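(* Let $\|\cdot\|_{X}$ be a function quasi-norm and let $T$ be a Calderón-Zygmund operator on $\mathbb{R}^d$ whose modulus of continuity $\omega$ satisfies the logarithmic Dini condition $$\int_0^1\omega(t)\Bigl(1+\log\frac1t\Bigr)\frac{dt}{t}<\infty.$$ Then there is a constant $C>0$, depending only on $d$, $T$ and the quasi-norm $\|\cdot\|_X$, such that for every integrable function $f$ on $\mathbb{R}^d$ $$\|Tf\|_X\le C\sup_{\mathscr{D},\mathcal{S}}\bigl\|\mathcal{A}^0_{\mathcal{S}}|f|\bigr\|_X,$$ where the supremum is taken over all dyadic grids $\mathscr{D}$ and all sparse collections $\mathcal{S}\subset\mathscr{D}$.
   Context: A function quasi-norm is a map $\|\cdot\|_X$ from the measurable functions on $\mathbb{R}^d$ to $[0,\infty]$ such that: (P1) there is a constant $C_X>0$ with $\|f+g\|_X\le C_X(\|f\|_X+\|g\|_X)$; (P2) $\|\lambda f\|_X=|\lambda|\|f\|_X$ for all $\lambda\in\mathbb{C}$; (P3) if $|f(x)|\le|g(x)|$ almost everywhere then $\|f\|_X\le\|g\|_X$; (P4) $\|\liminf_{n\to\infty}f_n\|_X\le\liminf_{n\to\infty}\|f_n\|_X$ for sequences of nonnegative measurable functions. A dyadic grid is any dyadic lattice of cubes in $\mathbb{R}^d$ with sides parallel to the axes. A collection $\mathcal{S}$ of cubes belonging to the same dyadic grid is sparse if for every $Q\in\mathcal{S}$ there is a measurable $E(Q)\subset Q$ with $|E(Q)|\ge\frac12|Q|$ and $E(Q)\cap E(Q')=\emptyset$ for distinct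 $Q,Q'\in\mathcal{S}$. With $\langle f\rangle_Q=\frac1{|Q|}\int_Q f$, set $\mathcal{A}^0_{\mathcal{S}}f(x)=\sum_{Q\in\mathcal{S}}\langle f\rangle_Q\mathbb{1}_Q(x)$. A Calderón-Zygmund operator with modulus of continuity $\omega$ is a linear operator $T$ which extends to a bounded operator from $L^q(\mathbb{R}^d)$ to $L^q(\mathbb{R}^d)$ for some $1\le q<\infty$ and such that for appropriate $f$ (e.g. bounded with compact support) $$Tf(x)=\int_{\mathbb{R}^d}K(x,y)f(y)\,dy\qquad\text{for all }x\notin\operatorname{supp}f,$$ where for some constants $A,C_K$ the kernel satisfies $|K(x,y)|\le A|x-y|^{-d}$ and $$|K(x,y)-K(x',y)|\le C_K\,\omega\Bigl(\frac{|x-x'|}{|x-y|}\Bigr)\frac1{|x-y|^d},\qquad |K(x,y)-K(x,y')|\le C_K\,\omega\Bigl(\frac{|y-y'|}{|x-y|}\Bigr)\frac1{|x-y|^d}$$ whenever $|x-x'|\le\frac12|x-y|$, respectively $|y-y'|\le\frac12|x-y|$. Here $\omega:[0,\infty)\to[0,\infty)$ is positive on $(0,\infty)$, nondecreasing, continuous and doubling (there is a constant $D$ with $\omega(2t)\le D\,\omega(t)$ for $t>0$). *)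

theory Defs
  imports "HOL-Analysis.Analysis"
begin

section \<open>Function quasi-norms\<close>

text \<open>
  Measurable functions are complex valued, so the Fatou property is stated for those sequences
  whose lower limit is finite almost everywhere, that is, whose lower limit \<open>g\<close> is again a function
  of the kind the quasi-norm is applied to.
\<close>

definition function_quasinorm :: "((real^'n \<Rightarrow> complex) \<Rightarrow> ennreal) \<Rightarrow> bool" where
  "function_quasinorm X \<longleftrightarrow>
     (\<exists>C>0. \<forall>f\<in>borel_measurable lebesgue. \<forall>g\<in>borel_measurable lebesgue.
        X (\<lambda>x. f x + g x) \<le> ennreal C * (X f + X g)) \<and>
     (\<forall>c. \<forall>f\<in>borel_measurable lebesgue. X (\<lambda>x. c * f x) = ennreal (cmod c) * X f) \<and>
     (\<forall>f\<in>borel_measurable lebesgue. \<forall>g\<in>borel_measurable lebesgue.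
        (AE x in lebesgue. cmod (f x) \<le> cmod (g x)) \<longrightarrow> X f \<le> X g) \<and>
     (\<forall>(F :: nat \<Rightarrow> real^'n \<Rightarrow> real) g.
        (\<forall>n. F n \<in> borel_measurable lebesgue \<and> (\<forall>x. 0 \<le> F n x)) \<and>
        g \<in> borel_measurable lebesgue \<and>
        (AE x in lebesgue. ereal (g x) = liminf (\<lambda>n. ereal (F n x))) \<longrightarrow>
        X (\<lambda>x. of_real (g x)) \<le> liminf (\<lambda>n. X (\<lambda>x. of_real (F n x))))"

section \<open>Dyadic grids and sparse operators\<close>

definition half_open_cube :: "real^'n \<Rightarrow> real \<Rightarrow> (real^'n) set" where
  "half_open_cube a l = {x. \<forall>i. a $ i \<le> x $ i \<and> x $ i < a $ i + l}"

definition dyadic_grid :: "(real^'n) set set \<Rightarrow> bool" where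
  "dyadic_grid \<D> \<longleftrightarrow>
     (\<forall>Q\<in>\<D>. \<exists>a (k::int). Q = half_open_cube a (2 powi k)) \<and>
     (\<forall>Q\<in>\<D>. \<forall>R\<in>\<D>. Q \<inter> R \<in> {Q, R, {}}) \<and>
     (\<forall>k::int. partition_on UNIV {Q \<in> \<D>. \<exists>a. Q = half_open_cube a (2 powi k)})"

definition sparse_collection :: "(real^'n) set set \<Rightarrow> bool" where
  "sparse_collection \<S> \<longleftrightarrow>
     (\<exists>E. (\<forall>Q\<in>\<S>. E Q \<in> sets lebesgue \<and> E Q \<subseteq> Q \<and>
                   measure lebesgue (E Q) \<ge> measure lebesgue Q / 2) \<and>
          (\<forall>Q\<in>\<S>. \<forall>R\<in>\<S>. Q \<noteq> R \<longrightarrow> E Q \<inter> E R = {}))"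

definition average :: "(real^'n \<Rightarrow> real) \<Rightarrow> (real^'n) set \<Rightarrow> real" where
  "average f Q = (LINT x:Q|lebesgue. f x) / measure lebesgue Q"

text \<open>
  For integrable \<open>f \<ge> 0\<close> and a sparse subcollection \<open>\<S>\<close> of a dyadic grid, the sum is finite for
  almost every \<open>x\<close>; on the exceptional null set \<^const>\<open>infsum\<close> takes the value 0, which a
  function quasi-norm does not see.
\<close>

definition sparse_operator :: "(real^'n) set set \<Rightarrow> (real^'n \<Rightarrow> real) \<Rightarrow> real^'n \<Rightarrow> real" where
  "sparse_operator \<S> f x = (\<Sum>\<^sub>\<infinity>Q\<in>\<S>. average f Q * indicator Q x)"

section \<open>Calderon-Zygmund operators\<close>

definition modulus_of_continuity :: "(real \<Rightarrow> real) \<Rightarrow> bool" where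
  "modulus_of_continuity \<omega> \<longleftrightarrow>
     0 \<le> \<omega> 0 \<and> (\<forall>t>0. 0 < \<omega> t) \<and> mono_on {0..} \<omega> \<and> continuous_on {0..} \<omega> \<and>
     (\<exists>D. \<forall>t>0. \<omega> (2 * t) \<le> D * \<omega> t)"

definition log_Dini :: "(real \<Rightarrow> real) \<Rightarrow> bool" where
  "log_Dini \<omega> \<longleftrightarrow> (\<integral>\<^sup>+t\<in>{0<..<1}. ennreal (\<omega> t * (1 + ln (1 / t)) / t) \<partial>lborel) < \<infinity>"

definition Lp_space :: "real \<Rightarrow> (real^'n \<Rightarrow> complex) set" where
  "Lp_space q = {f \<in> borel_measurable lebesgue. integrable lebesgue (\<lambda>x. cmod (f x) powr q)}"

definition Lp_norm :: "real \<Rightarrow> (real^'n \<Rightarrow> complex) \<Rightarrow> real" where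
  "Lp_norm q f = (LINT x|lebesgue. cmod (f x) powr q) powr (1 / q)"

definition supp :: "(real^'n \<Rightarrow> complex) \<Rightarrow> (real^'n) set" where
  "supp f = closure {x. f x \<noteq> 0}"

definition bounded_compactly_supported :: "(real^'n \<Rightarrow> complex) set" where
  "bounded_compactly_supported =
     {f \<in> borel_measurable lebesgue. bounded (range f) \<and> compact (supp f)}"

text \<open>
  Operators act on functions, but their values only matter up to null sets, so linearity and the
  kernel representation are required almost everywhere.
\<close>

definition linear_operator_on ::
  "(real^'n \<Rightarrow> complex) set \<Rightarrow> ((real^'n \<Rightarrow> complex) \<Rightarrow> real^'n \<Rightarrow> complex) \<Rightarrow> bool" where
  "linear_operator_on V T \<longleftrightarrow>
     (\<forall>f\<in>V. \<forall>g\<in>V. \<forall>a b. AE x in lebesgue. T (\<lambda>y. a * f y + b * g y) x = a * T f x + b * T g x)"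

definition bounded_operator_Lp ::
  "real \<Rightarrow> ((real^'n \<Rightarrow> complex) \<Rightarrow> real^'n \<Rightarrow> complex) \<Rightarrow> bool" where
  "bounded_operator_Lp q T \<longleftrightarrow>
     linear_operator_on (Lp_space q) T \<and> (\<forall>f\<in>Lp_space q. T f \<in> Lp_space q) \<and>
     (\<exists>B. \<forall>f\<in>Lp_space q. Lp_norm q (T f) \<le> B * Lp_norm q f)"

definition CZ_kernel :: "(real \<Rightarrow> real) \<Rightarrow> (real^'n \<Rightarrow> real^'n \<Rightarrow> complex) \<Rightarrow> bool" where
  "CZ_kernel \<omega> K \<longleftrightarrow>
     (\<exists>A. \<forall>x y. x \<noteq> y \<longrightarrow> cmod (K x y) \<le> A / norm (x - y) ^ CARD('n)) \<and>
     (\<exists>C\<^sub>K.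
        (\<forall>x x' y. x \<noteq> y \<and> norm (x - x') \<le> norm (x - y) / 2 \<longrightarrow>
           cmod (K x y - K x' y)
             \<le> C\<^sub>K * \<omega> (norm (x - x') / norm (x - y)) / norm (x - y) ^ CARD('n)) \<and>
        (\<forall>x y y'. x \<noteq> y \<and> norm (y - y') \<le> norm (x - y) / 2 \<longrightarrow>
           cmod (K x y - K x y')
             \<le> C\<^sub>K * \<omega> (norm (y - y') / norm (x - y)) / norm (x - y) ^ CARD('n)))"

definition CZ_operator ::
  "(real \<Rightarrow> real) \<Rightarrow> ((real^'n \<Rightarrow> complex) \<Rightarrow> real^'n \<Rightarrow> complex) \<Rightarrow> bool" where
  "CZ_operator \<omega> T \<longleftrightarrow>
     modulus_of_continuity \<omega> \<and>
     linear_operator_on bounded_compactly_supported T \<and>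
     (\<exists>q\<ge>1. \<exists>T'. bounded_operator_Lp q T' \<and>
        (\<forall>f\<in>bounded_compactly_supported. AE x in lebesgue. T' f x = T f x)) \<and>
     (\<exists>K. CZ_kernel \<omega> K \<and>
        (\<forall>f\<in>bounded_compactly_supported. AE x in lebesgue.
           x \<notin> supp f \<longrightarrow> T f x = (LINT y|lebesgue. K x y * f y)))"

definition converges_in_measure ::
  "(nat \<Rightarrow> real^'n \<Rightarrow> complex) \<Rightarrow> (real^'n \<Rightarrow> complex) \<Rightarrow> bool" where
  "converges_in_measure u g \<longleftrightarrow>
     (\<forall>\<epsilon>>0. (\<lambda>n. emeasure lebesgue {x. \<epsilon> < cmod (u n x - g x)}) \<longlonglongrightarrow> 0)"

text \<open>
  The meaning of \<open>T f\<close> for integrable \<open>f\<close>, which need not lie in the space \<open>L\<^sup>q\<close> on which \<open>T\<close> is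
  bounded: the extension by density of \<open>T\<close> from the bounded functions with compact support,
  continuous from \<open>L\<^sup>1\<close> to convergence in measure. For the operators considered here it exists by
  the weak type (1,1) estimate. It is determined up to a null set, and it agrees
  with \<open>T\<close> almost everywhere on bounded functions with compact support.
\<close>

definition L1_extension ::
  "((real^'n \<Rightarrow> complex) \<Rightarrow> real^'n \<Rightarrow> complex) \<Rightarrow> (real^'n \<Rightarrow> complex) \<Rightarrow> real^'n \<Rightarrow> complex" where
  "L1_extension T f =
     (SOME g. g \<in> borel_measurable lebesgue \<and>
        (\<forall>F. (\<forall>n. F n \<in> bounded_compactly_supported) \<and>
             (\<lambda>n. LINT x|lebesgue. cmod (F n x - f x)) \<longlonglongrightarrow> 0 \<longrightarrow>
             converges_in_measure (\<lambda>n. T (F n)) g))"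

end

theory Submission
  imports Defs
begin

text \<open>
  On a dyadic cube \<open>Q\<close>, the function \<open>T (f 1\<^bsub>3Q\<^esub>)\<close> is bounded by a multiple of the average of \<open>\<bar>f\<bar>\<close>
  over \<open>3Q\<close> outside a family of stopping cubes \<open>P\<close> filling at most half of \<open>Q\<close>; this is the weak
  type (1,1) of \<open>T\<close>. On a stopping cube the smoothness of the kernel controls the oscillation of
  \<open>T (f 1\<^bsub>3Q - 3P\<^esub>)\<close>, so that up to averages only \<open>T (f 1\<^bsub>3P\<^esub>)\<close> is left. Iterating bounds \<open>\<bar>T f\<bar>\<close>
  pointwise by a sparse sum of averages over triples (Lacey; Lerner and Ombrosi). Each triple lies in a
  comparable cube of one of finitely many shifted grids, and the families of cubes so obtained split
  into boundedly many sparse ones. The quasi-triangle inequality then gives the estimate for finite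
  subfamilies, and the Fatou property passes to the limit, first over the subfamilies, then over the
  cubes \<open>Q\<close>, and finally from bounded functions of compact support to integrable ones.
\<close>

section \<open>Cubes and shifted dyadic grids\<close>

text \<open>Each use of the quasi-triangle inequality costs its constant once more, so
  \<open>X\<close> cannot be applied to a sum of unboundedly many pieces. The pointwise bound has to
  end in a number of sparse operators that depends on the dimension alone:
  \<open>2 ^ CARD('n)\<close> shift patterns times \<open>4 * 16 ^ CARD('n)\<close> residue classes.
  The weak type constant is likewise fixed before any function is chosen. A second obstacle is that
  \<open>T\<close> is known only up to null sets on bounded functions of compact support, and its
  kernel formula only off the closed support. Hence cubes are indexed by a countable type, so that
  exceptional null sets can be united, and triples keep a margin of one side length between a cube
  and a function that vanishes on its triple. Open sets around superlevel sets take the place of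
  differentiation of integrals. The sparse bound holds at almost every point with a finite subfamily
  depending on the point; this exhibits the modulus of \<open>T f\<close> as a limit of functions
  dominated by finite sparse sums.\<close>

lemma mem_half_open_cube: "x \<in> half_open_cube a l \<longleftrightarrow> (\<forall>i. a $ i \<le> x $ i \<and> x $ i < a $ i + l)"
  by (simp add: half_open_cube_def)

lemma half_open_cube_borel [measurable, simp]: "half_open_cube a l \<in> sets borel"
proof -
  have "half_open_cube a l = (\<Inter>i. {x. a $ i \<le> x $ i} \<inter> {x. x $ i < a $ i + l})"
    by (auto simp: half_open_cube_def)
  moreover have "{x. a $ i \<le> x $ i} \<inter> {x. x $ i < a $ i + l} \<in> sets borel" for i
    by (intro sets.Int borel_closed borel_open closed_Collect_le open_Collect_less continuous_intros)
  ultimately show ?thesis by (auto intro!: sets.finite_INT)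
qed

lemma half_open_cube_lebesgue [measurable, simp]: "half_open_cube a l \<in> sets lebesgue"
  using half_open_cube_borel by (simp add: sets_completionI_sets)

lemma emeasure_half_open_cube:
  fixes a :: "real^'n"
  assumes "0 \<le> l"
  shows "emeasure lebesgue (half_open_cube a l) = ennreal (l ^ CARD('n))"
proof -
  define b where "b = (\<chi> i. a $ i + l)"
  have sub: "box a b \<subseteq> half_open_cube a l" "half_open_cube a l \<subseteq> cbox a b"
    by (auto simp: mem_half_open_cube b_def mem_box_cart less_imp_le)
  have le: "a \<bullet> e \<le> b \<bullet> e" and d: "(b - a) \<bullet> e = l" if "e \<in> Basis" for e
    using that assms by (auto simp: Basis_vec_def b_def inner_axis)
  have p: "(\<Prod>e\<in>Basis. (b - a) \<bullet> e) = l ^ CARD('n)"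
    using d by simp
  have "emeasure lborel (half_open_cube a l) = ennreal (l ^ CARD('n))"
  proof (rule antisym)
    show "emeasure lborel (half_open_cube a l) \<le> ennreal (l ^ CARD('n))"
      using emeasure_mono[OF sub(2), of lborel] le p by (simp add: emeasure_lborel_cbox)
    show "emeasure lborel (half_open_cube a l) \<ge> ennreal (l ^ CARD('n))"
      using emeasure_mono[OF sub(1), of lborel] le p by (simp add: emeasure_lborel_box)
  qed
  then show ?thesis by (simp add: emeasure_completion)
qed

lemma measure_half_open_cube:
  fixes a :: "real^'n"
  assumes "0 \<le> l"
  shows "measure lebesgue (half_open_cube a l) = l ^ CARD('n)"
  using emeasure_half_open_cube[OF assms, of a] assms by (simp add: measure_def)

text \<open>The points of the diagonal starting at \<open>a\<close> are tested. The end
  \<open>t = l\<close> is excluded from a half-open cube, so the upper bound is obtained by letting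
  \<open>t\<close> approach \<open>l\<close>.\<close>

lemma half_open_cube_subsetD:
  fixes a a' :: "real^'n"
  assumes "half_open_cube a l \<subseteq> half_open_cube a' l'" "0 < l"
  shows "a' $ i \<le> a $ i" "a $ i + l \<le> a' $ i + l'"
proof -
  have mem: "a' $ i \<le> a $ i + t \<and> a $ i + t < a' $ i + l'" if "0 \<le> t" "t < l" for t
  proof -
    have "(\<chi> i. a $ i + t) \<in> half_open_cube a l" using that by (simp add: mem_half_open_cube)
    then have "(\<chi> i. a $ i + t) \<in> half_open_cube a' l'" using assms(1) by blast
    then show ?thesis by (simp add: mem_half_open_cube)
  qed
  show "a' $ i \<le> a $ i" using mem[of 0] assms(2) by auto
  have "l \<le> a' $ i + l' - a $ i"
  proof (rule dense_le_bounded[OF assms(2)])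
    fix t assume "0 < t" "t < l"
    then show "t \<le> a' $ i + l' - a $ i" using mem[of t] by auto
  qed
  then show "a $ i + l \<le> a' $ i + l'" by simp
qed

text \<open>
  Consecutive offsets differ by \<open>\<plusminus> 2 powi k\<close>, so the cubes of the scales \<open>k\<close> and \<open>k + 1\<close> are nested,
  while at every scale the end points of the shifted and of the unshifted intervals are a third of
  the side length apart. The scale \<open>k\<close> belongs to the side length \<open>2 powi k\<close>: cubes grow with \<open>k\<close>.
\<close>

definition shift :: "('n \<Rightarrow> bool) \<Rightarrow> int \<Rightarrow> 'n \<Rightarrow> real" where
  "shift \<alpha> k i = (if \<alpha> i then (- 2) powi k / 3 else 0)"

text \<open>With this index, membership in a cube becomes an equation (\<open>mem_cube\<close>).
  Disjointness within a scale is then immediate, and nesting reduces to the fact that equal indices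
  stay equal at larger scales.\<close>

definition grid_index :: "('n::finite \<Rightarrow> bool) \<Rightarrow> int \<Rightarrow> real^'n \<Rightarrow> 'n \<Rightarrow> int" where
  "grid_index \<alpha> k x i = \<lfloor>(x $ i - shift \<alpha> k i) / 2 powi k\<rfloor>"

definition corner :: "('n::finite \<Rightarrow> bool) \<Rightarrow> int \<Rightarrow> ('n \<Rightarrow> int) \<Rightarrow> real^'n" where
  "corner \<alpha> k m = (\<chi> i. shift \<alpha> k i + 2 powi k * of_int (m i))"

definition cube :: "('n::finite \<Rightarrow> bool) \<Rightarrow> int \<Rightarrow> ('n \<Rightarrow> int) \<Rightarrow> (real^'n) set" where
  "cube \<alpha> k m = half_open_cube (corner \<alpha> k m) (2 powi k)"

definition triple_cube :: "('n::finite \<Rightarrow> bool) \<Rightarrow> int \<Rightarrow> ('n \<Rightarrow> int) \<Rightarrow> (real^'n) set" where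
  "triple_cube \<alpha> k m = half_open_cube (\<chi> i. corner \<alpha> k m $ i - 2 powi k) (3 * 2 powi k)"

definition grid :: "('n::finite \<Rightarrow> bool) \<Rightarrow> (real^'n) set set" where
  "grid \<alpha> = {cube \<alpha> k m | k m. True}"

lemma mem_cube: "x \<in> cube \<alpha> k m \<longleftrightarrow> grid_index \<alpha> k x = m"
proof -
  have p: "(2::real) powi k > 0" by simp
  have "\<lfloor>(x $ i - shift \<alpha> k i) / 2 powi k\<rfloor> = m i \<longleftrightarrow>
    corner \<alpha> k m $ i \<le> x $ i \<and> x $ i < corner \<alpha> k m $ i + 2 powi k" for i
    unfolding floor_eq_iff corner_def using p
    by (simp add: pos_le_divide_eq pos_divide_less_eq algebra_simps)
  then show ?thesis by (auto simp: cube_def mem_half_open_cube grid_index_def fun_eq_iff)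
qed

lemma mem_cube_corner: "x \<in> cube \<alpha> k m \<longleftrightarrow>
    (\<forall>i. corner \<alpha> k m $ i \<le> x $ i \<and> x $ i < corner \<alpha> k m $ i + 2 powi k)"
  by (simp add: cube_def mem_half_open_cube)

lemma mem_triple_cube_corner: "x \<in> triple_cube \<alpha> k m \<longleftrightarrow>
    (\<forall>i. corner \<alpha> k m $ i - 2 powi k \<le> x $ i \<and> x $ i < corner \<alpha> k m $ i + 2 * 2 powi k)"
  by (simp add: triple_cube_def mem_half_open_cube algebra_simps)

lemma cube_sets [measurable, simp]: "cube \<alpha> k m \<in> sets lebesgue" "cube \<alpha> k m \<in> sets borel"
  by (simp_all add: cube_def)

lemma triple_cube_sets [measurable, simp]: "triple_cube \<alpha> k m \<in> sets lebesgue" "triple_cube \<alpha> k m \<in> sets borel"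
  by (simp_all add: triple_cube_def)

lemma emeasure_cube [simp]:
  "emeasure lborel (cube \<alpha> k m :: (real^'n) set) = ennreal ((2 powi k) ^ CARD('n))"
  using emeasure_half_open_cube[of "2 powi k" "corner \<alpha> k m"] by (simp add: cube_def)

lemma measure_cube [simp]: "measure lborel (cube \<alpha> k m :: (real^'n) set) = (2 powi k) ^ CARD('n)"
  using measure_half_open_cube[of "2 powi k" "corner \<alpha> k m"] by (simp add: cube_def)

lemma emeasure_triple_cube [simp]:
  "emeasure lborel (triple_cube \<alpha> k m :: (real^'n) set) = ennreal (3 ^ CARD('n) * (2 powi k) ^ CARD('n))"
  using emeasure_half_open_cube[of "3 * 2 powi k"] by (simp add: triple_cube_def power_mult_distrib)

lemma measure_triple_cube [simp]: "measure lborel (triple_cube \<alpha> k m :: (real^'n) set) = 3 ^ CARD('n) * (2 powi k) ^ CARD('n)"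
  using measure_half_open_cube[of "3 * 2 powi k"] by (simp add: triple_cube_def power_mult_distrib)

lemma floor_half: "\<lfloor>t / 2\<rfloor> = \<lfloor>t::real\<rfloor> div 2"
  using floor_divide_real_eq_div[of 2 t] by simp

text \<open>The index at the next scale is a function of the present one: add an integer
  \<open>e\<close> that depends only on the scale and the coordinate, halve, and round down.\<close>

lemma grid_index_Suc:
  assumes "grid_index \<alpha> k x = grid_index \<alpha> k y"
  shows "grid_index \<alpha> (k + 1) x = grid_index \<alpha> (k + 1) y"
proof
  fix i
  define e :: int where "e = (if \<alpha> i then (if even k then 1 else -1) else 0)"
  have m2: "(- 2::real) powi k = (if even k then 1 else -1) * 2 powi k"
    by (auto simp: power_int_minus_left)
  have e: "(shift \<alpha> k i - shift \<alpha> (k + 1) i) / 2 powi k = of_int e"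
    unfolding shift_def e_def by (simp add: power_int_add m2)
  have "grid_index \<alpha> (k + 1) z i = (grid_index \<alpha> k z i + e) div 2" for z :: "real^'a"
  proof -
    have "(z $ i - shift \<alpha> (k + 1) i) / 2 powi (k + 1)
        = ((z $ i - shift \<alpha> k i) / 2 powi k + of_int e) / 2"
      unfolding e[symmetric] by (simp add: power_int_add field_simps)
    then show ?thesis by (simp only: grid_index_def floor_half floor_add_int)
  qed
  then show "grid_index \<alpha> (k + 1) x i = grid_index \<alpha> (k + 1) y i" using assms by simp
qed

lemma grid_index_mono:
  assumes "grid_index \<alpha> k x = grid_index \<alpha> k y" "k \<le> k'"
  shows "grid_index \<alpha> k' x = grid_index \<alpha> k' y"
  using assms(2)
proof (induction k' rule: int_ge_induct)
  case base
  show ?case by (rule assms(1))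
next
  case (step j)
  show ?case by (rule grid_index_Suc[OF step.IH])
qed

lemma cube_subset:
  assumes "x \<in> cube \<alpha> k m" "x \<in> cube \<alpha> k' m'" "k \<le> k'"
  shows "cube \<alpha> k m \<subseteq> cube \<alpha> k' m'"
proof
  fix y assume "y \<in> cube \<alpha> k m"
  then have "grid_index \<alpha> k x = grid_index \<alpha> k y" using assms(1) by (simp add: mem_cube)
  from grid_index_mono[OF this assms(3)] show "y \<in> cube \<alpha> k' m'" using assms(2) by (simp add: mem_cube)
qed

lemma cube_nonempty: "corner \<alpha> k m \<in> cube \<alpha> k m"
  by (simp add: cube_def mem_half_open_cube)

lemma cube_triple_cube: "cube \<alpha> k m \<subseteq> triple_cube \<alpha> k m"
proof
  fix x assume x: "x \<in> cube \<alpha> k m"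
  have "0 < (2::real) powi k" by simp
  then have "corner \<alpha> k m $ i - 2 powi k \<le> x $ i \<and> x $ i < corner \<alpha> k m $ i + 2 * 2 powi k" for i
    using x[unfolded mem_cube_corner, rule_format, of i] by linarith
  then show "x \<in> triple_cube \<alpha> k m" unfolding mem_triple_cube_corner by blast
qed

lemma triple_cube_subset:
  fixes m :: "'n::finite \<Rightarrow> int"
  assumes "x \<in> cube \<alpha> k m" "x \<in> cube \<alpha> k' m'" "k \<le> k'"
  shows "triple_cube \<alpha> k m \<subseteq> triple_cube \<alpha> k' m'"
proof -
  have "cube \<alpha> k m \<subseteq> cube \<alpha> k' m'" by (rule cube_subset[OF assms])
  then have *: "corner \<alpha> k' m' $ i \<le> corner \<alpha> k m $ i"
      "corner \<alpha> k m $ i + 2 powi k \<le> corner \<alpha> k' m' $ i + 2 powi k'" for i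
    using half_open_cube_subsetD[of "corner \<alpha> k m" "2 powi k" "corner \<alpha> k' m'" "2 powi k'"]
    by (auto simp: cube_def)
  have l: "(2::real) powi k \<le> 2 powi k'"
    using assms(3) by (simp add: power_int_increasing)
  show ?thesis
  proof
    fix y assume y: "y \<in> triple_cube \<alpha> k m"
    have "corner \<alpha> k' m' $ i - 2 powi k' \<le> y $ i \<and> y $ i < corner \<alpha> k' m' $ i + 2 * 2 powi k'" for i
      using y[unfolded mem_triple_cube_corner, rule_format, of i] *[of i] l by linarith
    then show "y \<in> triple_cube \<alpha> k' m'" unfolding mem_triple_cube_corner by blast
  qed
qed

text \<open>Some coordinate of \<open>x\<close> leaves the tripled interval, whose margin around the
  original interval is one side length. This separation is what makes the kernel estimates
  applicable.\<close>

lemma dist_outside_triple_cube: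
  fixes x y :: "real^'n"
  assumes "y \<in> cube \<alpha> k m" "x \<notin> triple_cube \<alpha> k m"
  shows "2 powi k \<le> norm (x - y)"
proof -
  obtain i where "\<not> (corner \<alpha> k m $ i - 2 powi k \<le> x $ i \<and> x $ i < corner \<alpha> k m $ i + 2 * 2 powi k)"
    using assms(2) unfolding mem_triple_cube_corner by blast
  moreover have "corner \<alpha> k m $ i \<le> y $ i \<and> y $ i < corner \<alpha> k m $ i + 2 powi k"
    using assms(1) unfolding mem_cube_corner by blast
  ultimately have "2 powi k \<le> \<bar>(x - y) $ i\<bar>" by auto
  then show ?thesis using component_le_norm_cart[of "x - y" i] by linarith
qed

lemma diam_cube:
  fixes x y :: "real^'n"
  assumes "y \<in> cube \<alpha> k m" "x \<in> cube \<alpha> k m"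
  shows "norm (x - y) \<le> CARD('n) * 2 powi k"
proof -
  have "\<bar>(x - y) $ i\<bar> \<le> 2 powi k" for i
  proof -
    have "corner \<alpha> k m $ i \<le> y $ i \<and> y $ i < corner \<alpha> k m $ i + 2 powi k"
      "corner \<alpha> k m $ i \<le> x $ i \<and> x $ i < corner \<alpha> k m $ i + 2 powi k"
      using assms unfolding mem_cube_corner by blast+
    then show ?thesis by auto
  qed
  then have "(\<Sum>i\<in>UNIV. \<bar>(x - y) $ i\<bar>) \<le> (\<Sum>i\<in>(UNIV::'n set). 2 powi k)" by (intro sum_mono) auto
  then show ?thesis using norm_le_l1_cart[of "x - y"] by simp
qed

text \<open>The kernel formula holds off the closed support. The margin of the triple is positive,
  so removing \<open>triple_cube\<close> from a set also keeps its closure away from the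
  cube.\<close>

lemma not_in_closure_outside_triple_cube:
  assumes "y \<in> cube \<alpha> k m" "S \<inter> triple_cube \<alpha> k m = {}"
  shows "y \<notin> closure S"
proof
  assume "y \<in> closure S"
  then obtain x where "x \<in> S" "dist x y < 2 powi k"
    unfolding closure_approachable by (force dest: spec[of _ "2 powi k"])
  moreover have "x \<notin> triple_cube \<alpha> k m" using \<open>x \<in> S\<close> assms(2) by auto
  ultimately show False using dist_outside_triple_cube[OF assms(1)] by (fastforce simp: dist_norm)
qed

lemma closure_cube_subset_triple_cube: "closure (cube \<alpha> k m) \<subseteq> triple_cube \<alpha> k m"
proof
  fix x assume "x \<in> closure (cube \<alpha> k m)"
  then obtain y where "y \<in> cube \<alpha> k m" "dist y x < 2 powi k"
    unfolding closure_approachable by (force dest: spec[of _ "2 powi k"])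
  then show "x \<in> triple_cube \<alpha> k m" using dist_outside_triple_cube[of y \<alpha> k m x]
    by (auto simp: dist_norm norm_minus_commute)
qed

lemma real_less_two_power_int: "\<exists>n::nat. (r::real) < 2 powi (k + int n)"
proof -
  obtain n where "r / 2 powi k < 2 ^ n" using real_arch_pow[of 2 "r / 2 powi k"] by auto
  then show ?thesis by (intro exI[of _ n]) (simp add: power_int_add field_simps)
qed

text \<open>The ancestors of a point need not fill the space: in the unshifted grid they stay in one
  orthant. Their triples do fill it, since each contains a ball around the point whose radius is the
  side length. Annuli are therefore formed from triples of ancestors.\<close>

lemma ancestors_exhaust:
  fixes x y :: "real^'n"
  shows "\<exists>n. x \<in> triple_cube \<alpha> (k + int n) (grid_index \<alpha> (k + int n) y)"
proof -
  obtain n where "norm (x - y) < 2 powi (k + int n)" using real_less_two_power_int by blast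
  then show ?thesis using dist_outside_triple_cube[of y \<alpha> "k + int n" "grid_index \<alpha> (k + int n) y" x]
    by (intro exI[of _ n]) (force simp: mem_cube)
qed

text \<open>
  The one-third trick: the interval has length \<open>3 / 16\<close> of the side at scale \<open>k + 4\<close>, so it cannot
  contain end points of both the shifted and the unshifted intervals.
\<close>

lemma third_shift_interval:
  fixes u :: real
  obtains b where "u + 3 * 2 powi k \<le> (if b then (-2) powi (k + 4) / 3 else 0)
     + 2 powi (k + 4) * (of_int \<lfloor>(u - (if b then (-2) powi (k + 4) / 3 else 0)) / 2 powi (k + 4)\<rfloor> + 1)"
proof (rule ccontr)
  define L where "L = (2::real) powi (k + 4)"
  define s where "s = (-2::real) powi (k + 4)"
  have L0: "L > 0" unfolding L_def by simp
  have l: "3 * 2 powi k = 3 * L / 16" unfolding L_def by (simp add: power_int_add)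
  have s: "s = L \<or> s = - L" unfolding L_def s_def by (auto simp: power_int_minus_left)
  define n0 where "n0 = \<lfloor>u / L\<rfloor>"
  define n1 where "n1 = \<lfloor>(u - s / 3) / L\<rfloor>"
  assume "\<not> thesis"
  then have "\<not> (u + 3 * 2 powi k \<le> L * (of_int n0 + 1))" "\<not> (u + 3 * 2 powi k \<le> s / 3 + L * (of_int n1 + 1))"
    using that[of False] that[of True] unfolding L_def s_def n0_def n1_def by auto
  then have a: "L * (of_int n0 + 1) < u + 3 * L / 16" "s / 3 + L * (of_int n1 + 1) < u + 3 * L / 16"
    unfolding l by auto
  have "u / L < of_int n0 + 1" "(u - s/3) / L < of_int n1 + 1"
    unfolding n0_def n1_def by linarith+
  then have b: "u < L * (of_int n0 + 1)" "u < s / 3 + L * (of_int n1 + 1)"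
    using L0 by (simp_all add: field_simps)
  have "\<bar>L * (of_int (n0 - n1)) - s / 3\<bar> < 3 * L / 16"
    using a b unfolding abs_less_iff of_int_diff distrib_left right_diff_distrib by (intro conjI) linarith+
  then have "\<exists>t::real. \<bar>t\<bar> = 1/3 \<and> \<bar>L * (of_int (n0 - n1) - t)\<bar> < L * (3 / 16)"
    using s L0 by (intro exI[of _ "s / (3 * L)"]) (auto simp: right_diff_distrib)
  then obtain t :: real where t: "\<bar>t\<bar> = 1/3" "\<bar>of_int (n0 - n1) - t\<bar> < 3 / 16"
    using L0 by (auto simp: abs_mult)
  then have "\<bar>real_of_int (n0 - n1)\<bar> < 1" by linarith
  then have "n0 - n1 = 0" by linarith
  then show False using t by simp
qed

text \<open>The interval lemma is applied in each coordinate separately, so \<open>\<beta>\<close>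
  may mix shifted and unshifted coordinates and \<open>2 ^ CARD('n)\<close> grids suffice. The
  argument needs the relative length \<open>3 / 2 ^ j\<close> to be below one third, and
  \<open>j = 4\<close> is the first exponent that achieves this.\<close>

lemma triple_cube_in_shifted_cube:
  fixes m :: "'n::finite \<Rightarrow> int"
  shows "\<exists>\<beta> m'. triple_cube \<alpha> k m \<subseteq> cube \<beta> (k + 4) m'"
proof -
  define u where "u i = corner \<alpha> k m $ i - 2 powi k" for i
  have "\<exists>b. u i + 3 * 2 powi k \<le> (if b then (-2) powi (k + 4) / 3 else 0)
     + 2 powi (k + 4) * (of_int \<lfloor>(u i - (if b then (-2) powi (k + 4) / 3 else 0)) / 2 powi (k + 4)\<rfloor> + 1)" for i
    using third_shift_interval[of "u i" k] by blast
  then obtain \<beta> where "u i + 3 * 2 powi k \<le> (if \<beta> i then (-2) powi (k + 4) / 3 else 0)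
     + 2 powi (k + 4) * (of_int \<lfloor>(u i - (if \<beta> i then (-2) powi (k + 4) / 3 else 0)) / 2 powi (k + 4)\<rfloor> + 1)" for i
    by metis
  then have \<beta>: "u i + 3 * 2 powi k \<le> shift \<beta> (k + 4) i
     + 2 powi (k + 4) * (of_int \<lfloor>(u i - shift \<beta> (k + 4) i) / 2 powi (k + 4)\<rfloor> + 1)" for i
    unfolding shift_def .
  \<comment> \<open>Choosing the cube that contains the lower corner of the triple settles all left
    end points; the interval lemma supplies the right ones.\<close>
  define m' where "m' = grid_index \<beta> (k + 4) (\<chi> i. u i)"
  have "(\<chi> i. u i) \<in> cube \<beta> (k + 4) m'" by (simp add: mem_cube m'_def)
  then have lo: "corner \<beta> (k + 4) m' $ i \<le> u i" for i
    by (simp add: cube_def mem_half_open_cube)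
  have hi: "u i + 3 * 2 powi k \<le> corner \<beta> (k + 4) m' $ i + 2 powi (k + 4)" for i
    using \<beta>[of i] by (simp add: corner_def m'_def grid_index_def algebra_simps)
  have "triple_cube \<alpha> k m \<subseteq> cube \<beta> (k + 4) m'"
  proof
    fix x assume "x \<in> triple_cube \<alpha> k m"
    then have "u i \<le> x $ i \<and> x $ i < u i + 3 * 2 powi k" for i
      by (auto simp: triple_cube_def mem_half_open_cube u_def)
    then have "corner \<beta> (k + 4) m' $ i \<le> x $ i \<and> x $ i < corner \<beta> (k + 4) m' $ i + 2 powi (k + 4)" for i
      using lo[of i] hi[of i] by (meson le_less_trans less_le_trans order_trans)
    then show "x \<in> cube \<beta> (k + 4) m'" by (auto simp: cube_def mem_half_open_cube)
  qed
  then show ?thesis by blast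
qed

lemma half_open_cube_eq_side:
  assumes "half_open_cube a l = half_open_cube a' l'" "0 < l" "0 < l'"
  shows "l = l'"
  using half_open_cube_subsetD[of a l a' l' undefined] half_open_cube_subsetD[of a' l' a l undefined] assms
  by fastforce

lemma cube_eq_scale:
  assumes "cube \<alpha> k m = half_open_cube a (2 powi k')" shows "k = k'"
proof -
  have "(2::real) powi k = 2 powi k'"
    using half_open_cube_eq_side[of _ "2 powi k" a "2 powi k'"] assms by (simp add: cube_def)
  then show ?thesis by (cases k k' rule: linorder_cases) (auto dest: power_int_strict_increasing[where a = "2::real"])
qed

lemma grid_nested:
  assumes "Q \<in> grid \<alpha>" "R \<in> grid \<alpha>"
  shows "Q \<inter> R = {} \<or> Q \<subseteq> R \<or> R \<subseteq> Q"
proof -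
  obtain k m k' m' where *: "Q = cube \<alpha> k m" "R = cube \<alpha> k' m'" using assms by (auto simp: grid_def)
  then show ?thesis using cube_subset[of _ \<alpha> k m k' m'] cube_subset[of _ \<alpha> k' m' k m]
    unfolding * by (cases "k \<le> k'") auto
qed

lemma dyadic_grid_grid: "dyadic_grid (grid \<alpha>)"
  unfolding dyadic_grid_def
proof (intro conjI ballI allI)
  fix Q assume "Q \<in> grid \<alpha>"
  then show "\<exists>a (k::int). Q = half_open_cube a (2 powi k)" by (auto simp: grid_def cube_def)
next
  fix Q R assume "Q \<in> grid \<alpha>" "R \<in> grid \<alpha>"
  then show "Q \<inter> R \<in> {Q, R, {}}" using grid_nested[of Q \<alpha> R] by auto
next
  fix k :: int
  have eq: "{Q \<in> grid \<alpha>. \<exists>a. Q = half_open_cube a (2 powi k)} = range (cube \<alpha> k)"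
  proof -
    have "Q \<in> range (cube \<alpha> k)" if "Q \<in> grid \<alpha>" "Q = half_open_cube a (2 powi k)" for Q a
    proof -
      obtain k' m where km: "Q = cube \<alpha> k' m" using \<open>Q \<in> grid \<alpha>\<close> by (auto simp: grid_def)
      then have "k' = k" using cube_eq_scale[of \<alpha> k' m a k] that(2) by simp
      then show ?thesis using km by blast
    qed
    moreover have "cube \<alpha> k m \<in> grid \<alpha> \<and> (\<exists>a. cube \<alpha> k m = half_open_cube a (2 powi k))" for m
      by (auto simp: grid_def cube_def)
    ultimately show ?thesis by blast
  qed
  show "partition_on UNIV {Q \<in> grid \<alpha>. \<exists>a. Q = half_open_cube a (2 powi k)}"
    unfolding eq partition_on_def disjoint_def
  proof (intro conjI ballI impI)
    show "\<Union> (range (cube \<alpha> k)) = UNIV" by (auto simp: mem_cube)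
    show "{} \<notin> range (cube \<alpha> k)" using cube_nonempty by fastforce
  next
    fix p q assume "p \<in> range (cube \<alpha> k)" "q \<in> range (cube \<alpha> k)" "p \<noteq> q"
    then show "p \<inter> q = {}" by (auto simp: mem_cube)
  qed
qed

section \<open>Maximal cubes and sparse families\<close>

text \<open>Cubes are handled as pairs of scale and index. Such pairs form a countable type and
  carry their scale visibly, which a bare set does not.\<close>

abbreviation icube :: "('n::finite \<Rightarrow> bool) \<Rightarrow> int \<times> ('n \<Rightarrow> int) \<Rightarrow> (real^'n) set" where
  "icube \<alpha> p \<equiv> cube \<alpha> (fst p) (snd p)"

text \<open>Cubes of one scale are equal or disjoint, so asking for a larger scale is the same as
  asking for proper containment.\<close>

definition maximal_cubes ::
  "('n::finite \<Rightarrow> bool) \<Rightarrow> (int \<times> ('n \<Rightarrow> int)) set \<Rightarrow> (int \<times> ('n \<Rightarrow> int)) set" where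
  "maximal_cubes \<alpha> C = {p \<in> C. \<forall>q\<in>C. fst p < fst q \<longrightarrow> \<not> icube \<alpha> p \<subseteq> icube \<alpha> q}"

lemma maximal_cubes_subset: "maximal_cubes \<alpha> C \<subseteq> C"
  by (auto simp: maximal_cubes_def)

lemma countable_icube_index: "countable (C :: (int \<times> ('n::finite \<Rightarrow> int)) set)"
  by (rule countableI_type)

lemma maximal_cubes_disjoint: "disjoint_family_on (icube \<alpha>) (maximal_cubes \<alpha> C)"
  unfolding disjoint_family_on_def
proof (intro ballI impI, rule ccontr)
  fix p q assume pq: "p \<in> maximal_cubes \<alpha> C" "q \<in> maximal_cubes \<alpha> C" "p \<noteq> q" "icube \<alpha> p \<inter> icube \<alpha> q \<noteq> {}"
  then obtain x where x: "x \<in> icube \<alpha> p" "x \<in> icube \<alpha> q" by auto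
  then have "fst p \<noteq> fst q" using pq(3) by (auto simp: mem_cube prod_eq_iff)
  moreover have "\<not> fst p < fst q" "\<not> fst q < fst p"
    using pq(1,2) x cube_subset[of x \<alpha> "fst p" "snd p" "fst q" "snd q"]
      cube_subset[of x \<alpha> "fst q" "snd q" "fst p" "snd p"]
    unfolding maximal_cubes_def by (auto intro: less_imp_le)
  ultimately show False by auto
qed

text \<open>The cubes through a given point form a chain with exactly one member per scale. A bound
  on the scales from above therefore gives a largest member of \<open>C\<close> through the
  point.\<close>

lemma Union_maximal_cubes:
  assumes "\<And>p. p \<in> C \<Longrightarrow> fst p \<le> K"
  shows "(\<Union>p\<in>maximal_cubes \<alpha> C. icube \<alpha> p) = (\<Union>p\<in>C. icube \<alpha> p)"
proof (intro antisym subsetI)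
  fix x assume "x \<in> (\<Union>p\<in>C. icube \<alpha> p)"
  then obtain p where p: "p \<in> C" "x \<in> icube \<alpha> p" by auto
  define A where "A = {k. (k, grid_index \<alpha> k x) \<in> C \<and> fst p \<le> k}"
  have "finite A" using assms by (intro finite_subset[of A "{fst p..K}"]) (auto simp: A_def)
  moreover have "fst p \<in> A" using p by (auto simp: A_def mem_cube)
  ultimately have M: "Max A \<in> A" and le: "\<And>k. k \<in> A \<Longrightarrow> k \<le> Max A" by (auto intro: Max_in)
  have "(Max A, grid_index \<alpha> (Max A) x) \<in> maximal_cubes \<alpha> C"
    unfolding maximal_cubes_def
  proof (intro CollectI conjI ballI impI notI)
    show "(Max A, grid_index \<alpha> (Max A) x) \<in> C" using M by (simp add: A_def)
    fix q assume q: "q \<in> C" "fst (Max A, grid_index \<alpha> (Max A) x) < fst q"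
      "icube \<alpha> (Max A, grid_index \<alpha> (Max A) x) \<subseteq> icube \<alpha> q"
    have "x \<in> icube \<alpha> (Max A, grid_index \<alpha> (Max A) x)" by (simp add: mem_cube)
    then have "x \<in> icube \<alpha> q" using q(3) by blast
    then have "q = (fst q, grid_index \<alpha> (fst q) x)" by (simp add: mem_cube prod_eq_iff)
    then have "fst q \<in> A" using q(1,2) M by (auto simp: A_def)
    then show False using le[of "fst q"] q(2) by auto
  qed
  then show "x \<in> (\<Union>p\<in>maximal_cubes \<alpha> C. icube \<alpha> p)"
    by (force simp: mem_cube)
qed (use maximal_cubes_subset in blast)

section \<open>The dyadic maximal function and cubes inside open sets\<close>

lemma emeasure_disjoint_cubes_le:
  fixes h :: "real^'n \<Rightarrow> real"
  assumes h: "integrable lebesgue h" "\<And>x. 0 \<le> h x" and "0 < c"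
    and C: "\<And>p. p \<in> C \<Longrightarrow> c * (2 powi fst p) ^ CARD('n) \<le> (LINT x:icube \<alpha> p|lebesgue. h x)"
    and disj: "disjoint_family_on (icube \<alpha>) C"
  shows "emeasure lebesgue (\<Union>p\<in>C. icube \<alpha> p) \<le> ennreal ((LINT x|lebesgue. h x) / c)"
proof -
  have hm [measurable]: "h \<in> borel_measurable lebesgue" using h(1) by auto
  have int: "set_integrable lebesgue (icube \<alpha> p) h" for p
    unfolding set_integrable_def using h(1) by (intro integrable_mult_indicator) auto
  have meas: "emeasure lebesgue (icube \<alpha> p) \<le> ennreal (1 / c) * (\<integral>\<^sup>+x\<in>icube \<alpha> p. ennreal (h x) \<partial>lebesgue)"
    if "p \<in> C" for p
  proof -
    have "(\<integral>\<^sup>+x\<in>icube \<alpha> p. ennreal (h x) \<partial>lebesgue) = ennreal (LINT x:icube \<alpha> p|lebesgue. h x)"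
      using int[of p] h(2) unfolding set_integrable_def set_lebesgue_integral_def
      by (subst nn_integral_eq_integral[symmetric]) (auto intro!: nn_integral_cong simp: indicator_def)
    moreover have "(2 powi fst p) ^ CARD('n) \<le> 1 / c * (LINT x:icube \<alpha> p|lebesgue. h x)"
      using C[OF that] \<open>0 < c\<close> by (simp add: field_simps)
    moreover have "emeasure lebesgue (icube \<alpha> p) = ennreal ((2 powi fst p) ^ CARD('n))" by simp
    ultimately show ?thesis using \<open>0 < c\<close>
      by (simp only: ennreal_mult'[symmetric] ennreal_leI divide_nonneg_pos zero_le_one)
  qed
  have "emeasure lebesgue (\<Union>p\<in>C. icube \<alpha> p) = (\<integral>\<^sup>+p. emeasure lebesgue (icube \<alpha> p) \<partial>count_space C)"
    by (intro emeasure_UN_countable countable_icube_index disj) auto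
  also have "\<dots> \<le> (\<integral>\<^sup>+p. ennreal (1 / c) * (\<integral>\<^sup>+x\<in>icube \<alpha> p. ennreal (h x) \<partial>lebesgue) \<partial>count_space C)"
    by (intro nn_integral_mono meas) auto
  also have "\<dots> = ennreal (1 / c) * (\<integral>\<^sup>+p. emeasure (density lebesgue (\<lambda>x. ennreal (h x))) (icube \<alpha> p) \<partial>count_space C)"
    by (subst nn_integral_cmult) (auto simp: emeasure_density)
  also have "\<dots> = ennreal (1 / c) * emeasure (density lebesgue (\<lambda>x. ennreal (h x))) (\<Union>p\<in>C. icube \<alpha> p)"
    by (subst emeasure_UN_countable[OF _ countable_icube_index disj]) auto
  also have "\<dots> \<le> ennreal (1 / c) * emeasure (density lebesgue (\<lambda>x. ennreal (h x))) (space lebesgue)"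
    by (intro mult_left_mono emeasure_mono) (auto)
  also have "\<dots> = ennreal (1 / c) * (\<integral>\<^sup>+x. ennreal (h x) \<partial>lebesgue)"
    by (subst emeasure_density) (auto intro!: nn_integral_cong)
  also have "\<dots> = ennreal ((LINT x|lebesgue. h x) / c)"
    using h \<open>0 < c\<close> by (subst nn_integral_eq_integral) (auto simp: ennreal_mult''[symmetric])
  finally show ?thesis .
qed

text \<open>A lower bound on the average over a cube bounds its volume by the total integral divided
  by \<open>c\<close>. This guarantees that maximal cubes exist.\<close>

lemma scale_bounded:
  fixes h :: "real^'n \<Rightarrow> real"
  assumes h: "integrable lebesgue h" "\<And>x. 0 \<le> h x" and "0 < c"
  shows "\<exists>K. \<forall>p\<in>{p. c * (2 powi fst p) ^ CARD('n) \<le> (LINT x:icube \<alpha> p|lebesgue. h x)}. fst p \<le> K"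
proof -
  obtain n where n: "(LINT x|lebesgue. h x) / c + 1 < 2 powi (0 + int n)" using real_less_two_power_int by blast
  have "fst p \<le> int n" if "c * (2 powi fst p) ^ CARD('n) \<le> (LINT x:icube \<alpha> p|lebesgue. h x)" for p
  proof (rule ccontr)
    assume "\<not> fst p \<le> int n"
    then have "(2::real) powi (int n) \<le> 2 powi (fst p)" by (intro power_int_increasing) auto
    moreover have "(1::real) \<le> 2 powi (int n)" by simp
    moreover have "(LINT x|lebesgue. h x) \<ge> 0" using h(2) by (intro integral_nonneg_AE) auto
    moreover have "((2::real) powi (fst p)) ^ 1 \<le> (2 powi (fst p)) ^ CARD('n)"
      by (rule power_increasing) (use order_trans[OF calculation(2,1)] in \<open>auto simp: Suc_le_eq\<close>)
    ultimately have "(LINT x|lebesgue. h x) / c < (2 powi (fst p)) ^ CARD('n)" using n \<open>0 < c\<close> by simp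
    then have "(LINT x|lebesgue. h x) < c * (2 powi (fst p)) ^ CARD('n)" using \<open>0 < c\<close> by (simp add: field_simps)
    also have "\<dots> \<le> (LINT x:icube \<alpha> p|lebesgue. h x)" by (rule that)
    also have "\<dots> \<le> (LINT x|lebesgue. h x)"
      unfolding set_lebesgue_integral_def using h
      by (intro integral_mono integrable_mult_indicator) (auto simp: indicator_def)
    finally show False by simp
  qed
  then show ?thesis by blast
qed

text \<open>This is the weak type (1,1) bound for the dyadic maximal function, with constant 1:
  after passing to the maximal cubes the integrals run over disjoint sets.\<close>

lemma dyadic_weak_type:
  fixes h :: "real^'n \<Rightarrow> real"
  assumes h: "integrable lebesgue h" "\<And>x. 0 \<le> h x" and "0 < c"
    and C: "\<And>p. p \<in> C \<Longrightarrow> c * (2 powi fst p) ^ CARD('n) \<le> (LINT x:icube \<alpha> p|lebesgue. h x)"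
  shows "emeasure lebesgue (\<Union>p\<in>C. icube \<alpha> p) \<le> ennreal ((LINT x|lebesgue. h x) / c)"
proof -
  obtain K where "\<And>p. p \<in> C \<Longrightarrow> fst p \<le> K" using scale_bounded[OF h \<open>0 < c\<close>, of \<alpha>] C by blast
  then have "(\<Union>p\<in>C. icube \<alpha> p) = (\<Union>p\<in>maximal_cubes \<alpha> C. icube \<alpha> p)"
    using Union_maximal_cubes[of C K \<alpha>] by simp
  also have "emeasure lebesgue \<dots> \<le> ennreal ((LINT x|lebesgue. h x) / c)"
    using C maximal_cubes_subset[of \<alpha> C]
    by (intro emeasure_disjoint_cubes_le h \<open>0 < c\<close> maximal_cubes_disjoint) auto
  finally show ?thesis .
qed

text \<open>The bound \<open>K\<close> lets the small cube be taken strictly below a given one.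
  Applied to an open set around a superlevel set, this yields a cube that the set fills
  completely.\<close>

lemma open_contains_cube:
  fixes U :: "(real^'n) set"
  assumes "open U" "x \<in> U"
  shows "\<exists>k\<le>K. cube \<alpha> k (grid_index \<alpha> k x) \<subseteq> U"
proof -
  obtain e where e: "0 < e" "ball x e \<subseteq> U" using assms by (auto simp: open_contains_ball)
  obtain n where n: "CARD('n) / e < 2 powi (- K + int n)" using real_less_two_power_int by blast
  define k where "k = K - int n"
  have "(2::real) powi (- K + int n) = 1 / 2 powi k"
    using power_int_minus[of "2::real" k] by (simp add: k_def divide_inverse)
  then have "CARD('n) / e < 1 / 2 powi k" using n by simp
  then have "CARD('n) * 2 powi k < e" using e(1) by (simp add: divide_simps mult.commute)
  then have "cube \<alpha> k (grid_index \<alpha> k x) \<subseteq> ball x e"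
    using diam_cube[of _ \<alpha> k "grid_index \<alpha> k x" x] by (force simp: dist_norm mem_cube)
  then show ?thesis using e(2) by (intro exI[of _ k]) (auto simp: k_def)
qed

text \<open>
  Call the number of members of \<open>S\<close> strictly above a cube its generation. Sparseness bounds the
  total measure of the members below \<open>R\<close>, and the unions of the successive generations below \<open>R\<close>
  decrease, so the \<open>N\<close>-th one fills at most half of \<open>R\<close>. Hence each class of generations
  modulo \<open>N\<close> is sparse.
\<close>

lemma sparse_split:
  fixes S :: "(real^'n) set set" and N :: nat
  assumes fin: "finite S" and S: "S \<subseteq> grid \<beta>" and \<eta>: "0 < \<eta>" "2 / \<eta> \<le> real N"
    and E: "\<And>Q. Q \<in> S \<Longrightarrow> E Q \<in> sets lebesgue \<and> E Q \<subseteq> Q \<and> \<eta> * measure lebesgue Q \<le> measure lebesgue (E Q)"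
    and disj: "disjoint_family_on E S"
  obtains P :: "nat \<Rightarrow> (real^'n) set set"
    where "S = (\<Union>i<N. P i)" "disjoint_family_on P {..<N}" "\<And>i. i < N \<Longrightarrow> sparse_collection (P i)"
proof -
  define gen where "gen Q = card {R \<in> S. Q \<subset> R}" for Q
  define P where "P i = {Q \<in> S. gen Q mod N = i}" for i
  define U where "U k R = \<Union> {Q \<in> S. Q \<subseteq> R \<and> gen Q = gen R + k}" for k R
  have N: "N > 0" using \<eta> by (metis divide_pos_pos gr0I not_le of_nat_0 zero_less_numeral)
  have ne: "Q \<noteq> {}" and lm: "Q \<in> lmeasurable" if "Q \<in> S" for Q
    using S that cube_nonempty unfolding grid_def
    by (fastforce, auto simp: fmeasurable_def)
  have nest: "Q \<subseteq> R \<or> R \<subseteq> Q" if "Q \<in> S" "R \<in> S" "Q' \<noteq> {}" "Q' \<subseteq> Q" "Q' \<subseteq> R" for Q R Q'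
    using grid_nested[of Q \<beta> R] S that by blast
  \<comment> \<open>No generation is skipped on the way from \<open>Q\<close> up to
    \<open>R\<close>: the smallest member strictly containing \<open>Q\<close> has generation
    exactly one less, because by nesting every other strict superset lies strictly above it.\<close>
  have ex: "\<exists>Q'\<in>S. Q \<subseteq> Q' \<and> Q' \<subseteq> R \<and> gen Q' = g"
    if "Q \<in> S" "R \<in> S" "Q \<subseteq> R" "gen R \<le> g" "g \<le> gen Q" for Q R g
    using that
  proof (induction "gen Q - g" arbitrary: Q)
    case 0
    then show ?case by (intro bexI[of _ Q]) auto
  next
    case (Suc j)
    then have "Q \<noteq> R" by auto
    define A where "A = {R' \<in> S. Q \<subset> R'}"
    have A: "finite A" "R \<in> A" using fin Suc.prems \<open>Q \<noteq> R\<close> by (auto simp: A_def)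
    obtain Q1 where Q1: "Q1 \<in> A" "\<And>R'. R' \<in> A \<Longrightarrow> R' \<subseteq> Q1 \<Longrightarrow> R' = Q1"
      using finite_has_minimal[OF A(1)] A(2) by (metis empty_iff)
    have min: "Q1 \<subseteq> R'" if "R' \<in> A" for R'
      using nest[of Q1 R' Q] Q1 that ne[OF Suc.prems(1)] unfolding A_def by auto
    have "A = insert Q1 {R' \<in> S. Q1 \<subset> R'}" using Q1(1) min by (auto simp: A_def)
    then have "gen Q = Suc (gen Q1)" using fin unfolding gen_def A_def by simp
    then have "\<exists>Q'\<in>S. Q1 \<subseteq> Q' \<and> Q' \<subseteq> R \<and> gen Q' = g"
      using Suc.hyps(2) Suc.prems Q1(1) min[OF A(2)] by (intro Suc.hyps(1)) (auto simp: A_def)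
    then obtain Q' where "Q' \<in> S" "Q1 \<subseteq> Q'" "Q' \<subseteq> R" "gen Q' = g" by blast
    moreover have "Q \<subseteq> Q1" using Q1(1) by (auto simp: A_def)
    ultimately show ?case by blast
  qed
  have mU: "U k R \<in> lmeasurable" for k R
    unfolding U_def using fin lm by (intro fmeasurable.finite_Union) auto
  have half: "measure lebesgue (U N R) \<le> measure lebesgue R / 2" if R: "R \<in> S" for R
  proof -
    define B where "B k = {Q \<in> S. Q \<subseteq> R \<and> gen Q = gen R + k}" for k
    have Bfin: "finite (B k)" for k using fin by (simp add: B_def)
    have UN: "U N R \<subseteq> U k R" if "k \<le> N" for k
    proof
      fix x assume "x \<in> U N R"
      then obtain Q where Q: "Q \<in> S" "Q \<subseteq> R" "gen Q = gen R + N" "x \<in> Q" by (auto simp: U_def)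
      then show "x \<in> U k R" using ex[of Q R "gen R + k"] R that by (auto simp: U_def)
    qed
    have "real N * measure lebesgue (U N R) = (\<Sum>k<N. measure lebesgue (U N R))" by simp
    also have "\<dots> \<le> (\<Sum>k<N. measure lebesgue (U k R))"
      using UN by (intro sum_mono measure_mono_fmeasurable mU fmeasurableD) auto
    also have "\<dots> \<le> (\<Sum>k<N. \<Sum>Q\<in>B k. measure lebesgue Q)"
      unfolding U_def B_def[symmetric] using Bfin lm
      by (intro sum_mono measure_Union_le) (auto simp: B_def)
    also have "\<dots> \<le> (\<Sum>k<N. \<Sum>Q\<in>B k. measure lebesgue (E Q) / \<eta>)"
      using E \<eta> by (intro sum_mono) (auto simp: B_def field_simps)
    also have "\<dots> = (\<Sum>Q\<in>(\<Union>k<N. B k). measure lebesgue (E Q)) / \<eta>"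
      using Bfin by (subst sum.UNION_disjoint) (auto simp: B_def sum_divide_distrib)
    also have "(\<Sum>Q\<in>(\<Union>k<N. B k). measure lebesgue (E Q)) = measure lebesgue (\<Union>Q\<in>(\<Union>k<N. B k). E Q)"
    proof (rule measure_UNION'[symmetric])
      show "finite (\<Union>k<N. B k)" using Bfin by auto
      show "E Q \<in> lmeasurable" if "Q \<in> (\<Union>k<N. B k)" for Q
        using E[of Q] lm[of Q] that by (auto simp: B_def intro: fmeasurableI2)
      show "pairwise (\<lambda>i j. disjnt (E i) (E j)) (\<Union>k<N. B k)"
        using disj by (auto simp: B_def pairwise_def disjnt_def disjoint_family_on_def)
    qed
    also have "\<dots> \<le> measure lebesgue R"
      using E lm R Bfin
      by (intro measure_mono_fmeasurable) (fastforce simp: B_def, auto simp: B_def intro!: sets.finite_UN)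
    finally have "real N * measure lebesgue (U N R) \<le> measure lebesgue R / \<eta>"
      using \<eta> by (simp add: divide_right_mono)
    then have "measure lebesgue (U N R) \<le> measure lebesgue R * (1 / (\<eta> * N))"
      using \<eta> N by (simp add: field_simps)
    also have "\<dots> \<le> measure lebesgue R * (1 / 2)"
      using \<eta> N by (intro mult_left_mono) (auto simp: field_simps)
    finally show ?thesis by simp
  qed
  show ?thesis
  proof (rule that[of P])
    show "S = (\<Union>i<N. P i)" using N by (auto simp: P_def)
    show "disjoint_family_on P {..<N}" by (auto simp: P_def disjoint_family_on_def)
    fix i assume "i < N"
    \<comment> \<open>A member strictly below \<open>R\<close> has a strictly larger generation.
      Inside one residue class the difference is thus at least \<open>N\<close>, and all such
      members lie in \<open>U N R\<close>.\<close>
    define E' where "E' R = R - \<Union> {Q \<in> P i. Q \<subset> R}" for R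
    have "E' Q \<inter> E' R = {}" if "Q \<in> P i" "R \<in> P i" "Q \<noteq> R" for Q R
      using nest[of Q R "E' Q \<inter> E' R"] that by (auto simp: P_def E'_def)
    moreover have "E' R \<in> sets lebesgue \<and> E' R \<subseteq> R \<and> measure lebesgue R / 2 \<le> measure lebesgue (E' R)"
      if R: "R \<in> P i" for R
    proof (intro conjI)
      have RS: "R \<in> S" using R by (simp add: P_def)
      have fP: "finite {Q \<in> P i. Q \<subset> R}" using fin by (simp add: P_def)
      have sub: "\<Union> {Q \<in> P i. Q \<subset> R} \<subseteq> U N R"
      proof
        fix x assume "x \<in> \<Union> {Q \<in> P i. Q \<subset> R}"
        then obtain Q where Q: "Q \<in> S" "gen Q mod N = i" "Q \<subset> R" "x \<in> Q" by (auto simp: P_def)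
        have "insert R {R' \<in> S. R \<subset> R'} \<subseteq> {R' \<in> S. Q \<subset> R'}" using Q RS by auto
        then have "card (insert R {R' \<in> S. R \<subset> R'}) \<le> gen Q"
          unfolding gen_def using fin by (intro card_mono) auto
        then have less: "gen R < gen Q" using fin by (simp add: gen_def)
        moreover have "gen Q mod N = gen R mod N" using Q R by (simp add: P_def)
        ultimately have "N dvd gen Q - gen R" by (subst mod_eq_dvd_iff_nat[symmetric]) auto
        then have "gen R + N \<le> gen Q" using less dvd_imp_le[of N "gen Q - gen R"] by auto
        then show "x \<in> U N R" using ex[of Q R "gen R + N"] Q RS by (auto simp: U_def)
      qed
      have UP: "\<Union> {Q \<in> P i. Q \<subset> R} \<in> lmeasurable"
        using fP lm by (intro fmeasurable.finite_Union) (auto simp: P_def)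
      show "E' R \<in> sets lebesgue" unfolding E'_def using UP lm[OF RS] by auto
      show "E' R \<subseteq> R" by (auto simp: E'_def)
      have "measure lebesgue (E' R) = measure lebesgue R - measure lebesgue (\<Union> {Q \<in> P i. Q \<subset> R})"
        unfolding E'_def using lm[OF RS] UP by (intro measurable_measure_Diff) auto
      moreover have "measure lebesgue (\<Union> {Q \<in> P i. Q \<subset> R}) \<le> measure lebesgue (U N R)"
        using sub UP by (intro measure_mono_fmeasurable mU) auto
      ultimately show "measure lebesgue R / 2 \<le> measure lebesgue (E' R)" using half[OF RS] by simp
    qed
    ultimately show "sparse_collection (P i)" unfolding sparse_collection_def by (intro exI[of _ E']) blast
  qed
qed

section \<open>Calderon-Zygmund operators\<close>

abbreviation cut :: "(real^'n) set \<Rightarrow> (real^'n \<Rightarrow> complex) \<Rightarrow> real^'n \<Rightarrow> complex" where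
  "cut S f \<equiv> (\<lambda>x. indicator S x *\<^sub>R f x)"

abbreviation bcs :: "(real^'n \<Rightarrow> complex) set" where
  "bcs \<equiv> bounded_compactly_supported"

text \<open>One number bounds both the values and the support. Closure properties of this class then
  need no compactness or closure argument.\<close>

lemma bcs_iff:
  "f \<in> bcs \<longleftrightarrow> f \<in> borel_measurable lebesgue \<and>
     (\<exists>M>0. \<forall>x. cmod (f x) \<le> M \<and> (M < norm x \<longrightarrow> f x = 0))"
proof
  assume f: "f \<in> bcs"
  then obtain M1 where M1: "\<And>x. cmod (f x) \<le> M1"
    by (auto simp: bounded_compactly_supported_def bounded_iff)
  have "bounded (supp f)" using f by (auto simp: bounded_compactly_supported_def compact_imp_bounded)
  then obtain M2 where M2: "\<And>x. x \<in> supp f \<Longrightarrow> norm x \<le> M2" by (auto simp: bounded_iff)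
  have "f x = 0" if "M2 < norm x" for x
    using M2[of x] that closure_subset[of "{x. f x \<noteq> 0}"] by (auto simp: supp_def)
  then show "f \<in> borel_measurable lebesgue \<and> (\<exists>M>0. \<forall>x. cmod (f x) \<le> M \<and> (M < norm x \<longrightarrow> f x = 0))"
    using f M1 by (intro conjI exI[of _ "max 1 (max M1 M2)"]) (auto simp: bounded_compactly_supported_def le_max_iff_disj)
next
  assume "f \<in> borel_measurable lebesgue \<and> (\<exists>M>0. \<forall>x. cmod (f x) \<le> M \<and> (M < norm x \<longrightarrow> f x = 0))"
  then obtain M where f: "f \<in> borel_measurable lebesgue" and M: "\<And>x. cmod (f x) \<le> M" "\<And>x. M < norm x \<Longrightarrow> f x = 0" by auto
  have "supp f \<subseteq> cball 0 M" unfolding supp_def using M(2) by (intro closure_minimal) (auto simp: not_less[symmetric])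
  then have "compact (supp f)"
    unfolding compact_eq_bounded_closed using bounded_subset[OF bounded_cball] by (auto simp: supp_def)
  then show "f \<in> bcs"
    using f M(1) by (auto simp: bounded_compactly_supported_def bounded_iff)
qed

lemma bcs_measurable: "f \<in> bcs \<Longrightarrow> f \<in> borel_measurable lebesgue"
  by (simp add: bcs_iff)

lemma bcs_lincomb:
  assumes f: "f \<in> bcs" and g: "g \<in> bcs"
  shows "(\<lambda>x. a * f x + b * g x) \<in> bcs"
proof -
  obtain M where M: "M > 0" "\<And>x. cmod (f x) \<le> M" "\<And>x. M < norm x \<Longrightarrow> f x = 0" using f by (auto simp: bcs_iff)
  obtain N where N: "N > 0" "\<And>x. cmod (g x) \<le> N" "\<And>x. N < norm x \<Longrightarrow> g x = 0" using g by (auto simp: bcs_iff)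
  have [measurable]: "f \<in> borel_measurable lebesgue" "g \<in> borel_measurable lebesgue"
    using f g by (auto simp: bcs_iff)
  define R where "R = max (max M N) (cmod a * M + cmod b * N)"
  have "cmod (a * f x + b * g x) \<le> R" for x
  proof -
    have "cmod (a * f x + b * g x) \<le> cmod a * cmod (f x) + cmod b * cmod (g x)"
      by (metis norm_mult norm_triangle_ineq)
    also have "\<dots> \<le> cmod a * M + cmod b * N" using M N by (intro add_mono mult_left_mono) auto
    finally show ?thesis by (simp add: R_def)
  qed
  moreover have "(\<lambda>x. a * f x + b * g x) \<in> borel_measurable lebesgue" by measurable
  ultimately show ?thesis unfolding bcs_iff using M N
    by (intro conjI exI[of _ R]) (auto simp: R_def)
qed

lemma bcs_diff:
  assumes "f \<in> bcs" "g \<in> bcs"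
  shows "(\<lambda>x. f x - g x) \<in> bcs"
  using bcs_lincomb[OF assms, of 1 "-1"] by simp

lemma bcs_cut:
  assumes f: "f \<in> bcs" and S: "S \<in> sets lebesgue"
  shows "cut S f \<in> bcs"
proof -
  have [measurable]: "f \<in> borel_measurable lebesgue" "S \<in> sets lebesgue" using f S by (auto simp: bcs_iff)
  have "cut S f \<in> borel_measurable lebesgue" by measurable
  then show ?thesis using f unfolding bcs_iff by (auto simp: indicator_def intro: less_imp_le)
qed

lemma integrable_bounded_support:
  fixes f :: "real^'n \<Rightarrow> 'b::{banach, second_countable_topology}"
  assumes "f \<in> borel_measurable lebesgue" "\<And>x. norm (f x) \<le> M" "\<And>x. R < norm x \<Longrightarrow> f x = 0"
  shows "integrable lebesgue f"
proof (rule Bochner_Integration.integrable_bound)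
  have "emeasure lebesgue (cball (0::real^'n) R) < \<infinity>"
    using emeasure_bounded_finite[OF bounded_cball, of "0::real^'n" R] by (simp add: less_top)
  then show "integrable lebesgue (\<lambda>x::real^'n. indicator (cball 0 R) x *\<^sub>R M)"
    by (intro integrable_scaleR_left integrable_real_indicator) auto
  show "AE x in lebesgue. norm (f x) \<le> norm (indicator (cball 0 R) x *\<^sub>R M)"
    using assms(2,3) by (intro always_eventually allI) (auto simp: indicator_def not_le intro: order_trans[OF _ abs_ge_self])
qed fact

lemma bcs_integrable:
  assumes "f \<in> bcs" shows "integrable lebesgue f"
proof -
  obtain M where "f \<in> borel_measurable lebesgue" "\<And>x. cmod (f x) \<le> M" "\<And>x. M < norm x \<Longrightarrow> f x = 0"
    using assms unfolding bcs_iff by blast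
  then show ?thesis by (rule integrable_bounded_support)
qed

lemma bcs_integrable_powr:
  assumes "f \<in> bcs" "0 < q"
  shows "integrable lebesgue (\<lambda>x. cmod (f x) powr q)"
proof -
  obtain M where M: "\<And>x. cmod (f x) \<le> M" "\<And>x. M < norm x \<Longrightarrow> f x = 0"
    and [measurable]: "f \<in> borel_measurable lebesgue" using assms by (auto simp: bcs_iff)
  show ?thesis
    using M assms(2) by (intro integrable_bounded_support[of _ "M powr q" M]) (auto intro!: powr_mono2)
qed

lemma bcs_Lp_space: "f \<in> bcs \<Longrightarrow> 0 < q \<Longrightarrow> f \<in> Lp_space q"
  using bcs_integrable_powr[of f q] by (auto simp: Lp_space_def bcs_iff)

lemma superlevel_sets:
  assumes [measurable]: "f \<in> borel_measurable lebesgue"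
  shows "{x. t < cmod (f x)} \<in> sets lebesgue"
proof -
  have "{x \<in> space lebesgue. t < cmod (f x)} \<in> sets lebesgue" by measurable
  then show ?thesis by simp
qed

lemma emeasure_superlevel_Lp:
  assumes f: "f \<in> Lp_space q" and q: "0 < q" and t: "0 < t"
  shows "emeasure lebesgue {x. t < cmod (f x)} \<le> ennreal ((LINT x|lebesgue. cmod (f x) powr q) / t powr q)"
proof -
  have [measurable]: "f \<in> borel_measurable lebesgue" and int: "integrable lebesgue (\<lambda>x. cmod (f x) powr q)"
    using f by (auto simp: Lp_space_def)
  have "emeasure lebesgue {x. t < cmod (f x)} \<le> emeasure lebesgue {x\<in>space lebesgue. t powr q \<le> cmod (f x) powr q}"
  proof (rule emeasure_mono)
    show "{x \<in> space lebesgue. t powr q \<le> cmod (f x) powr q} \<in> sets lebesgue" by measurable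
    have "t powr q \<le> cmod (f x) powr q" if "t < cmod (f x)" for x
      using q t that by (intro powr_mono2) auto
    then show "{x. t < cmod (f x)} \<subseteq> {x \<in> space lebesgue. t powr q \<le> cmod (f x) powr q}" by auto
  qed
  also have "\<dots> \<le> ennreal (1 / t powr q * (LINT x|lebesgue. cmod (f x) powr q))"
    by (rule integral_Markov_inequality[OF int]) (use t in auto)
  finally show ?thesis by simp
qed

text \<open>
  The number \<open>\<rho> n\<close> bounds the oscillation of the kernel over a cube, relative to its size, at
  points outside the triple of the \<open>n\<close>-th ancestor of the cube. Its summability is all that is
  needed of the Dini condition.
\<close>

locale cz_data =
  fixes T :: "(real^'n \<Rightarrow> complex) \<Rightarrow> real^'n \<Rightarrow> complex"
    and K :: "real^'n \<Rightarrow> real^'n \<Rightarrow> complex"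
    and q B :: real and \<rho> :: "nat \<Rightarrow> real"
  assumes linear: "linear_operator_on bounded_compactly_supported T"
    and T_measurable: "f \<in> bcs \<Longrightarrow> T f \<in> borel_measurable lebesgue"
    and q: "1 \<le> q" and B: "0 \<le> B"
    and strong_type: "f \<in> bcs \<Longrightarrow> 0 < t \<Longrightarrow>
      emeasure lebesgue {x. t < cmod (T f x)} \<le> ennreal (B * (LINT x|lebesgue. cmod (f x) powr q) / t powr q)"
    and representation: "f \<in> bcs \<Longrightarrow>
      AE x in lebesgue. x \<notin> supp f \<longrightarrow> T f x = (LINT y|lebesgue. K x y * f y)"
    and kernel_integrable: "f \<in> bcs \<Longrightarrow> x \<notin> supp f \<Longrightarrow>
      integrable lebesgue (\<lambda>y. K x y * f y)"
    and \<rho>_nonneg: "0 \<le> \<rho> n" and \<rho>_summable: "summable \<rho>"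
    and kernel_snd: "y \<in> cube \<alpha> k m \<Longrightarrow> y' \<in> cube \<alpha> k m \<Longrightarrow>
      x \<notin> triple_cube \<alpha> (k + int n) (grid_index \<alpha> (k + int n) y) \<Longrightarrow>
      cmod (K x y - K x y') \<le> \<rho> n / (2 powi (k + int n)) ^ CARD('n)"
    and kernel_fst: "y \<in> cube \<alpha> k m \<Longrightarrow> y' \<in> cube \<alpha> k m \<Longrightarrow>
      x \<notin> triple_cube \<alpha> (k + int n) (grid_index \<alpha> (k + int n) y) \<Longrightarrow>
      cmod (K y x - K y' x) \<le> \<rho> n / (2 powi (k + int n)) ^ CARD('n)"

text \<open>Between \<open>(1 / 2) ^ Suc j\<close> and \<open>(1 / 2) ^ j\<close> the logarithmic
  factor is at least 1 and \<omega> is at least its value at the left end, so the integrand is at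
  least that value divided by \<open>(1 / 2) ^ j\<close>. The interval has length
  \<open>(1 / 2) ^ Suc j\<close>, which leaves half of the value. The intervals are disjoint, so
  these halves add up to at most the integral.\<close>

lemma log_Dini_summable:
  assumes \<omega>: "modulus_of_continuity \<omega>" and dini: "log_Dini \<omega>"
  shows "summable (\<lambda>j. \<omega> ((1 / 2) ^ Suc j))"
proof -
  have mono: "\<omega> s \<le> \<omega> t" if "0 \<le> s" "s \<le> t" for s t
  proof -
    have "mono_on {0..} \<omega>" using \<omega> unfolding modulus_of_continuity_def by blast
    from mono_onD[OF this, of s t] show ?thesis using that by simp
  qed
  have pos: "0 < \<omega> t" if "0 < t" for t using \<omega> that unfolding modulus_of_continuity_def by blast
  define F where "F t = ennreal (\<omega> t * (1 + ln (1 / t)) / t) * indicator {0<..<1} t" for t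
  have "continuous_on {0<..<1::real} (\<lambda>t. \<omega> t * (1 + ln (1 / t)) / t)"
  proof -
    have "continuous_on {0..} \<omega>" using \<omega> unfolding modulus_of_continuity_def by blast
    then have "continuous_on {0<..<1} \<omega>" by (rule continuous_on_subset) auto
    then show ?thesis by (intro continuous_intros) auto
  qed
  then have "(\<lambda>t. indicator {0<..<1} t *\<^sub>R (\<omega> t * (1 + ln (1 / t)) / t)) \<in> borel_measurable borel"
    by (intro borel_measurable_continuous_on_indicator) auto
  then have "(\<lambda>t. ennreal (indicator {0<..<1} t *\<^sub>R (\<omega> t * (1 + ln (1 / t)) / t))) \<in> borel_measurable borel"
    by measurable
  also have "(\<lambda>t. ennreal (indicator {0<..<1} t *\<^sub>R (\<omega> t * (1 + ln (1 / t)) / t))) = F"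
    by (auto simp: F_def indicator_def)
  finally have F [measurable]: "F \<in> borel_measurable lborel" by simp
  have fin: "(\<integral>\<^sup>+t. F t \<partial>lborel) < \<infinity>" using dini by (simp add: log_Dini_def F_def)
  define I where "I j = {(1 / 2) ^ Suc j<..<(1 / 2 :: real) ^ j}" for j :: nat
  have disj: "disjoint_family I"
    unfolding disjoint_family_on_def
  proof (intro ballI impI)
    fix i j :: nat assume "i \<noteq> j"
    then consider "Suc i \<le> j" | "Suc j \<le> i" by linarith
    then show "I i \<inter> I j = {}"
    proof cases
      case 1
      then have "(1 / 2 :: real) ^ j \<le> (1 / 2) ^ Suc i" by (intro power_decreasing) auto
      then show ?thesis unfolding I_def by fastforce
    next
      case 2
      then have "(1 / 2 :: real) ^ i \<le> (1 / 2) ^ Suc j" by (intro power_decreasing) auto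
      then show ?thesis unfolding I_def by fastforce
    qed
  qed
  have le: "ennreal (\<omega> ((1 / 2) ^ Suc j) / 2) \<le> emeasure (density lborel F) (I j)" for j
  proof -
    have *: "\<omega> ((1 / 2) ^ Suc j) / (1 / 2) ^ j \<le> \<omega> t * (1 + ln (1 / t)) / t" and t01: "0 < t" "t < 1" if "t \<in> I j" for t
    proof -
      have t: "(1 / 2) ^ Suc j < t" "t < (1 / 2) ^ j" using that by (auto simp: I_def)
      have "0 < (1 / 2 :: real) ^ Suc j" by simp
      then show t0: "0 < t" using t(1) by linarith
      have "(1 / 2 :: real) ^ j \<le> 1" by (intro power_le_one) auto
      then show t1: "t < 1" using t(2) by linarith
      have "\<omega> ((1 / 2) ^ Suc j) \<le> \<omega> t" using t by (intro mono) auto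
      moreover have "1 \<le> 1 + ln (1 / t)" using t0 t1 by (simp add: ln_div)
      ultimately have "\<omega> ((1 / 2) ^ Suc j) * 1 \<le> \<omega> t * (1 + ln (1 / t))"
        using pos[OF t0] by (intro mult_mono) auto
      then show "\<omega> ((1 / 2) ^ Suc j) / (1 / 2) ^ j \<le> \<omega> t * (1 + ln (1 / t)) / t"
        using t t0 pos[of "(1 / 2) ^ Suc j"] by (intro frac_le) auto
    qed
    have "ennreal (\<omega> ((1 / 2) ^ Suc j) / 2)
        = ennreal (\<omega> ((1 / 2) ^ Suc j) / (1 / 2) ^ j) * emeasure lborel (I j)"
      using pos[of "(1 / 2) ^ Suc j"] unfolding I_def
      by (simp add: ennreal_mult''[symmetric] field_simps)
    also have "\<dots> = (\<integral>\<^sup>+t. ennreal (\<omega> ((1 / 2) ^ Suc j) / (1 / 2) ^ j) * indicator (I j) t \<partial>lborel)"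
      by (simp add: I_def nn_integral_cmult_indicator)
    also have "\<dots> \<le> (\<integral>\<^sup>+t. F t * indicator (I j) t \<partial>lborel)"
      using * t01 by (intro nn_integral_mono) (auto simp: F_def indicator_def intro!: ennreal_leI)
    also have "\<dots> = emeasure (density lborel F) (I j)"
      by (subst emeasure_density) (auto simp: I_def)
    finally show ?thesis .
  qed
  have "(\<Sum>j. ennreal (\<omega> ((1 / 2) ^ Suc j) / 2)) \<le> (\<Sum>j. emeasure (density lborel F) (I j))"
    by (intro suminf_le le) auto
  also have "\<dots> = emeasure (density lborel F) (\<Union>j. I j)"
    by (intro suminf_emeasure disj) (auto simp: I_def)
  also have "\<dots> \<le> emeasure (density lborel F) (space lborel)" by (intro emeasure_mono) auto
  also have "\<dots> = (\<integral>\<^sup>+t. F t \<partial>lborel)" by (simp add: emeasure_density)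
  finally have "(\<Sum>j. ennreal (\<omega> ((1 / 2) ^ Suc j) / 2)) < \<infinity>" using fin by (rule le_less_trans)
  then have "summable (\<lambda>j. \<omega> ((1 / 2) ^ Suc j) / 2)"
    using pos by (intro summable_suminf_not_top) (auto intro: less_imp_le)
  from summable_mult[OF this, of 2] show ?thesis by simp
qed


text \<open>The factor \<open>c\<close> accounts for the diameter of a cube, which is several side
  lengths. It is absorbed by an index shift as soon as \<open>c < 2 ^ m\<close>.\<close>

lemma omega_scaled_summable:
  assumes \<omega>: "modulus_of_continuity \<omega>" and dini: "log_Dini \<omega>" and "0 \<le> c"
  shows "summable (\<lambda>n. \<omega> (c / 2 ^ n))"
proof -
  have mono: "\<omega> s \<le> \<omega> t" if "0 \<le> s" "s \<le> t" for s t
  proof -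
    have "mono_on {0..} \<omega>" using \<omega> unfolding modulus_of_continuity_def by blast
    from mono_onD[OF this, of s t] show ?thesis using that by simp
  qed
  have nonneg: "0 \<le> \<omega> t" if "0 \<le> t" for t
    using \<omega> mono[of 0 t] that unfolding modulus_of_continuity_def by linarith
  obtain m where m: "c < 2 ^ m" using real_arch_pow[of 2 c] by auto
  have "summable (\<lambda>n. \<omega> (c / 2 ^ (n + Suc m)))"
  proof (rule summable_comparison_test[OF _ log_Dini_summable[OF \<omega> dini]], intro exI allI impI)
    fix n :: nat
    have "c / 2 ^ (n + Suc m) \<le> 2 ^ m / 2 ^ (n + Suc m)" using m by (intro divide_right_mono) auto
    also have "\<dots> = (1 / 2) ^ Suc n" by (simp add: power_add power_one_over field_simps)
    finally show "norm (\<omega> (c / 2 ^ (n + Suc m))) \<le> \<omega> ((1 / 2) ^ Suc n)"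
      using nonneg mono \<open>0 \<le> c\<close> by simp
  qed
  then show ?thesis using summable_iff_shift[of "\<lambda>n. \<omega> (c / 2 ^ n)" "Suc m"] by simp
qed

text \<open>\<open>modulus_of_continuity\<close> alone permits a positive value at 0; it is the
  convergence of the series that forces the limit 0. This gives continuity of the kernel off the
  diagonal.\<close>

lemma omega_at_zero:
  assumes \<omega>: "modulus_of_continuity \<omega>" and dini: "log_Dini \<omega>" and "0 < e"
  shows "\<exists>\<delta>>0. \<forall>t. 0 \<le> t \<and> t < \<delta> \<longrightarrow> \<omega> t < e"
proof -
  have "mono_on {0..} \<omega>" using \<omega> unfolding modulus_of_continuity_def by blast
  then have mono: "\<omega> s \<le> \<omega> t" if "0 \<le> s" "s \<le> t" for s t using that mono_onD[of "{0..}" \<omega> s t] by simp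
  have "(\<lambda>j. \<omega> ((1 / 2) ^ Suc j)) \<longlonglongrightarrow> 0" by (rule summable_LIMSEQ_zero[OF log_Dini_summable[OF \<omega> dini]])
  then have "eventually (\<lambda>j. \<omega> ((1 / 2) ^ Suc j) < e) sequentially" using \<open>0 < e\<close> by (rule order_tendstoD)
  then obtain j where j: "\<omega> ((1 / 2) ^ Suc j) < e" by (auto simp: eventually_sequentially)
  have "\<omega> t < e" if "0 \<le> t" "t < (1 / 2) ^ Suc j" for t
    using mono[of t "(1 / 2) ^ Suc j"] that j by linarith
  then show ?thesis by (intro exI[of _ "(1 / 2) ^ Suc j"]) auto
qed

lemma CZ_operator_cz_data:
  fixes T :: "(real^'n \<Rightarrow> complex) \<Rightarrow> real^'n \<Rightarrow> complex"
  assumes T: "CZ_operator \<omega> T" and dini: "log_Dini \<omega>"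
  obtains K q B \<rho> where "cz_data T K q B \<rho>"
proof -
  have \<omega>: "modulus_of_continuity \<omega>" and lin: "linear_operator_on bounded_compactly_supported T"
    using T unfolding CZ_operator_def by blast+
  have mono: "\<omega> s \<le> \<omega> t" if "0 \<le> s" "s \<le> t" for s t
  proof -
    have "mono_on {0..} \<omega>" using \<omega> unfolding modulus_of_continuity_def by blast
    from mono_onD[OF this, of s t] show ?thesis using that by simp
  qed
  have nonneg: "0 \<le> \<omega> t" if "0 \<le> t" for t
    using \<omega> mono[of 0 t] that unfolding modulus_of_continuity_def by linarith
  obtain q T' where q: "q \<ge> 1" and T': "bounded_operator_Lp q T'"
    and TT': "\<And>f. f \<in> bcs \<Longrightarrow> AE x in lebesgue. T' f x = T f x"
    using T unfolding CZ_operator_def by blast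
  obtain K where K: "CZ_kernel \<omega> K"
    and rep: "\<And>f. f \<in> bcs \<Longrightarrow> AE x in lebesgue.
           x \<notin> supp f \<longrightarrow> T f x = (LINT y|lebesgue. K x y * f y)"
    using T unfolding CZ_operator_def by blast
  obtain A0 where A0: "\<And>x y. x \<noteq> y \<Longrightarrow> cmod (K x y) \<le> A0 / norm (x - y) ^ CARD('n)"
    using K unfolding CZ_kernel_def by blast
  obtain C0 where
     C0: "\<And>x x' y. x \<noteq> y \<Longrightarrow> norm (x - x') \<le> norm (x - y) / 2 \<Longrightarrow> cmod (K x y - K x' y)
             \<le> C0 * \<omega> (norm (x - x') / norm (x - y)) / norm (x - y) ^ CARD('n)"
      "\<And>x y y'. x \<noteq> y \<Longrightarrow> norm (y - y') \<le> norm (x - y) / 2 \<Longrightarrow> cmod (K x y - K x y')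
             \<le> C0 * \<omega> (norm (y - y') / norm (x - y)) / norm (x - y) ^ CARD('n)"
    using K unfolding CZ_kernel_def by blast
  \<comment> \<open>The constants in \<open>CZ_kernel\<close> may have either sign; absolute values
    make the later monotonicity arguments valid.\<close>
  define A where "A = \<bar>A0\<bar>"
  define C where "C = \<bar>C0\<bar>"
  have A: "cmod (K x y) \<le> A / norm (x - y) ^ CARD('n)" if "x \<noteq> y" for x y
    using A0[OF that] by (rule order_trans) (auto simp: A_def intro!: divide_right_mono)
  have C1: "cmod (K x y - K x' y) \<le> C * \<omega> (norm (x - x') / norm (x - y)) / norm (x - y) ^ CARD('n)"
    if "x \<noteq> y" "norm (x - x') \<le> norm (x - y) / 2" for x x' y
    using C0(1)[OF that] by (rule order_trans) (auto simp: C_def nonneg intro!: divide_right_mono mult_right_mono)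
  have C2: "cmod (K x y - K x y') \<le> C * \<omega> (norm (y - y') / norm (x - y)) / norm (x - y) ^ CARD('n)"
    if "x \<noteq> y" "norm (y - y') \<le> norm (x - y) / 2" for x y y'
    using C0(2)[OF that] by (rule order_trans) (auto simp: C_def nonneg intro!: divide_right_mono mult_right_mono)
  define d where "d = real CARD('n)"
  \<comment> \<open>The two points of the cube differ by at most \<open>d * 2 powi k\<close>, and
    the third point is at distance at least \<open>2 powi (k + int n)\<close>. The smoothness
    condition therefore applies once \<open>2 * d \<le> 2 ^ n\<close>; for the finitely many smaller
    \<open>n\<close> the size bound is used on both kernel values.\<close>
  define \<rho> where "\<rho> n = (if 2 * d \<le> 2 ^ n then C * \<omega> (d / 2 ^ n) else 2 * A)" for n :: nat
  have AC: "0 \<le> A" "0 \<le> C" "0 \<le> d" by (auto simp: A_def C_def d_def)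
  have \<rho>0: "0 \<le> \<rho> n" for n using AC nonneg by (auto simp: \<rho>_def)
  have \<rho>s: "summable \<rho>"
  proof -
    obtain m where m: "2 * d < 2 ^ m" using real_arch_pow[of 2 "2 * d"] by auto
    have "summable (\<lambda>n. C * \<omega> (d / 2 ^ n))"
      by (intro summable_mult omega_scaled_summable[OF \<omega> dini] AC)
    then show ?thesis
    proof (rule summable_comparison_test[rotated], intro exI[of _ m] allI impI)
      fix n assume "m \<le> n"
      then have "(2::real) ^ m \<le> 2 ^ n" by (intro power_increasing) auto
      then have "2 * d \<le> 2 ^ n" using m by linarith
      then show "norm (\<rho> n) \<le> C * \<omega> (d / 2 ^ n)" using AC nonneg by (simp add: \<rho>_def)
    qed
  qed
  have far: "2 powi (k + int n) \<le> norm (x - y)" "x \<noteq> y" "norm (y - y') \<le> d / 2 ^ n * 2 powi (k + int n)"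
    if "y \<in> cube \<alpha> k m" "y' \<in> cube \<alpha> k m" "x \<notin> triple_cube \<alpha> (k + int n) (grid_index \<alpha> (k + int n) y)"
    for x y y' :: "real^'n" and \<alpha> k m n
  proof -
    show *: "2 powi (k + int n) \<le> norm (x - y)"
      using dist_outside_triple_cube[OF _ that(3), of y] by (simp add: mem_cube)
    have p: "(0::real) < 2 powi (k + int n)" by simp
    show "x \<noteq> y"
    proof
      assume "x = y"
      then have "2 powi (k + int n) \<le> (0::real)" using * by simp
      then show False using p by linarith
    qed
    show "norm (y - y') \<le> d / 2 ^ n * 2 powi (k + int n)"
      using diam_cube[OF that(2,1)] by (simp add: d_def power_int_add)
  qed
  have key: "C * \<omega> (s / N) / N ^ CARD('n) \<le> \<rho> n / r ^ CARD('n) \<and> s \<le> N / 2"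
    if "2 * d \<le> 2 ^ n" "0 < r" "r \<le> N" "0 \<le> s" "s \<le> d / 2 ^ n * r" for s N r n
  proof -
    have "s / N \<le> s / r" using that by (intro divide_left_mono) auto
    also have "\<dots> \<le> d / 2 ^ n" using that by (simp add: field_simps)
    finally have 1: "s / N \<le> d / 2 ^ n" .
    have "s \<le> d / 2 ^ n * N" using that AC by (meson divide_nonneg_pos mult_left_mono order_trans zero_less_numeral zero_less_power)
    also have "\<dots> \<le> 1 / 2 * N" using that by (intro mult_right_mono) (auto simp: field_simps)
    finally have 2: "s \<le> N / 2" by simp
    have "C * \<omega> (s / N) \<le> C * \<omega> (d / 2 ^ n)" using 1 that AC by (intro mult_left_mono mono) auto
    moreover have "r ^ CARD('n) \<le> N ^ CARD('n)" "0 < r ^ CARD('n)"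
      using that(2,3) by (auto intro: power_mono)
    moreover have "0 \<le> C * \<omega> (d / 2 ^ n)" using AC nonneg by simp
    ultimately have "C * \<omega> (s / N) / N ^ CARD('n) \<le> C * \<omega> (d / 2 ^ n) / r ^ CARD('n)"
      by (intro frac_le)
    then show ?thesis using 2 that(1) by (simp add: \<rho>_def)
  qed
  have far2: "2 * A / r ^ CARD('n) \<le> \<rho> n / r ^ CARD('n)" if "\<not> 2 * d \<le> 2 ^ n" for n and r :: real
    using that by (simp add: \<rho>_def)
  have one: "cmod (K x y) \<le> A / r ^ CARD('n)" if "0 < r" "r \<le> norm (x - y)" for r x y
  proof -
    have "x \<noteq> y" using that by auto
    moreover have "r ^ CARD('n) \<le> norm (x - y) ^ CARD('n)" "0 < r ^ CARD('n)"
      using that by (auto intro: power_mono)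
    then have "A / norm (x - y) ^ CARD('n) \<le> A / r ^ CARD('n)" using AC by (intro frac_le) auto
    ultimately show ?thesis using A order_trans by blast
  qed
  have snd: "cmod (K x y - K x y') \<le> \<rho> n / (2 powi (k + int n)) ^ CARD('n)"
    if y: "y \<in> cube \<alpha> k m" "y' \<in> cube \<alpha> k m" "x \<notin> triple_cube \<alpha> (k + int n) (grid_index \<alpha> (k + int n) y)"
    for x y y' :: "real^'n" and \<alpha> k m n
  proof (cases "2 * d \<le> 2 ^ n")
    case True
    from key[OF True _ far(1)[OF y] norm_ge_zero far(3)[OF y]] C2[OF far(2)[OF y], of y']
    show ?thesis by simp
  next
    case False
    have g: "grid_index \<alpha> (k + int n) y = grid_index \<alpha> (k + int n) y'"
      using grid_index_mono[of \<alpha> k y y' "k + int n"] y by (simp add: mem_cube)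
    have "cmod (K x y - K x y') \<le> cmod (K x y) + cmod (K x y')" by (rule norm_triangle_ineq4)
    also have "\<dots> \<le> 2 * A / (2 powi (k + int n)) ^ CARD('n)"
      using one[OF _ far(1)[OF y]] one[OF _ far(1)[OF y(2,1) y(3)[unfolded g]]] by simp
    finally show ?thesis using far2[OF False] by (rule order_trans)
  qed
  have fst: "cmod (K y x - K y' x) \<le> \<rho> n / (2 powi (k + int n)) ^ CARD('n)"
    if y: "y \<in> cube \<alpha> k m" "y' \<in> cube \<alpha> k m" "x \<notin> triple_cube \<alpha> (k + int n) (grid_index \<alpha> (k + int n) y)"
    for x y y' :: "real^'n" and \<alpha> k m n
  proof (cases "2 * d \<le> 2 ^ n")
    case True
    have far1: "2 powi (k + int n) \<le> norm (y - x)" using far(1)[OF y] by (simp add: norm_minus_commute)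
    from key[OF True _ far1 norm_ge_zero far(3)[OF y]] C1[OF far(2)[OF y, symmetric], of y']
    show ?thesis by simp
  next
    case False
    have g: "grid_index \<alpha> (k + int n) y = grid_index \<alpha> (k + int n) y'"
      using grid_index_mono[of \<alpha> k y y' "k + int n"] y by (simp add: mem_cube)
    have far1: "2 powi (k + int n) \<le> norm (y - x)" "2 powi (k + int n) \<le> norm (y' - x)"
      using far(1)[OF y] far(1)[OF y(2,1) y(3)[unfolded g]] by (simp_all add: norm_minus_commute)
    have "cmod (K y x - K y' x) \<le> cmod (K y x) + cmod (K y' x)" by (rule norm_triangle_ineq4)
    also have "\<dots> \<le> 2 * A / (2 powi (k + int n)) ^ CARD('n)"
      using one[OF _ far1(1)] one[OF _ far1(2)] by simp
    finally show ?thesis using far2[OF False] by (rule order_trans)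
  qed
  \<comment> \<open>\<open>CZ_kernel\<close> says nothing about measurability. Smoothness in the
    second variable, together with \<omega> tending to 0, makes \<open>K x\<close> continuous off
    \<open>x\<close> and hence measurable there.\<close>
  have cont: "continuous_on (- {x}) (K x)" for x
    unfolding continuous_on_iff
  proof (intro ballI allI impI)
    fix y and e :: real assume "y \<in> - {x}" "0 < e"
    then have N: "0 < norm (x - y)" by auto
    define N where "N = norm (x - y)"
    have N: "0 < N" using N by (simp add: N_def)
    have "0 < e * N ^ CARD('n) / (C + 1)" using N \<open>0 < e\<close> AC by auto
    from omega_at_zero[OF \<omega> dini this] obtain \<delta> where \<delta>: "\<delta> > 0"
      "\<And>t. 0 \<le> t \<Longrightarrow> t < \<delta> \<Longrightarrow> \<omega> t < e * N ^ CARD('n) / (C + 1)" by blast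
    have "dist (K x y') (K x y) < e" if y': "dist y' y < min (N / 2) (N * \<delta>)" for y'
    proof -
      define s where "s = norm (y - y')"
      have s: "s \<le> N / 2" "s < N * \<delta>" "0 \<le> s" using y' by (auto simp: s_def dist_norm norm_minus_commute)
      then have "s / N < \<delta>" "0 \<le> s / N" using N by (auto simp: field_simps)
      then have "\<omega> (s / N) < e * N ^ CARD('n) / (C + 1)" by (intro \<delta>)
      then have "(C + 1) * \<omega> (s / N) < e * N ^ CARD('n)" using AC by (simp add: field_simps)
      moreover have "C * \<omega> (s / N) \<le> (C + 1) * \<omega> (s / N)" using \<open>0 \<le> s / N\<close> by (simp add: nonneg algebra_simps)
      ultimately have "C * \<omega> (s / N) / N ^ CARD('n) < e" using N by (simp add: field_simps)
      moreover have "cmod (K x y - K x y') \<le> C * \<omega> (s / N) / N ^ CARD('n)"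
        using C2[of x y y'] s(1) N unfolding s_def N_def by auto
      ultimately show ?thesis by (simp add: dist_norm norm_minus_commute)
    qed
    then show "\<exists>d>0. \<forall>y'\<in>- {x}. dist y' y < d \<longrightarrow> dist (K x y') (K x y) < e"
      using N \<delta>(1) by (intro exI[of _ "min (N / 2) (N * \<delta>)"]) auto
  qed
  have intK: "integrable lebesgue (\<lambda>y. K x y * f y)"
    if f: "f \<in> bcs" and x: "x \<notin> supp f" for f x
  proof -
    obtain M where M: "\<And>x. cmod (f x) \<le> M" "\<And>x. M < norm x \<Longrightarrow> f x = 0"  "0 < M"
      and [measurable]: "f \<in> borel_measurable lebesgue" using f by (auto simp: bcs_iff)
    obtain \<delta> where \<delta>: "\<delta> > 0" "\<And>y. f y \<noteq> 0 \<Longrightarrow> \<delta> \<le> norm (x - y)"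
    proof -
      obtain \<delta> where "\<delta> > 0" "\<forall>y\<in>{y. f y \<noteq> 0}. \<delta> \<le> dist y x"
        using x unfolding supp_def closure_approachable by (auto simp: not_less)
      then show ?thesis by (intro that[of \<delta>]) (auto simp: dist_norm norm_minus_commute)
    qed
    have "(\<lambda>y. indicator (- {x}) y *\<^sub>R K x y) \<in> borel_measurable borel"
      by (intro borel_measurable_continuous_on_indicator cont) auto
    then have "(\<lambda>y. indicator (- {x}) y *\<^sub>R K x y) \<in> borel_measurable lborel" by simp
    then have [measurable]: "(\<lambda>y. indicator (- {x}) y *\<^sub>R K x y) \<in> borel_measurable lebesgue"
      by (rule measurable_completion)
    have fx: "f x = 0" using \<delta>(2)[of x] \<delta>(1) by (cases "f x = 0") auto
    \<comment> \<open>The kernel is uncontrolled at the single point \<open>y = x\<close>; since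
      \<open>f\<close> vanishes there, its value may be replaced by 0.\<close>
    have eq: "(\<lambda>y. K x y * f y) = (\<lambda>y. (indicator (- {x}) y *\<^sub>R K x y) * f y)"
      using fx by (auto simp: indicator_def fun_eq_iff)
    show ?thesis
    proof (rule integrable_bounded_support)
      show "(\<lambda>y. K x y * f y) \<in> borel_measurable lebesgue" unfolding eq by measurable
      show "norm (K x y * f y) \<le> A / \<delta> ^ CARD('n) * M" for y
      proof (cases "f y = 0")
        case False
        have "0 \<le> A / \<delta> ^ CARD('n)" using AC \<delta>(1) by simp
        then show ?thesis unfolding norm_mult
          using one[OF \<delta>(1) \<delta>(2)[OF False]] M(1)[of y] by (intro mult_mono) auto
      qed (use AC M \<delta>(1) in auto)
      show "\<And>y. M < norm y \<Longrightarrow> K x y * f y = 0" using M by auto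
    qed
  qed
  obtain B0 where B0: "\<And>f. f \<in> Lp_space q \<Longrightarrow> Lp_norm q (T' f) \<le> B0 * Lp_norm q f"
    using T' unfolding bounded_operator_Lp_def by blast
  \<comment> \<open>The operator bound concerns norms, that is, \<open>q\<close>-th roots, whereas
    Chebyshev's inequality uses the \<open>q\<close>-th power; hence the exponent.\<close>
  define B where "B = \<bar>B0\<bar> powr q"
  have T'L: "T' f \<in> Lp_space q" if "f \<in> Lp_space q" for f
    using T' that unfolding bounded_operator_Lp_def by blast
  have meas: "T f \<in> borel_measurable lebesgue" if "f \<in> bcs" for f
    using borel_measurable_AE[OF _ TT'[OF that]] T'L[of f] bcs_Lp_space[OF that, of q] q
    by (auto simp: Lp_space_def)
  have strong: "emeasure lebesgue {x. t < cmod (T f x)} \<le> ennreal (B * (LINT x|lebesgue. cmod (f x) powr q) / t powr q)"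
    if f: "f \<in> bcs" and t: "0 < t" for f t
  proof -
    have fL: "f \<in> Lp_space q" using f q by (intro bcs_Lp_space) auto
    define I J where "I = (LINT x|lebesgue. cmod (T' f x) powr q)" and "J = (LINT x|lebesgue. cmod (f x) powr q)"
    have IJ: "0 \<le> I" "0 \<le> J" by (auto simp: I_def J_def)
    have "I powr (1 / q) \<le> B0 * J powr (1 / q)" using B0[OF fL] by (simp add: Lp_norm_def I_def J_def)
    also have "\<dots> \<le> \<bar>B0\<bar> * J powr (1 / q)" by (intro mult_right_mono) auto
    finally have "(I powr (1 / q)) powr q \<le> (\<bar>B0\<bar> * J powr (1 / q)) powr q" using q by (intro powr_mono2) auto
    then have IB: "I \<le> B * J" using q IJ by (simp add: powr_powr powr_mult B_def)
    have [measurable]: "T f \<in> borel_measurable lebesgue" "T' f \<in> borel_measurable lebesgue"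
      using meas[OF f] T'L[OF fL] by (auto simp: Lp_space_def)
    have "emeasure lebesgue {x. t < cmod (T f x)} = emeasure lebesgue {x. t < cmod (T' f x)}"
      using TT'[OF f] by (intro emeasure_eq_AE superlevel_sets) auto
    also have "\<dots> \<le> ennreal (I / t powr q)"
      unfolding I_def using q by (intro emeasure_superlevel_Lp T'L fL t) auto
    also have "\<dots> \<le> ennreal (B * J / t powr q)" using IB by (intro ennreal_leI divide_right_mono) auto
    finally show ?thesis by (simp add: J_def)
  qed
  have "cz_data T K q B \<rho>"
    by unfold_locales (use lin meas q strong rep intK \<rho>0 \<rho>s snd fst in \<open>auto simp: B_def\<close>)
  then show thesis by (rule that)
qed

section \<open>Weak type (1,1)\<close>

text \<open>A majorant, as a function of \<open>x\<close>, for the oscillation of \<open>K x\<close>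
  over the cube \<open>p\<close>. Its value on the annulus between the triples of consecutive
  ancestors is the bound valid outside the inner triple, and it does not depend on the two points of
  the cube being compared.\<close>

definition annular_kernel :: "(nat \<Rightarrow> real) \<Rightarrow> ('n::finite \<Rightarrow> bool) \<Rightarrow> int \<times> ('n \<Rightarrow> int) \<Rightarrow> real^'n \<Rightarrow> ennreal" where
  "annular_kernel \<rho> \<alpha> p x = (\<Sum>n. ennreal (\<rho> n / (2 powi (fst p + int n)) ^ CARD('n)) *
     indicator (triple_cube \<alpha> (fst p + int (Suc n)) (grid_index \<alpha> (fst p + int (Suc n)) (corner \<alpha> (fst p) (snd p))) -
       triple_cube \<alpha> (fst p + int n) (grid_index \<alpha> (fst p + int n) (corner \<alpha> (fst p) (snd p)))) x)"

abbreviation itriple :: "('n::finite \<Rightarrow> bool) \<Rightarrow> int \<times> ('n \<Rightarrow> int) \<Rightarrow> (real^'n) set" where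
  "itriple \<alpha> p \<equiv> triple_cube \<alpha> (fst p) (snd p)"

lemma annular_kernel_measurable [measurable]:
  "annular_kernel \<rho> \<alpha> p \<in> borel_measurable lebesgue"
proof -
  have "(\<lambda>x. annular_kernel \<rho> \<alpha> p x) \<in> borel_measurable lebesgue"
    unfolding annular_kernel_def by measurable
  then show ?thesis by simp
qed

text \<open>This is Hoermander's integral condition in dyadic form. The outer triple of the
  \<open>n\<close>-th annulus has side \<open>6 * 2 powi (fst p + int n)\<close>, so its volume
  cancels the denominator up to the factor \<open>6 ^ CARD('n)\<close>.\<close>

lemma nn_integral_annular_kernel_le:
  fixes p :: "int \<times> ('n::finite \<Rightarrow> int)"
  assumes "\<And>n. 0 \<le> \<rho> n" "summable \<rho>"
  shows "(\<integral>\<^sup>+x. annular_kernel \<rho> \<alpha> p x \<partial>lebesgue) \<le> ennreal (6 ^ CARD('n) * suminf \<rho>)"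
proof -
  define c where "c = corner \<alpha> (fst p) (snd p)"
  have step: "(\<integral>\<^sup>+x. ennreal (\<rho> n / (2 powi (fst p + int n)) ^ CARD('n)) *
     indicator (triple_cube \<alpha> (fst p + int (Suc n)) (grid_index \<alpha> (fst p + int (Suc n)) c) -
       triple_cube \<alpha> (fst p + int n) (grid_index \<alpha> (fst p + int n) c)) x \<partial>lebesgue) \<le> ennreal (6 ^ CARD('n) * \<rho> n)" for n
  proof -
    define r :: real where "r = 2 powi (fst p + int n)"
    have r: "0 < r" unfolding r_def by simp
    have r2: "2 powi (fst p + int (Suc n)) = 2 * r" by (simp add: r_def power_int_add)
    have "(\<integral>\<^sup>+x. ennreal (\<rho> n / r ^ CARD('n)) *
       indicator (triple_cube \<alpha> (fst p + int (Suc n)) (grid_index \<alpha> (fst p + int (Suc n)) c) -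
       triple_cube \<alpha> (fst p + int n) (grid_index \<alpha> (fst p + int n) c)) x \<partial>lebesgue)
      \<le> (\<integral>\<^sup>+x. ennreal (\<rho> n / r ^ CARD('n)) *
       indicator (triple_cube \<alpha> (fst p + int (Suc n)) (grid_index \<alpha> (fst p + int (Suc n)) c)) x \<partial>lebesgue)"
      by (intro nn_integral_mono mult_left_mono) (auto simp: indicator_def)
    also have "\<dots> = ennreal (\<rho> n / r ^ CARD('n)) * ennreal (3 ^ CARD('n) * (2 * r) ^ CARD('n))"
      by (subst nn_integral_cmult_indicator) (auto simp: r2[symmetric])
    also have "\<dots> = ennreal (\<rho> n / r ^ CARD('n) * (3 ^ CARD('n) * (2 * r) ^ CARD('n)))"
      using assms(1) r by (subst ennreal_mult) auto
    also have "\<rho> n / r ^ CARD('n) * (3 ^ CARD('n) * (2 * r) ^ CARD('n)) = 6 ^ CARD('n) * \<rho> n"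
      using r by (simp add: power_mult_distrib) (simp add: power_mult_distrib[symmetric])
    finally show ?thesis by (simp add: r_def)
  qed
  have "(\<integral>\<^sup>+x. annular_kernel \<rho> \<alpha> p x \<partial>lebesgue) = (\<Sum>n. \<integral>\<^sup>+x. ennreal (\<rho> n / (2 powi (fst p + int n)) ^ CARD('n)) *
     indicator (triple_cube \<alpha> (fst p + int (Suc n)) (grid_index \<alpha> (fst p + int (Suc n)) c) -
       triple_cube \<alpha> (fst p + int n) (grid_index \<alpha> (fst p + int n) c)) x \<partial>lebesgue)"
    unfolding annular_kernel_def c_def by (intro nn_integral_suminf) auto
  also have "\<dots> \<le> (\<Sum>n. ennreal (6 ^ CARD('n) * \<rho> n))" by (intro suminf_le step) auto
  also have "\<dots> = ennreal (6 ^ CARD('n) * suminf \<rho>)"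
    using assms by (subst suminf_ennreal2) (auto intro: summable_mult simp: suminf_mult)
  finally show ?thesis .
qed

lemma ennreal_suminf_ge_term: "f j \<le> (\<Sum>n. f n :: ennreal)"
  using sum_le_suminf[of f "{j}"] by simp

text \<open>The annulus of \<open>x\<close> is found from the first ancestor whose triple contains
  \<open>x\<close>. It is not the cube itself, so the preceding triple exists and misses
  \<open>x\<close>, which is where the kernel bound applies.\<close>

lemma (in cz_data) kernel_diff_le_annular_kernel:
  assumes "y \<in> icube \<alpha> p" "y' \<in> icube \<alpha> p" "x \<notin> itriple \<alpha> p"
  shows "ennreal (cmod (K x y - K x y')) \<le> annular_kernel \<rho> \<alpha> p x"
proof -
  define k c where "k = fst p" and "c = corner \<alpha> (fst p) (snd p)"
  define R where "R n = triple_cube \<alpha> (k + int n) (grid_index \<alpha> (k + int n) c)" for n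
  have c: "c \<in> icube \<alpha> p" by (simp add: c_def cube_nonempty)
  have yc: "grid_index \<alpha> (k + int n) y = grid_index \<alpha> (k + int n) c" for n
    using grid_index_mono[of \<alpha> k y c "k + int n"] assms(1) c by (simp add: mem_cube k_def)
  define n where "n = (LEAST n. x \<in> R n)"
  have n: "x \<in> R n" unfolding n_def using ancestors_exhaust[of x \<alpha> k c] by (auto simp: R_def intro: LeastI_ex)
  have "x \<notin> R 0" using assms(3) c by (simp add: R_def mem_cube k_def)
  then have "n \<noteq> 0" using n by (intro notI) auto
  then obtain j where j: "n = Suc j" by (cases n) auto
  have xj: "x \<notin> R j" using not_less_Least[of j "\<lambda>n. x \<in> R n"] j unfolding n_def[symmetric] by simp
  have "cmod (K x y - K x y') \<le> \<rho> j / (2 powi (k + int j)) ^ CARD('n)"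
    using kernel_snd[of y \<alpha> k "snd p" y' x j] assms xj yc by (simp add: k_def R_def)
  then have "ennreal (cmod (K x y - K x y')) \<le> ennreal (\<rho> j / (2 powi (k + int j)) ^ CARD('n)) * indicator (R (Suc j) - R j) x"
    using n xj j by (simp add: ennreal_leI)
  also have "\<dots> \<le> (\<Sum>n. ennreal (\<rho> n / (2 powi (k + int n)) ^ CARD('n)) * indicator (R (Suc n) - R n) x)"
    by (rule ennreal_suminf_ge_term)
  finally show ?thesis by (simp add: annular_kernel_def R_def k_def c_def)
qed

lemma sum_disjoint_indicator:
  fixes f :: "'i \<Rightarrow> 'b::comm_monoid_add"
  assumes "finite C" "disjoint_family_on A C" "p \<in> C" "y \<in> A p"
    and "\<And>q. y \<notin> A q \<Longrightarrow> f q = 0"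
  shows "(\<Sum>q\<in>C. f q) = f p"
proof -
  have "f q = 0" if "q \<in> C - {p}" for q
    using disjoint_family_onD[OF assms(2), of q p] that assms(3,4) by (intro assms(5)) blast
  then have "(\<Sum>q\<in>C. f q) = (\<Sum>q\<in>{p}. f q)"
    using assms(1,3) by (intro sum.mono_neutral_right) auto
  then show ?thesis by simp
qed

text \<open>On each cube the mean value zero allows subtracting the constant \<open>K x c\<close>
  from the kernel, after which only its oscillation counts. The resulting majorant \<open>u\<close>
  is integrable by the integral condition, and Markov's inequality finishes.\<close>

lemma (in cz_data) bad_part:
  assumes b: "b \<in> bcs" and C: "finite C" "disjoint_family_on (icube \<alpha>) C"
    and supp_b: "\<And>x. x \<notin> (\<Union>p\<in>C. icube \<alpha> p) \<Longrightarrow> b x = 0"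
    and mean: "\<And>p. p \<in> C \<Longrightarrow> (LINT x|lebesgue. cut (icube \<alpha> p) b x) = 0" and t: "0 < t"
  shows "emeasure lebesgue {x. x \<notin> (\<Union>p\<in>C. itriple \<alpha> p) \<and> t < cmod (T b x)} \<le>
     ennreal (6 ^ CARD('n) * suminf \<rho> * (LINT x|lebesgue. cmod (b x)) / t)"
proof -
  define N where "N p = (\<integral>\<^sup>+y. indicator (icube \<alpha> p) y * ennreal (cmod (b y)) \<partial>lebesgue)" for p
  define u where "u x = (\<Sum>p\<in>C. N p * annular_kernel \<rho> \<alpha> p x)" for x
  have bm [measurable]: "b \<in> borel_measurable lebesgue" using b by (rule bcs_measurable)
  have um [measurable]: "u \<in> borel_measurable lebesgue" unfolding u_def by measurable
  have bi: "integrable lebesgue b" using b by (rule bcs_integrable)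
  have split: "(\<Sum>p\<in>C. indicator (icube \<alpha> p) y *\<^sub>R z) = z" if "b y \<noteq> 0" for y and z :: complex
  proof -
    obtain p where p: "p \<in> C" "y \<in> icube \<alpha> p" using supp_b[of y] \<open>b y \<noteq> 0\<close> by blast
    have "(\<Sum>p\<in>C. indicator (icube \<alpha> p) y *\<^sub>R z) = indicator (icube \<alpha> p) y *\<^sub>R z"
      by (rule sum_disjoint_indicator[OF C p]) simp
    then show ?thesis using p by simp
  qed
  \<comment> \<open>Finiteness of \<open>C\<close> matters here: a finite union of closed cubes is
    closed and still lies in the union of the triples.\<close>
  have not_supp: "x \<notin> supp b" if "x \<notin> (\<Union>p\<in>C. itriple \<alpha> p)" for x
  proof -
    have "supp b \<subseteq> (\<Union>p\<in>C. closure (icube \<alpha> p))"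
      unfolding supp_def
    proof (rule closure_minimal)
      show "{x. b x \<noteq> 0} \<subseteq> (\<Union>p\<in>C. closure (icube \<alpha> p))"
        using supp_b closure_subset by blast
      show "closed (\<Union>p\<in>C. closure (icube \<alpha> p))" using C by (intro closed_UN) auto
    qed
    also have "\<dots> \<subseteq> (\<Union>p\<in>C. itriple \<alpha> p)" using closure_cube_subset_triple_cube by blast
    finally show ?thesis using that by blast
  qed
  have bound: "ennreal (cmod (LINT y|lebesgue. K x y * b y)) \<le> u x" if x: "x \<notin> (\<Union>p\<in>C. itriple \<alpha> p)" for x
  proof -
    have Kb: "integrable lebesgue (\<lambda>y. K x y * b y)" by (rule kernel_integrable[OF b not_supp[OF x]])
    have int1: "integrable lebesgue (\<lambda>y. indicator (icube \<alpha> p) y *\<^sub>R (K x y * b y))" for p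
      by (intro integrable_mult_indicator Kb) auto
    have int2: "integrable lebesgue (\<lambda>y. K x c * (indicator (icube \<alpha> p) y *\<^sub>R b y))" for p c
      by (intro integrable_mult_right integrable_mult_indicator bi) auto
    have "(LINT y|lebesgue. K x y * b y) = (LINT y|lebesgue. (\<Sum>p\<in>C. indicator (icube \<alpha> p) y *\<^sub>R (K x y * b y)))"
    proof (intro Bochner_Integration.integral_cong refl)
      fix y show "K x y * b y = (\<Sum>p\<in>C. indicator (icube \<alpha> p) y *\<^sub>R (K x y * b y))"
        using split[of y "K x y * b y"] by (cases "b y = 0") simp_all
    qed
    also have "\<dots> = (\<Sum>p\<in>C. LINT y|lebesgue. indicator (icube \<alpha> p) y *\<^sub>R (K x y * b y))"
      by (intro Bochner_Integration.integral_sum int1)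
    also have "ennreal (cmod \<dots>) \<le> (\<Sum>p\<in>C. ennreal (cmod (LINT y|lebesgue. indicator (icube \<alpha> p) y *\<^sub>R (K x y * b y))))"
      by (subst sum_ennreal) (auto intro!: ennreal_leI norm_sum)
    also have "\<dots> \<le> (\<Sum>p\<in>C. N p * annular_kernel \<rho> \<alpha> p x)"
    proof (rule sum_mono)
      fix p assume p: "p \<in> C"
      define c where "c = corner \<alpha> (fst p) (snd p)"
      have c: "c \<in> icube \<alpha> p" by (simp add: c_def cube_nonempty)
      have xp: "x \<notin> itriple \<alpha> p" using x p by auto
      \<comment> \<open>The subtracted integral vanishes by the mean value hypothesis, so any fixed
        point of the cube may serve as \<open>c\<close>.\<close>
      have "(LINT y|lebesgue. indicator (icube \<alpha> p) y *\<^sub>R (K x y * b y))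
         = (LINT y|lebesgue. indicator (icube \<alpha> p) y *\<^sub>R (K x y * b y)) - K x c * (LINT y|lebesgue. cut (icube \<alpha> p) b y)"
        using mean[OF p] by simp
      also have "\<dots> = (LINT y|lebesgue. indicator (icube \<alpha> p) y *\<^sub>R (K x y * b y) - K x c * (indicator (icube \<alpha> p) y *\<^sub>R b y))"
        by (simp only: Bochner_Integration.integral_diff[OF int1 int2] integral_mult_right_zero)
      finally have eq: "(LINT y|lebesgue. indicator (icube \<alpha> p) y *\<^sub>R (K x y * b y)) = \<dots>" .
      have "ennreal (cmod (LINT y|lebesgue. indicator (icube \<alpha> p) y *\<^sub>R (K x y * b y)))
        \<le> (\<integral>\<^sup>+y. ennreal (cmod (indicator (icube \<alpha> p) y *\<^sub>R (K x y * b y) - K x c * (indicator (icube \<alpha> p) y *\<^sub>R b y))) \<partial>lebesgue)"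
        unfolding eq using int1 int2 by (intro integral_norm_bound_ennreal) auto
      also have "\<dots> \<le> (\<integral>\<^sup>+y. annular_kernel \<rho> \<alpha> p x * (indicator (icube \<alpha> p) y * ennreal (cmod (b y))) \<partial>lebesgue)"
      proof (rule nn_integral_mono)
        fix y
        show "ennreal (cmod (indicator (icube \<alpha> p) y *\<^sub>R (K x y * b y) - K x c * (indicator (icube \<alpha> p) y *\<^sub>R b y)))
          \<le> annular_kernel \<rho> \<alpha> p x * (indicator (icube \<alpha> p) y * ennreal (cmod (b y)))"
        proof (cases "y \<in> icube \<alpha> p")
          case True
          have "ennreal (cmod (K x y * b y - K x c * b y)) = ennreal (cmod (K x y - K x c)) * ennreal (cmod (b y))"
            by (simp add: ennreal_mult'[symmetric] norm_mult[symmetric] left_diff_distrib)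
          also have "\<dots> \<le> annular_kernel \<rho> \<alpha> p x * ennreal (cmod (b y))"
            by (intro mult_right_mono kernel_diff_le_annular_kernel True c xp) auto
          finally show ?thesis using True by simp
        qed simp
      qed
      also have "\<dots> = N p * annular_kernel \<rho> \<alpha> p x"
        unfolding N_def by (subst nn_integral_cmult) (auto simp: mult.commute)
      finally show "ennreal (cmod (LINT y|lebesgue. indicator (icube \<alpha> p) y *\<^sub>R (K x y * b y))) \<le> N p * annular_kernel \<rho> \<alpha> p x" .
    qed
    finally show ?thesis by (simp add: u_def)
  qed
  have sumN: "(\<Sum>p\<in>C. N p) \<le> ennreal (LINT x|lebesgue. cmod (b x))"
  proof -
    have "(\<Sum>p\<in>C. N p) = (\<integral>\<^sup>+y. (\<Sum>p\<in>C. indicator (icube \<alpha> p) y * ennreal (cmod (b y))) \<partial>lebesgue)"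
      unfolding N_def by (subst nn_integral_sum) auto
    also have "\<dots> \<le> (\<integral>\<^sup>+y. ennreal (cmod (b y)) \<partial>lebesgue)"
    proof (rule nn_integral_mono)
      fix y
      show "(\<Sum>p\<in>C. indicator (icube \<alpha> p) y * ennreal (cmod (b y))) \<le> ennreal (cmod (b y))"
      proof (cases "y \<in> (\<Union>p\<in>C. icube \<alpha> p)")
        case True
        then obtain p where p: "p \<in> C" "y \<in> icube \<alpha> p" by blast
        have "(\<Sum>p\<in>C. indicator (icube \<alpha> p) y * ennreal (cmod (b y))) = indicator (icube \<alpha> p) y * ennreal (cmod (b y))"
          by (rule sum_disjoint_indicator[OF C p]) simp
        then show ?thesis using p by simp
      next
        case False
        then show ?thesis by (auto intro!: sum_nonpos simp: indicator_def)
      qed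
    qed
    also have "\<dots> = ennreal (LINT x|lebesgue. cmod (b x))"
      using bi by (intro nn_integral_eq_integral) auto
    finally show ?thesis .
  qed
  have intu: "(\<integral>\<^sup>+x. u x \<partial>lebesgue) \<le> ennreal (6 ^ CARD('n) * suminf \<rho>) * ennreal (LINT x|lebesgue. cmod (b x))"
  proof -
    have "(\<integral>\<^sup>+x. u x \<partial>lebesgue) = (\<Sum>p\<in>C. N p * (\<integral>\<^sup>+x. annular_kernel \<rho> \<alpha> p x \<partial>lebesgue))"
      unfolding u_def by (subst nn_integral_sum) (auto simp: nn_integral_cmult)
    also have "\<dots> \<le> (\<Sum>p\<in>C. N p * ennreal (6 ^ CARD('n) * suminf \<rho>))"
      by (intro sum_mono mult_left_mono nn_integral_annular_kernel_le \<rho>_nonneg \<rho>_summable) auto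
    also have "\<dots> = (\<Sum>p\<in>C. N p) * ennreal (6 ^ CARD('n) * suminf \<rho>)" by (simp add: sum_distrib_right)
    also have "\<dots> \<le> ennreal (LINT x|lebesgue. cmod (b x)) * ennreal (6 ^ CARD('n) * suminf \<rho>)"
      by (intro mult_right_mono sumN) auto
    finally show ?thesis by (simp add: mult.commute)
  qed
  have [measurable]: "T b \<in> borel_measurable lebesgue" using T_measurable[OF b] .
  have "emeasure lebesgue {x. x \<notin> (\<Union>p\<in>C. itriple \<alpha> p) \<and> t < cmod (T b x)}
     \<le> emeasure lebesgue {x\<in>space lebesgue. 1 \<le> ennreal (1 / t) * u x}"
  proof (rule emeasure_mono_AE)
    show "AE x in lebesgue. x \<in> {x. x \<notin> (\<Union>p\<in>C. itriple \<alpha> p) \<and> t < cmod (T b x)} \<longrightarrow>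
        x \<in> {x \<in> space lebesgue. 1 \<le> ennreal (1 / t) * u x}"
      using representation[OF b]
    proof eventually_elim
      case (elim x)
      show ?case
      proof
        assume "x \<in> {x. x \<notin> (\<Union>p\<in>C. itriple \<alpha> p) \<and> t < cmod (T b x)}"
        then have x: "x \<notin> (\<Union>p\<in>C. itriple \<alpha> p)" "t < cmod (T b x)" by auto
        have "ennreal t \<le> u x"
          using bound[OF x(1)] elim not_supp[OF x(1)] x(2) by (metis ennreal_leI less_imp_le order_trans)
        then have "ennreal (1 / t) * ennreal t \<le> ennreal (1 / t) * u x" by (intro mult_left_mono) auto
        then show "x \<in> {x \<in> space lebesgue. 1 \<le> ennreal (1 / t) * u x}"
          using t by (simp add: ennreal_mult'[symmetric])
      qed
    qed
  qed measurable
  also have "\<dots> \<le> ennreal (1 / t) * (\<integral>\<^sup>+x. u x * indicator (space lebesgue) x \<partial>lebesgue)"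
    by (intro nn_integral_Markov_inequality) auto
  also have "\<dots> = ennreal (1 / t) * (\<integral>\<^sup>+x. u x \<partial>lebesgue)" by simp
  also have "\<dots> \<le> ennreal (1 / t) * (ennreal (6 ^ CARD('n) * suminf \<rho>) * ennreal (LINT x|lebesgue. cmod (b x)))"
    by (intro mult_left_mono intu) auto
  also have "\<dots> = ennreal (6 ^ CARD('n) * suminf \<rho> * (LINT x|lebesgue. cmod (b x)) / t)"
    using t suminf_nonneg[OF \<rho>_summable \<rho>_nonneg] by (simp add: ennreal_mult'[symmetric] ennreal_mult''[symmetric])
  finally show ?thesis .
qed

section \<open>Calderon-Zygmund decomposition at a given height\<close>

lemma Union_icube_sets: "(\<Union>p\<in>M. icube \<alpha> p) \<in> sets lebesgue"
  by (intro sets.countable_UN' countable_icube_index) auto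

lemma bcs_sum:
  assumes "finite J" "\<And>p. p \<in> J \<Longrightarrow> F p \<in> bcs"
  shows "(\<lambda>x. \<Sum>p\<in>J. F p x) \<in> bcs"
  using assms
proof (induction J)
  case empty
  have "(\<lambda>x. 0) \<in> bcs" unfolding bcs_iff by (auto intro: exI[of _ 1])
  then show ?case by simp
next
  case (insert p J)
  then show ?case using bcs_lincomb[of "F p" "\<lambda>x. \<Sum>p\<in>J. F p x" 1 1] by simp
qed

lemma bcs_indicator_cube: "(\<lambda>x. indicator (cube \<alpha> k m) x *\<^sub>R z) \<in> bcs"
  unfolding bcs_iff
proof (intro conjI)
  define M where "M = norm (corner \<alpha> k m) + real CARD('a) * 2 powi k"
  have M: "norm x \<le> M" if "x \<in> cube \<alpha> k m" for x :: "real^'a"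
    using diam_cube[OF cube_nonempty that] norm_triangle_ineq2[of x "corner \<alpha> k m"] by (simp add: M_def)
  have "cmod (indicator (cube \<alpha> k m) x *\<^sub>R z) \<le> max 1 (max M (cmod z)) \<and>
     (max 1 (max M (cmod z)) < norm x \<longrightarrow> indicator (cube \<alpha> k m) x *\<^sub>R z = 0)" for x :: "real^'a"
    using M[of x] by (cases "x \<in> cube \<alpha> k m") (auto simp: le_max_iff_disj not_less)
  then show "\<exists>M>0. \<forall>x::real^'a. cmod (indicator (cube \<alpha> k m) x *\<^sub>R z) \<le> M \<and> (M < norm x \<longrightarrow> indicator (cube \<alpha> k m) x *\<^sub>R z = 0)"
    by (intro exI[of _ "max 1 (max M (cmod z))"]) auto
qed measurable

lemma L1_norm_triangle:
  assumes "integrable M f" "integrable M g"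
  shows "(LINT x|M. cmod (f x + g x)) \<le> (LINT x|M. cmod (f x)) + (LINT x|M. cmod (g x))"
proof -
  have "(LINT x|M. cmod (f x + g x)) \<le> (LINT x|M. cmod (f x) + cmod (g x))"
    using assms by (intro integral_mono norm_triangle_ineq) auto
  also have "\<dots> = (LINT x|M. cmod (f x)) + (LINT x|M. cmod (g x))"
    using assms by (intro Bochner_Integration.integral_add) auto
  finally show ?thesis .
qed

lemma L1_norm_cut_le:
  assumes "integrable lebesgue f" "S \<in> sets lebesgue"
  shows "(LINT x|lebesgue. cmod (cut S f x)) \<le> (LINT x|lebesgue. cmod (f x))"
proof (rule integral_mono)
  show "integrable lebesgue (\<lambda>x. cmod (cut S f x))"
    using assms by (intro integrable_norm integrable_mult_indicator) auto
  show "integrable lebesgue (\<lambda>x. cmod (f x))" using assms by auto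
  show "cmod (cut S f x) \<le> cmod (f x)" for x by (auto simp: indicator_def)
qed

text \<open>The cubes are enumerated by \<open>to_nat\<close>. A point lies in at most one of them,
  so the unions of the tails decrease to the empty set, and finite measure makes their measures tend
  to 0.\<close>

lemma small_tail:
  fixes M :: "(int \<times> ('n::finite \<Rightarrow> int)) set"
  assumes disj: "disjoint_family_on (icube \<alpha>) M"
    and fin: "emeasure lebesgue (\<Union>p\<in>M. icube \<alpha> p) < \<infinity>" and "0 < (\<delta>::real)"
  obtains J where "finite J" "J \<subseteq> M" "emeasure lebesgue (\<Union>p\<in>M - J. icube \<alpha> p) \<le> ennreal \<delta>"
proof -
  define A where "A j = (\<Union>p\<in>{p\<in>M. j \<le> to_nat p}. icube \<alpha> p)" for j :: nat
  have As: "A j \<in> sets lebesgue" for j unfolding A_def by (intro sets.countable_UN' countable_icube_index) auto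
  have dec: "decseq A" unfolding A_def decseq_def by fastforce
  have Afin: "emeasure lebesgue (A j) \<noteq> \<infinity>" for j
  proof -
    have "emeasure lebesgue (A j) \<le> emeasure lebesgue (\<Union>p\<in>M. icube \<alpha> p)"
      by (intro emeasure_mono sets.countable_UN' countable_icube_index) (auto simp: A_def)
    then show ?thesis using fin by (auto simp: top_unique)
  qed
  have "(\<Inter>j. A j) = {}"
  proof (rule equals0I)
    fix x assume x: "x \<in> (\<Inter>j. A j)"
    then obtain p where p: "p \<in> M" "x \<in> icube \<alpha> p" by (auto simp: A_def)
    from x have "x \<in> A (Suc (to_nat p))" by blast
    then obtain r where r: "r \<in> M" "Suc (to_nat p) \<le> to_nat r" "x \<in> icube \<alpha> r" by (auto simp: A_def)
    then have "r \<noteq> p" by auto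
    then show False using disjoint_family_onD[OF disj r(1) p(1)] p r by blast
  qed
  then have "(\<lambda>j. emeasure lebesgue (A j)) \<longlonglongrightarrow> 0"
    using Lim_emeasure_decseq[of A lebesgue] As dec Afin by (auto simp: image_subset_iff)
  then have "eventually (\<lambda>j. emeasure lebesgue (A j) < ennreal \<delta>) sequentially"
    using \<open>0 < \<delta>\<close> by (intro order_tendstoD) auto
  then obtain j where j: "emeasure lebesgue (A j) < ennreal \<delta>" by (auto simp: eventually_sequentially)
  define J where "J = {p\<in>M. to_nat p < j}"
  have "finite J"
  proof (rule inj_on_finite[where f = to_nat and B = "{..<j}"])
    show "inj_on to_nat J" by (auto simp: inj_on_def)
  qed (auto simp: J_def)
  moreover have "M - J = {p\<in>M. j \<le> to_nat p}" by (auto simp: J_def)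
  then have "(\<Union>p\<in>M - J. icube \<alpha> p) = A j" by (simp add: A_def)
  ultimately show thesis using j by (intro that[of J]) (auto simp: J_def less_imp_le)
qed

lemma set_LINT_mono_set:
  fixes h :: "'a \<Rightarrow> real"
  assumes "integrable M h" "\<And>x. 0 \<le> h x" "A \<in> sets M" "B \<in> sets M" "A \<subseteq> B"
  shows "(LINT x:A|M. h x) \<le> (LINT x:B|M. h x)"
  unfolding set_lebesgue_integral_def
  using assms by (intro integral_mono integrable_mult_indicator) (auto simp: indicator_def)

lemma set_LINT_mono:
  fixes f g :: "'a \<Rightarrow> real"
  assumes "integrable M f" "integrable M g" "A \<in> sets M" "\<And>x. x \<in> A \<Longrightarrow> f x \<le> g x"
  shows "(LINT x:A|M. f x) \<le> (LINT x:A|M. g x)"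
  using assms by (intro set_integral_mono) (auto simp: set_integrable_def intro!: integrable_mult_indicator simp del: real_scaleR_def)

text \<open>By maximality the dyadic parent fails the lower bound; its volume is
  \<open>2 ^ CARD('n)\<close> times that of \<open>p\<close>, and the integral over it is at least
  as large.\<close>

lemma parent_average_bound:
  fixes p :: "int \<times> ('n::finite \<Rightarrow> int)" and h :: "real^'n \<Rightarrow> real"
  assumes h: "integrable lebesgue h" "\<And>x. 0 \<le> h x"
    and p: "p \<in> maximal_cubes \<alpha> {p. c * (2 powi fst p) ^ CARD('n) \<le> (LINT x:icube \<alpha> p|lebesgue. h x)}"
  shows "(LINT x:icube \<alpha> p|lebesgue. h x) \<le> 2 ^ CARD('n) * c * (2 powi fst p) ^ CARD('n)"
proof -
  define r where "r = (fst p + 1, grid_index \<alpha> (fst p + 1) (corner \<alpha> (fst p) (snd p)))"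
  have sub: "icube \<alpha> p \<subseteq> icube \<alpha> r"
    unfolding r_def by (rule cube_subset[OF cube_nonempty]) (auto simp: mem_cube)
  then have "r \<notin> {p. c * (2 powi fst p) ^ CARD('n) \<le> (LINT x:icube \<alpha> p|lebesgue. h x)}"
    using p unfolding maximal_cubes_def by (auto simp: r_def)
  then have "(LINT x:icube \<alpha> r|lebesgue. h x) \<le> c * (2 powi fst r) ^ CARD('n)" by simp
  moreover have "(LINT x:icube \<alpha> p|lebesgue. h x) \<le> (LINT x:icube \<alpha> r|lebesgue. h x)"
    using h sub by (intro set_LINT_mono_set) auto
  ultimately show ?thesis by (simp add: r_def power_int_add power_mult_distrib mult_ac)
qed

text \<open>
  The stopping rule uses \<open>cmod f + t * indicator U\<close> for an open set \<open>U\<close> around the superlevel set.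
  Since a point of \<open>U\<close> lies in a cube contained in \<open>U\<close>, this gives \<open>cmod f \<le> t\<close> off the
  stopping cubes without Lebesgue's differentiation theorem. Only finitely many stopping cubes enter
  the bad part, because the kernel representation is available only outside the closed support; the
  other ones form the small set \<open>V\<close>.
\<close>

lemma CZ_decomposition:
  fixes f :: "real^'n \<Rightarrow> complex"
  assumes f: "f \<in> bcs" and t: "0 < t" and \<delta>: "0 < \<delta>"
  obtains J g b V where "finite J" "disjoint_family_on (icube \<alpha>) J"
    "g \<in> bcs" "b \<in> bcs" "V \<in> sets lebesgue"
    "\<And>x. f x = g x + b x + cut V f x"
    "\<And>x. cmod (g x) \<le> 2 ^ CARD('n) * t"
    "(LINT x|lebesgue. cmod (g x)) \<le> 2 * (LINT x|lebesgue. cmod (f x))"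
    "(LINT x|lebesgue. cmod (b x)) \<le> 2 * (LINT x|lebesgue. cmod (f x))"
    "\<And>x. x \<notin> (\<Union>p\<in>J. icube \<alpha> p) \<Longrightarrow> b x = 0"
    "\<And>p. p \<in> J \<Longrightarrow> (LINT x|lebesgue. cut (icube \<alpha> p) b x) = 0"
    "emeasure lebesgue (\<Union>p\<in>J. itriple \<alpha> p) \<le> ennreal (3 ^ CARD('n) * (4 * (LINT x|lebesgue. cmod (f x)) / t + 2 * \<delta>))"
    "emeasure lebesgue V \<le> ennreal \<delta>"
proof -
  define L where "L = (LINT x|lebesgue. cmod (f x))"
  have fm [measurable]: "f \<in> borel_measurable lebesgue" using f by (rule bcs_measurable)
  have fi: "integrable lebesgue f" using f by (rule bcs_integrable)
  have L0: "0 \<le> L" by (simp add: L_def)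
  define E where "E = {x. t < cmod (f x)}"
  have Es: "E \<in> sets lebesgue" unfolding E_def by (intro superlevel_sets) auto
  have Em: "emeasure lebesgue E \<le> ennreal (L / t)"
  proof -
    have "emeasure lebesgue E \<le> emeasure lebesgue {x\<in>space lebesgue. t \<le> cmod (f x)}"
    proof (rule emeasure_mono)
      show "E \<subseteq> {x\<in>space lebesgue. t \<le> cmod (f x)}" by (auto simp: E_def)
    qed measurable
    also have "\<dots> \<le> ennreal (1 / t * L)"
      unfolding L_def by (rule integral_Markov_inequality) (use fi t in auto)
    finally show ?thesis by simp
  qed
  obtain U where U: "open U" "E \<subseteq> U" "U - E \<in> lmeasurable" "emeasure lebesgue (U - E) < ennreal \<delta>"
    using sets_lebesgue_outer_open[OF Es \<delta>] by blast
  have Us [measurable]: "U \<in> sets lebesgue" using U(1) by auto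
  have Um: "emeasure lebesgue U \<le> ennreal (L / t + \<delta>)"
  proof -
    have "emeasure lebesgue U = emeasure lebesgue (E \<union> (U - E))" using U(2) by (intro arg_cong2[where f = emeasure]) auto
    also have "\<dots> \<le> emeasure lebesgue E + emeasure lebesgue (U - E)" using Es U by (intro emeasure_subadditive) auto
    also have "\<dots> \<le> ennreal (L / t) + ennreal \<delta>" using Em U(4) by (intro add_mono) auto
    finally show ?thesis using L0 t \<delta> by simp
  qed
  define h where "h x = cmod (f x) + t * indicator U x" for x
  have indU: "integrable lebesgue (\<lambda>x. indicator U x :: real)"
    using Um by (intro integrable_real_indicator) (auto simp: less_top[symmetric] top_unique intro: le_less_trans)
  have hi: "integrable lebesgue h" unfolding h_def using fi indU by auto
  have h0: "0 \<le> h x" for x using t by (simp add: h_def)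
  \<comment> \<open>Chebyshev gives \<open>U\<close> measure at most
    \<open>L / t + \<delta>\<close>, so the added term \<open>t * indicator U\<close> costs only
    about as much as the norm of \<open>f\<close> itself.\<close>
  have hL: "(LINT x|lebesgue. h x) \<le> 2 * L + t * \<delta>"
  proof -
    have "(LINT x|lebesgue. h x) = L + t * (LINT x|lebesgue. indicator U x)"
      unfolding h_def L_def using fi indU by (subst Bochner_Integration.integral_add) auto
    also have "(LINT x|lebesgue. indicator U x) = measure lebesgue U" by simp
    also have "measure lebesgue U \<le> L / t + \<delta>"
      using Um L0 t \<delta> unfolding measure_def by (intro enn2real_leI) auto
    then have "L + t * measure lebesgue U \<le> L + t * (L / t + \<delta>)" using t by (intro add_left_mono mult_left_mono) auto
    finally show ?thesis using t by (simp add: algebra_simps)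
  qed
  define C where "C = {p. t / 2 * (2 powi fst p) ^ CARD('n) \<le> (LINT x:icube \<alpha> p|lebesgue. h x)}"
  define M where "M = maximal_cubes \<alpha> C"
  have t2: "0 < t / 2" using t by simp
  obtain K where K: "\<And>p. p \<in> C \<Longrightarrow> fst p \<le> K"
    using scale_bounded[OF hi h0 t2, of \<alpha>] unfolding C_def by auto
  have UM: "(\<Union>p\<in>M. icube \<alpha> p) = (\<Union>p\<in>C. icube \<alpha> p)" unfolding M_def by (rule Union_maximal_cubes[OF K])
  have dM: "disjoint_family_on (icube \<alpha>) M" unfolding M_def by (rule maximal_cubes_disjoint)
  have VM: "emeasure lebesgue (\<Union>p\<in>M. icube \<alpha> p) \<le> ennreal (4 * L / t + 2 * \<delta>)"
  proof -
    have "emeasure lebesgue (\<Union>p\<in>M. icube \<alpha> p) \<le> ennreal ((LINT x|lebesgue. h x) / (t / 2))"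
      unfolding UM by (rule dyadic_weak_type[OF hi h0 t2]) (simp add: C_def)
    also have "\<dots> \<le> ennreal ((2 * L + t * \<delta>) / (t / 2))"
      using hL t by (intro ennreal_leI divide_right_mono) auto
    also have "(2 * L + t * \<delta>) / (t / 2) = 4 * L / t + 2 * \<delta>" using t by (simp add: field_simps)
    finally show ?thesis .
  qed
  have Mavg: "(LINT x:icube \<alpha> p|lebesgue. cmod (f x)) \<le> 2 ^ CARD('n) * t * (2 powi fst p) ^ CARD('n)" if "p \<in> M" for p
  proof -
    have "(LINT x:icube \<alpha> p|lebesgue. cmod (f x)) \<le> (LINT x:icube \<alpha> p|lebesgue. h x)"
    proof (rule set_LINT_mono)
      show "integrable lebesgue (\<lambda>x. cmod (f x))" using fi by auto
      show "cmod (f x) \<le> h x" for x using t by (simp add: h_def)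
    qed (auto intro: hi)
    also have "\<dots> \<le> 2 ^ CARD('n) * (t / 2) * (2 powi fst p) ^ CARD('n)"
      using parent_average_bound[OF hi h0, of p \<alpha> "t / 2"] that unfolding M_def C_def by simp
    also have "\<dots> \<le> 2 ^ CARD('n) * t * (2 powi fst p) ^ CARD('n)"
      using t by (intro mult_right_mono) auto
    finally show ?thesis .
  qed
  have off: "cmod (f x) \<le> t" if "x \<notin> (\<Union>p\<in>M. icube \<alpha> p)" for x
  proof (rule ccontr)
    assume "\<not> cmod (f x) \<le> t"
    then have "x \<in> U" using U(2) by (auto simp: E_def)
    then obtain k where k: "cube \<alpha> k (grid_index \<alpha> k x) \<subseteq> U" using open_contains_cube[OF U(1)] by blast
    define Q where "Q = cube \<alpha> k (grid_index \<alpha> k x)"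
    have "t / 2 * (2 powi k) ^ CARD('n) \<le> t * measure lebesgue Q" using t by (simp add: Q_def)
    also have "\<dots> = (LINT x:Q|lebesgue. t)"
      unfolding set_lebesgue_integral_def Q_def by simp
    also have "\<dots> \<le> (LINT x:Q|lebesgue. h x)"
    proof (rule set_integral_mono)
      show "set_integrable lebesgue Q (\<lambda>_. t)"
        unfolding set_integrable_def Q_def by (intro integrable_scaleR_left integrable_real_indicator) auto
      show "set_integrable lebesgue Q h"
        unfolding set_integrable_def Q_def using hi by (intro integrable_mult_indicator) auto
      show "t \<le> h x" if "x \<in> Q" for x using that k by (auto simp: h_def Q_def)
    qed
    finally have "(k, grid_index \<alpha> k x) \<in> C" by (simp add: C_def Q_def)
    moreover have "x \<in> icube \<alpha> (k, grid_index \<alpha> k x)" by (simp add: mem_cube)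
    ultimately show False using that unfolding UM by blast
  qed
  have "emeasure lebesgue (\<Union>p\<in>M. icube \<alpha> p) < \<infinity>" using VM by (rule le_less_trans) simp
  then obtain J where J: "finite J" "J \<subseteq> M" "emeasure lebesgue (\<Union>p\<in>M - J. icube \<alpha> p) \<le> ennreal \<delta>"
    using small_tail[OF dM _ \<delta>] by blast
  have dJ: "disjoint_family_on (icube \<alpha>) J" using disjoint_family_on_mono[OF J(2) dM] .
  define VJ where "VJ = (\<Union>p\<in>J. icube \<alpha> p)"
  define V where "V = (\<Union>p\<in>M - J. icube \<alpha> p)"
  have Vs: "V \<in> sets lebesgue" "VJ \<in> sets lebesgue"
    unfolding V_def VJ_def by (rule Union_icube_sets)+
  have VVJ: "V \<inter> VJ = {}"
  proof (rule equals0I)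
    fix x assume "x \<in> V \<inter> VJ"
    then obtain p r where "p \<in> M" "p \<notin> J" "x \<in> icube \<alpha> p" "r \<in> J" "x \<in> icube \<alpha> r"
      by (auto simp: V_def VJ_def)
    then show False using disjoint_family_onD[OF dM, of p r] J(2) by blast
  qed
  have VVJ2: "V \<union> VJ = (\<Union>p\<in>M. icube \<alpha> p)"
    using J(2) unfolding V_def VJ_def by auto
  define a where "a p = (LINT x|lebesgue. cut (icube \<alpha> p) f x) / of_real ((2 powi fst p) ^ CARD('n))" for p
  have vol: "0 < (2 powi fst p :: real) ^ CARD('n)" for p :: "int \<times> ('n \<Rightarrow> int)" by simp
  have a_vol: "cmod (a p) * (2 powi fst p) ^ CARD('n) \<le> (LINT x:icube \<alpha> p|lebesgue. cmod (f x))" for p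
  proof -
    have "cmod (a p) * (2 powi fst p) ^ CARD('n) = cmod (LINT x|lebesgue. cut (icube \<alpha> p) f x)"
      using vol[of p] unfolding a_def norm_divide norm_of_real by simp
    also have "\<dots> \<le> (LINT x|lebesgue. cmod (cut (icube \<alpha> p) f x))" by (rule integral_norm_bound)
    also have "\<dots> = (LINT x:icube \<alpha> p|lebesgue. cmod (f x))"
      unfolding set_lebesgue_integral_def by (intro Bochner_Integration.integral_cong) (auto simp: indicator_def)
    finally show ?thesis .
  qed
  have a_le: "cmod (a p) \<le> 2 ^ CARD('n) * t" if "p \<in> J" for p
    using order_trans[OF a_vol Mavg, of p] that J(2) mult_le_cancel_right_pos[OF vol[of p]] by blast
  define G where "G x = (\<Sum>p\<in>J. indicator (icube \<alpha> p) x *\<^sub>R a p)" for x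
  have Gp: "G x = a p" if "p \<in> J" "x \<in> icube \<alpha> p" for x p
  proof -
    have "G x = indicator (icube \<alpha> p) x *\<^sub>R a p"
      unfolding G_def by (rule sum_disjoint_indicator[OF J(1) dJ that]) simp
    then show ?thesis using that by simp
  qed
  have G0: "G x = 0" if "x \<notin> VJ" for x
    using that unfolding G_def VJ_def by (intro sum.neutral) auto
  have Gb: "G \<in> bcs"
    unfolding G_def[abs_def] using J(1) by (intro bcs_sum bcs_indicator_cube) auto
  have GL: "(LINT x|lebesgue. cmod (G x)) \<le> L"
  proof -
    have int: "integrable lebesgue (\<lambda>x. cmod (a p) * indicator (icube \<alpha> p) x)" for p
      by (intro integrable_mult_right integrable_real_indicator) auto
    have "(LINT x|lebesgue. cmod (G x)) \<le> (LINT x|lebesgue. (\<Sum>p\<in>J. cmod (a p) * indicator (icube \<alpha> p) x))"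
    proof (rule integral_mono)
      show "cmod (G x) \<le> (\<Sum>p\<in>J. cmod (a p) * indicator (icube \<alpha> p) x)" for x
        unfolding G_def by (rule order_trans[OF norm_sum]) (simp add: mult.commute)
    qed (use bcs_integrable[OF Gb] int in auto)
    also have "\<dots> = (\<Sum>p\<in>J. cmod (a p) * (2 powi fst p) ^ CARD('n))"
      using int by (subst Bochner_Integration.integral_sum) auto
    also have "\<dots> \<le> (\<Sum>p\<in>J. LINT x:icube \<alpha> p|lebesgue. cmod (f x))" by (intro sum_mono a_vol)
    also have "\<dots> = (LINT x|lebesgue. (\<Sum>p\<in>J. indicator (icube \<alpha> p) x *\<^sub>R cmod (f x)))"
      unfolding set_lebesgue_integral_def using fi
      by (intro Bochner_Integration.integral_sum[symmetric] integrable_mult_indicator) auto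
    also have "\<dots> \<le> (LINT x|lebesgue. cmod (f x))"
    proof (rule integral_mono)
      show "integrable lebesgue (\<lambda>x. \<Sum>p\<in>J. indicator (icube \<alpha> p) x *\<^sub>R cmod (f x))"
        using fi by (intro Bochner_Integration.integrable_sum integrable_mult_indicator) auto
      show "(\<Sum>p\<in>J. indicator (icube \<alpha> p) x *\<^sub>R cmod (f x)) \<le> cmod (f x)" for x
      proof (cases "x \<in> VJ")
        case True
        then obtain p where p: "p \<in> J" "x \<in> icube \<alpha> p" by (auto simp: VJ_def)
        have "(\<Sum>p\<in>J. indicator (icube \<alpha> p) x *\<^sub>R cmod (f x)) = indicator (icube \<alpha> p) x *\<^sub>R cmod (f x)"
          by (rule sum_disjoint_indicator[OF J(1) dJ p]) simp
        then show ?thesis using p by simp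
      next
        case False
        then show ?thesis by (auto simp: VJ_def intro!: sum_nonpos)
      qed
    qed (use fi in auto)
    finally show ?thesis by (simp add: L_def)
  qed
  \<comment> \<open>The good part is \<open>f\<close> off all stopping cubes, the mean of
    \<open>f\<close> on each cube of \<open>J\<close>, and 0 on \<open>V\<close>; the part of
    \<open>f\<close> on \<open>V\<close> is kept as a separate remainder.\<close>
  define g where "g x = cut (- (V \<union> VJ)) f x + G x" for x
  define b where "b x = cut VJ f x - G x" for x
  have cutb: "cut S f \<in> bcs" if "S \<in> sets lebesgue" for S
    using f that by (rule bcs_cut)
  have VJc: "- (V \<union> VJ) \<in> sets lebesgue" using Vs by auto
  show thesis
  proof (rule that[of J g b V])
    show "finite J" "disjoint_family_on (icube \<alpha>) J" by fact+
    show "g \<in> bcs"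
      using bcs_lincomb[OF cutb[OF VJc] Gb, of 1 1] by (simp add: g_def[abs_def])
    show "b \<in> bcs"
      using bcs_diff[OF cutb[OF Vs(2)] Gb] by (simp add: b_def[abs_def])
    show "V \<in> sets lebesgue" by fact
    show "f x = g x + b x + cut V f x" for x
      using VVJ by (auto simp: g_def b_def indicator_def)
    show "cmod (g x) \<le> 2 ^ CARD('n) * t" for x
    proof -
      have t1: "t \<le> 2 ^ CARD('n) * t" using t by simp
      consider "x \<in> VJ" | "x \<in> V" "x \<notin> VJ" | "x \<notin> V \<union> VJ" by auto
      then show ?thesis
      proof cases
        case 1
        then obtain p where p: "p \<in> J" "x \<in> icube \<alpha> p" by (auto simp: VJ_def)
        then show ?thesis using a_le[OF p(1)] Gp[OF p] 1 by (simp add: g_def)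
      next
        case 2
        then show ?thesis using t by (simp add: g_def G0)
      next
        case 3
        then have "cmod (f x) \<le> t" using off VVJ2 by blast
        then show ?thesis using t1 3 by (simp add: g_def G0)
      qed
    qed
    have ci: "integrable lebesgue (cut S f)" "(LINT x|lebesgue. cmod (cut S f x)) \<le> L" if "S \<in> sets lebesgue" for S
      using bcs_integrable[OF cutb[OF that]] L1_norm_cut_le[OF fi that] by (auto simp: L_def)
    show "(LINT x|lebesgue. cmod (g x)) \<le> 2 * (LINT x|lebesgue. cmod (f x))"
      using L1_norm_triangle[OF ci(1)[OF VJc] bcs_integrable[OF Gb]] ci(2)[OF VJc] GL
      by (simp add: g_def[abs_def] L_def[symmetric])
    have mG: "integrable lebesgue (\<lambda>x. - G x)" using bcs_integrable[OF Gb] by simp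
    show "(LINT x|lebesgue. cmod (b x)) \<le> 2 * (LINT x|lebesgue. cmod (f x))"
      using L1_norm_triangle[OF ci(1)[OF Vs(2)] mG] ci(2)[OF Vs(2)] GL
      by (simp add: b_def[abs_def] L_def[symmetric])
    show "b x = 0" if "x \<notin> (\<Union>p\<in>J. icube \<alpha> p)" for x
      using that G0[of x] by (simp add: b_def VJ_def)
    show "(LINT x|lebesgue. cut (icube \<alpha> p) b x) = 0" if p: "p \<in> J" for p
    proof -
      have "cut (icube \<alpha> p) b x = cut (icube \<alpha> p) f x - indicator (icube \<alpha> p) x *\<^sub>R a p" for x
        using Gp[OF p, of x] p by (auto simp: b_def indicator_def VJ_def)
      then have "(LINT x|lebesgue. cut (icube \<alpha> p) b x)
        = (LINT x|lebesgue. cut (icube \<alpha> p) f x) - (LINT x|lebesgue. indicator (icube \<alpha> p) x *\<^sub>R a p)"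
        using ci(1)[of "icube \<alpha> p"] bcs_integrable[OF bcs_indicator_cube]
        by (simp only:) (rule Bochner_Integration.integral_diff, auto)
      also have "(LINT x|lebesgue. indicator (icube \<alpha> p) x *\<^sub>R a p) = (2 powi fst p) ^ CARD('n) *\<^sub>R a p"
        by (subst integral_scaleR_left) (auto intro: integrable_real_indicator)
      also have "\<dots> = (LINT x|lebesgue. cut (icube \<alpha> p) f x)"
        using vol[of p] by (simp add: a_def scaleR_conv_of_real)
      finally show ?thesis by simp
    qed
    show "emeasure lebesgue (\<Union>p\<in>J. itriple \<alpha> p) \<le> ennreal (3 ^ CARD('n) * (4 * (LINT x|lebesgue. cmod (f x)) / t + 2 * \<delta>))"
    proof -
      have "emeasure lebesgue (\<Union>p\<in>J. itriple \<alpha> p) \<le> (\<Sum>p\<in>J. emeasure lebesgue (itriple \<alpha> p))"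
        using J(1) by (intro emeasure_subadditive_finite) auto
      also have "\<dots> = (\<Sum>p\<in>J. ennreal (3 ^ CARD('n)) * emeasure lebesgue (icube \<alpha> p))"
        by (intro sum.cong refl) (simp add: ennreal_mult)
      also have "\<dots> = ennreal (3 ^ CARD('n)) * emeasure lebesgue (\<Union>p\<in>J. icube \<alpha> p)"
        using J(1) dJ by (simp only: sum_distrib_left[symmetric]) (subst sum_emeasure, auto)
      also have "\<dots> \<le> ennreal (3 ^ CARD('n)) * emeasure lebesgue (\<Union>p\<in>M. icube \<alpha> p)"
        using J(2) by (intro mult_left_mono emeasure_mono sets.countable_UN' countable_icube_index) auto
      also have "\<dots> \<le> ennreal (3 ^ CARD('n)) * ennreal (4 * L / t + 2 * \<delta>)"
        by (intro mult_left_mono VM) auto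
      also have "\<dots> = ennreal (3 ^ CARD('n) * (4 * L / t + 2 * \<delta>))"
        using L0 t \<delta> by (subst ennreal_mult) auto
      finally show ?thesis by (simp add: L_def)
    qed
    show "emeasure lebesgue V \<le> ennreal \<delta>" using J(3) by (simp add: V_def)
  qed
qed

context cz_data
begin

lemma T_add:
  assumes "f \<in> bcs" "g \<in> bcs"
  shows "AE x in lebesgue. T (\<lambda>y. f y + g y) x = T f x + T g x"
proof -
  have "AE x in lebesgue. T (\<lambda>y. 1 * f y + 1 * g y) x = 1 * T f x + 1 * T g x"
    using linear assms unfolding linear_operator_on_def by blast
  then show ?thesis by simp
qed

lemma T_diff:
  assumes "f \<in> bcs" "g \<in> bcs"
  shows "AE x in lebesgue. T (\<lambda>y. f y - g y) x = T f x - T g x"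
proof -
  have "AE x in lebesgue. T (\<lambda>y. 1 * f y + (- 1) * g y) x = 1 * T f x + (- 1) * T g x"
    using linear assms unfolding linear_operator_on_def by blast
  then show ?thesis by simp
qed

lemma T_superlevel_sets:
  "f \<in> bcs \<Longrightarrow> {x. t < cmod (T f x)} \<in> sets lebesgue"
  by (intro superlevel_sets T_measurable)

text \<open>Since \<open>cmod (g x)\<close> is at most \<open>c * t\<close>, its \<open>q\<close>-th
  power is at most \<open>(c * t) powr (q - 1)\<close> times itself. In the strong type bound the
  powers of \<open>t\<close> then cancel down to \<open>1 / t\<close>.\<close>

lemma good_part:
  assumes g: "g \<in> bcs" and le: "\<And>x. cmod (g x) \<le> c * t" and "0 < c" "0 < t"
  shows "emeasure lebesgue {x. t < cmod (T g x)} \<le> ennreal (B * c powr (q - 1) * (LINT x|lebesgue. cmod (g x)) / t)"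
proof -
  have pt: "cmod (g x) powr q \<le> (c * t) powr (q - 1) * cmod (g x)" for x
  proof (cases "g x = 0")
    case False
    then have "cmod (g x) powr q = cmod (g x) powr (q - 1) * cmod (g x)"
      using powr_add[of "cmod (g x)" "q - 1" 1] by simp
    also have "\<dots> \<le> (c * t) powr (q - 1) * cmod (g x)"
      using le q by (intro mult_right_mono powr_mono2) auto
    finally show ?thesis .
  qed (use q in simp)
  have "(LINT x|lebesgue. cmod (g x) powr q) \<le> (LINT x|lebesgue. (c * t) powr (q - 1) * cmod (g x))"
    using bcs_integrable_powr[OF g, of q] bcs_integrable[OF g] q pt by (intro integral_mono) auto
  also have "\<dots> = (c * t) powr (q - 1) * (LINT x|lebesgue. cmod (g x))" by simp
  finally have "B * (LINT x|lebesgue. cmod (g x) powr q) / t powr q \<le> B * ((c * t) powr (q - 1) * (LINT x|lebesgue. cmod (g x))) / t powr q"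
    using B by (intro divide_right_mono mult_left_mono) auto
  also have tq: "t powr q = t powr (q - 1) * t" using \<open>0 < t\<close> powr_add[of t "q - 1" 1] by simp
  also have "B * ((c * t) powr (q - 1) * (LINT x|lebesgue. cmod (g x))) / (t powr (q - 1) * t) = B * c powr (q - 1) * (LINT x|lebesgue. cmod (g x)) / t"
    using \<open>0 < c\<close> \<open>0 < t\<close> by (simp add: powr_mult)
  finally show ?thesis using strong_type[OF g \<open>0 < t\<close>] unfolding tq by (meson ennreal_leI order_trans)
qed

text \<open>The three pieces of the decomposition are each estimated at height \<open>t\<close>,
  which bounds the set at height \<open>3 * t\<close>. The remainder on \<open>V\<close> is handled
  by the strong type bound and the supremum of \<open>f\<close>. That supremum must not enter the
  constant, so \<delta> is chosen after \<open>f\<close>, and the error \<open>e\<close> is removed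
  by being arbitrary.\<close>

lemma weak_type:
  obtains W where "0 < W" "\<And>f t. f \<in> bcs \<Longrightarrow> 0 < t \<Longrightarrow>
    emeasure lebesgue {x. t < cmod (T f x)} \<le> ennreal (W * (LINT x|lebesgue. cmod (f x)) / t)"
proof -
  define P where "P = 6 ^ CARD('n) * suminf \<rho>"
  have P0: "0 \<le> P" using suminf_nonneg[OF \<rho>_summable \<rho>_nonneg] by (simp add: P_def)
  \<comment> \<open>The summands come from the good part, the triples of the stopping cubes, and the
    bad part; the factors 2 come from the norms of \<open>g\<close> and \<open>b\<close>.\<close>
  define W1 where "W1 = 2 * (B * (2 ^ CARD('n)) powr (q - 1)) + 4 * 3 ^ CARD('n) + 2 * P"
  have W10: "0 \<le> W1" using B P0 by (simp add: W1_def)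
  have main: "emeasure lebesgue {x. 3 * t < cmod (T f x)} \<le> ennreal (W1 * (LINT x|lebesgue. cmod (f x)) / t)"
    if f: "f \<in> bcs" and t: "0 < t" for f t
  proof (rule ennreal_le_epsilon)
    fix e :: real assume "0 < e"
    define L where "L = (LINT x|lebesgue. cmod (f x))"
    have L0: "0 \<le> L" by (simp add: L_def)
    obtain M where M: "M > 0" "\<And>x. cmod (f x) \<le> M" using f by (auto simp: bcs_iff)
    define H where "H = B * M powr q / t powr q"
    have H0: "0 \<le> H" using B by (simp add: H_def)
    \<comment> \<open>The two errors proportional to \<delta> are
      \<open>2 * 3 ^ CARD('n) * \<delta>\<close> from the triples and \<open>H * \<delta>\<close>
      from \<open>V\<close>; this choice makes their sum at most \<open>e\<close>.\<close>
    define \<delta> where "\<delta> = e / (2 * 3 ^ CARD('n) + H + 1)"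
    have \<delta>: "0 < \<delta>" using \<open>0 < e\<close> H0 unfolding \<delta>_def by (intro divide_pos_pos) (auto intro: add_nonneg_pos)
    have \<delta>e: "2 * 3 ^ CARD('n) * \<delta> + H * \<delta> \<le> e"
    proof -
      have "(2 * 3 ^ CARD('n) + H + 1) * \<delta> = e" using H0 by (simp add: \<delta>_def add_nonneg_eq_0_iff)
      then show ?thesis using \<delta> by (simp add: algebra_simps)
    qed
    obtain J g b V where D: "finite J" "disjoint_family_on (icube (\<lambda>_. False)) J"
      "g \<in> bcs" "b \<in> bcs" "V \<in> sets lebesgue"
      and fx: "\<And>x. f x = g x + b x + cut V f x"
      and gle: "\<And>x. cmod (g x) \<le> 2 ^ CARD('n) * t"
      and gL: "(LINT x|lebesgue. cmod (g x)) \<le> 2 * L"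
      and bL: "(LINT x|lebesgue. cmod (b x)) \<le> 2 * L"
      and b0: "\<And>x. x \<notin> (\<Union>p\<in>J. icube (\<lambda>_. False) p) \<Longrightarrow> b x = 0"
      and bm: "\<And>p. p \<in> J \<Longrightarrow> (LINT x|lebesgue. cut (icube (\<lambda>_. False) p) b x) = 0"
      and JL: "emeasure lebesgue (\<Union>p\<in>J. itriple (\<lambda>_. False) p) \<le> ennreal (3 ^ CARD('n) * (4 * L / t + 2 * \<delta>))"
      and V\<delta>: "emeasure lebesgue V \<le> ennreal \<delta>"
      unfolding L_def by (rule CZ_decomposition[OF f t \<delta>, of "\<lambda>_. False"]) blast
    define X where "X = (\<Union>p\<in>J. itriple (\<lambda>_. False) p :: (real^'n) set)"
    have Xs: "X \<in> sets lebesgue" unfolding X_def using D(1) by auto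
    have cV: "cut V f \<in> bcs" by (rule bcs_cut[OF f D(5)])
    have gb: "(\<lambda>x. g x + b x) \<in> bcs" using bcs_lincomb[OF D(3,4), of 1 1] by simp
    define S1 S2 S3 where "S1 = {x. t < cmod (T g x)}" and "S2 = {x. x \<notin> X \<and> t < cmod (T b x)}"
      and "S3 = {x. t < cmod (T (cut V f) x)}"
    have Ss: "S1 \<in> sets lebesgue" "S2 \<in> sets lebesgue" "S3 \<in> sets lebesgue"
    proof -
      have "S2 = {x. t < cmod (T b x)} - X" by (auto simp: S2_def)
      then show "S2 \<in> sets lebesgue" using T_superlevel_sets[OF D(4)] Xs by auto
    qed (auto simp: S1_def S3_def intro: T_superlevel_sets D cV)
    have "emeasure lebesgue {x. 3 * t < cmod (T f x)} \<le> emeasure lebesgue (S1 \<union> (X \<union> (S2 \<union> S3)))"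
    proof (rule emeasure_mono_AE)
      have eq: "(\<lambda>x. g x + b x + cut V f x) = f" using fx by auto
      show "AE x in lebesgue. x \<in> {x. 3 * t < cmod (T f x)} \<longrightarrow> x \<in> S1 \<union> (X \<union> (S2 \<union> S3))"
        using T_add[OF gb cV, unfolded eq] T_add[OF D(3,4)]
      proof eventually_elim
        case (elim x)
        have "cmod (T f x) \<le> cmod (T g x) + cmod (T b x) + cmod (T (cut V f) x)"
          unfolding elim by (metis (no_types) norm_triangle_ineq add_right_mono order_trans)
        then show ?case by (auto simp: S1_def S2_def S3_def)
      qed
    qed (use Ss Xs in auto)
    also have "\<dots> \<le> emeasure lebesgue S1 + (emeasure lebesgue X + (emeasure lebesgue S2 + emeasure lebesgue S3))"
      using Ss Xs by (intro order_trans[OF emeasure_subadditive] add_mono order_refl) auto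
    also have "\<dots> \<le> ennreal (B * (2 ^ CARD('n)) powr (q - 1) * (2 * L) / t) + (ennreal (3 ^ CARD('n) * (4 * L / t + 2 * \<delta>)) +
        (ennreal (P * (2 * L) / t) + ennreal (H * \<delta>)))"
    proof (intro add_mono)
      have "emeasure lebesgue S1 \<le> ennreal (B * (2 ^ CARD('n)) powr (q - 1) * (LINT x|lebesgue. cmod (g x)) / t)"
        unfolding S1_def by (rule good_part[OF D(3) gle]) (use t in auto)
      also have "\<dots> \<le> ennreal (B * (2 ^ CARD('n)) powr (q - 1) * (2 * L) / t)"
        using t B gL by (intro ennreal_leI divide_right_mono mult_left_mono) auto
      finally show "emeasure lebesgue S1 \<le> ennreal (B * (2 ^ CARD('n)) powr (q - 1) * (2 * L) / t)" .
      show "emeasure lebesgue X \<le> ennreal (3 ^ CARD('n) * (4 * L / t + 2 * \<delta>))" using JL by (simp only: X_def)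
      have "emeasure lebesgue S2 \<le> ennreal (P * (LINT x|lebesgue. cmod (b x)) / t)"
        unfolding S2_def X_def P_def by (rule bad_part[OF D(4,1,2) b0 bm t])
      also have "\<dots> \<le> ennreal (P * (2 * L) / t)"
        using t P0 bL by (intro ennreal_leI divide_right_mono mult_left_mono) auto
      finally show "emeasure lebesgue S2 \<le> ennreal (P * (2 * L) / t)" .
      show "emeasure lebesgue S3 \<le> ennreal (H * \<delta>)"
      proof -
        have Vf: "V \<in> lmeasurable" using D(5) V\<delta> by (auto intro!: fmeasurableI intro: le_less_trans)
        have "(LINT x|lebesgue. cmod (cut V f x) powr q) \<le> (LINT x|lebesgue. M powr q * indicator V x)"
        proof (rule integral_mono)
          show "integrable lebesgue (\<lambda>x. cmod (cut V f x) powr q)" using bcs_integrable_powr[OF cV] q by auto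
          show "integrable lebesgue (\<lambda>x. M powr q * indicator V x)"
            using Vf by (intro integrable_mult_right integrable_real_indicator) (auto simp: fmeasurable_def)
          show "cmod (cut V f x) powr q \<le> M powr q * indicator V x" for x
            using M q by (auto simp: indicator_def intro: powr_mono2)
        qed
        also have "\<dots> = M powr q * measure lebesgue V" by simp
        also have "\<dots> \<le> M powr q * \<delta>"
          using V\<delta> \<delta> by (intro mult_left_mono) (auto simp: measure_def intro!: enn2real_leI)
        finally have "B * (LINT x|lebesgue. cmod (cut V f x) powr q) / t powr q \<le> B * (M powr q * \<delta>) / t powr q"
          using B by (intro divide_right_mono mult_left_mono) auto
        also have "\<dots> = H * \<delta>" by (simp add: H_def)
        finally show ?thesis unfolding S3_def using strong_type[OF cV t] by (meson ennreal_leI order_trans)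
      qed
    qed
    also have "\<dots> = ennreal (B * (2 ^ CARD('n)) powr (q - 1) * (2 * L) / t + (3 ^ CARD('n) * (4 * L / t + 2 * \<delta>) + (P * (2 * L) / t + H * \<delta>)))"
      using B L0 t \<delta> P0 H0 by simp
    also have "\<dots> \<le> ennreal (W1 * L / t + e)"
    proof (rule ennreal_leI)
      have "B * (2 ^ CARD('n)) powr (q - 1) * (2 * L) / t + (3 ^ CARD('n) * (4 * L / t + 2 * \<delta>) + (P * (2 * L) / t + H * \<delta>))
        = W1 * L / t + (2 * 3 ^ CARD('n) * \<delta> + H * \<delta>)" by (simp add: W1_def algebra_simps add_divide_distrib)
      then show "B * (2 ^ CARD('n)) powr (q - 1) * (2 * L) / t + (3 ^ CARD('n) * (4 * L / t + 2 * \<delta>) + (P * (2 * L) / t + H * \<delta>)) \<le> W1 * L / t + e"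
        using \<delta>e by linarith
    qed
    also have "\<dots> = ennreal (W1 * L / t) + ennreal e" using W10 L0 t \<open>0 < e\<close> by simp
    finally show "emeasure lebesgue {x. 3 * t < cmod (T f x)} \<le> ennreal (W1 * (LINT x|lebesgue. cmod (f x)) / t) + ennreal e"
      by (simp add: L_def)
  qed
  show thesis
  proof (rule that[of "3 * W1 + 1"])
    show "0 < 3 * W1 + 1" using W10 by simp
    fix f :: "real^'n \<Rightarrow> complex" and t :: real
    assume f: "f \<in> bcs" and t: "0 < t"
    have "emeasure lebesgue {x. t < cmod (T f x)} \<le> ennreal (W1 * (LINT x|lebesgue. cmod (f x)) / (t / 3))"
      using main[OF f, of "t / 3"] t by simp
    also have "\<dots> \<le> ennreal ((3 * W1 + 1) * (LINT x|lebesgue. cmod (f x)) / t)"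
      using t W10 by (intro ennreal_leI) (simp add: divide_right_mono algebra_simps)
    finally show "emeasure lebesgue {x. t < cmod (T f x)} \<le> ennreal ((3 * W1 + 1) * (LINT x|lebesgue. cmod (f x)) / t)" .
  qed
qed

end

section \<open>Sparse domination\<close>

definition triple_average :: "('n::finite \<Rightarrow> bool) \<Rightarrow> (real^'n \<Rightarrow> complex) \<Rightarrow> int \<times> ('n \<Rightarrow> int) \<Rightarrow> real" where
  "triple_average \<alpha> f p = (LINT x:itriple \<alpha> p|lebesgue. cmod (f x)) / (3 ^ CARD('n) * (2 powi fst p) ^ CARD('n))"

lemma triple_average_nonneg: "0 \<le> triple_average \<alpha> f p"
  by (simp add: triple_average_def set_lebesgue_integral_def)

lemma triple_average_mult:
  fixes p :: "int \<times> ('n::finite \<Rightarrow> int)"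
  shows "triple_average \<alpha> f p * (3 ^ CARD('n) * (2 powi fst p) ^ CARD('n)) = (LINT x:itriple \<alpha> p|lebesgue. cmod (f x))"
  by (simp add: triple_average_def)

lemma L1_norm_cut:
  "(LINT x|lebesgue. cmod (cut S f x)) = (LINT x:S|lebesgue. cmod (f x))"
  unfolding set_lebesgue_integral_def by (intro Bochner_Integration.integral_cong) (auto simp: indicator_def)

lemma itriple_mono:
  assumes "icube \<alpha> r \<subseteq> icube \<alpha> p" "fst r \<le> fst p"
  shows "itriple \<alpha> r \<subseteq> itriple \<alpha> p"
  by (rule triple_cube_subset[OF cube_nonempty _ assms(2)]) (use assms(1) cube_nonempty in blast)

lemma AE_exists_in_set:
  assumes "AE x in M. P x" "S \<in> sets M" "emeasure M S \<noteq> 0"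
  shows "\<exists>x\<in>S. P x"
proof (rule ccontr)
  assume neg: "\<not> (\<exists>x\<in>S. P x)"
  have "AE x in M. x \<notin> S" using assms(1) by eventually_elim (use neg in auto)
  then have "emeasure M S = 0" using AE_iff_null_sets[OF assms(2)] by (auto simp: null_sets_def)
  then show False using assms(3) by simp
qed

text \<open>Triples are not members of a grid, so each selected triple is put into a shifted cube of
  16 times the side, and the dyadic weak type bound is used in all \<open>2 ^ CARD('n)\<close>
  grids. This produces the constant \<open>32 ^ CARD('n)\<close>. If the average over the triple of
  \<open>p\<close> is 0, the threshold is 0, but then no cube is selected.\<close>

lemma emeasure_triple_average_superlevel:
  fixes p :: "int \<times> ('n::finite \<Rightarrow> int)"
  assumes f: "integrable lebesgue f" and A: "0 < A"
  shows "emeasure lebesgue (\<Union>r\<in>{r. fst r < fst p \<and> icube \<alpha> r \<subseteq> icube \<alpha> p \<and> A * triple_average \<alpha> f p < triple_average \<alpha> f r}. icube \<alpha> r)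
    \<le> ennreal (32 ^ CARD('n) / A * (2 powi fst p) ^ CARD('n))"
proof -
  define S where "S = {r. fst r < fst p \<and> icube \<alpha> r \<subseteq> icube \<alpha> p \<and> A * triple_average \<alpha> f p < triple_average \<alpha> f r}"
  define v where "v r = (2 powi fst r :: real) ^ CARD('n)" for r :: "int \<times> ('n \<Rightarrow> int)"
  have v0: "0 < v r" for r by (simp add: v_def)
  define h where "h x = indicator (itriple \<alpha> p) x *\<^sub>R cmod (f x)" for x
  have hi: "integrable lebesgue h" unfolding h_def using f by (intro integrable_mult_indicator) auto
  have h0: "0 \<le> h x" for x by (simp add: h_def)
  have hL: "(LINT x|lebesgue. h x) = triple_average \<alpha> f p * (3 ^ CARD('n) * v p)"
    unfolding v_def triple_average_mult by (simp add: h_def set_lebesgue_integral_def)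
  have sub: "itriple \<alpha> r \<subseteq> itriple \<alpha> p" if "r \<in> S" for r
    using that by (intro itriple_mono) (auto simp: S_def)
  have S_int: "(LINT x:itriple \<alpha> r|lebesgue. cmod (f x)) = (LINT x:itriple \<alpha> r|lebesgue. h x)" if "r \<in> S" for r
    unfolding set_lebesgue_integral_def h_def
    using sub[OF that] by (intro Bochner_Integration.integral_cong) (auto simp: indicator_def)
  show ?thesis unfolding S_def[symmetric] v_def[symmetric]
  proof (cases "triple_average \<alpha> f p = 0")
    case True
    have "S = {}"
    proof (rule equals0I)
      fix r assume r: "r \<in> S"
      have "(LINT x:itriple \<alpha> r|lebesgue. cmod (f x)) \<le> (LINT x:itriple \<alpha> p|lebesgue. cmod (f x))"
        using f sub[OF r] by (intro set_LINT_mono_set) auto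
      then have "triple_average \<alpha> f r * (3 ^ CARD('n) * v r) \<le> 0" using True unfolding v_def triple_average_mult by (simp add: triple_average_mult[symmetric])
      moreover have "0 < triple_average \<alpha> f r" using r True by (simp add: S_def)
      moreover have "0 < 3 ^ CARD('n) * v r" using v0[of r] by simp
      ultimately show False using mult_pos_pos by (meson not_le)
    qed
    then show "emeasure lebesgue (\<Union>r\<in>S. icube \<alpha> r) \<le> ennreal (32 ^ CARD('n) / A * v p)" by simp
  next
    case False
    then have tp: "0 < triple_average \<alpha> f p" using triple_average_nonneg[of \<alpha> f p] by simp
    \<comment> \<open>Division by \<open>16 ^ CARD('n)\<close> compensates the larger volume of the
      shifted cube: the integral over a selected triple alone makes that cube pass the test in
      \<open>C\<close>.\<close>
    define c where "c = A * triple_average \<alpha> f p * 3 ^ CARD('n) / 16 ^ CARD('n)"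
    have c: "0 < c" using A tp by (simp add: c_def)
    define C where "C \<beta> = {r. c * v r \<le> (LINT x:icube \<beta> r|lebesgue. h x)}" for \<beta>
    have cov: "(\<Union>r\<in>S. icube \<alpha> r) \<subseteq> (\<Union>\<beta>\<in>UNIV. \<Union>r\<in>C \<beta>. icube \<beta> r)"
    proof (rule UN_least)
      fix r assume r: "r \<in> S"
      obtain \<beta> m' where \<beta>: "itriple \<alpha> r \<subseteq> cube \<beta> (fst r + 4) m'" using triple_cube_in_shifted_cube by blast
      have "c * v (fst r + 4, m') = A * triple_average \<alpha> f p * (3 ^ CARD('n) * v r)"
        by (simp add: c_def v_def power_int_add power_mult_distrib)
      also have "\<dots> \<le> triple_average \<alpha> f r * (3 ^ CARD('n) * v r)"
        using r v0[of r] by (intro mult_right_mono) (auto simp: S_def)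
      also have "\<dots> = (LINT x:itriple \<alpha> r|lebesgue. h x)" unfolding v_def triple_average_mult using S_int[OF r] .
      also have "\<dots> \<le> (LINT x:icube \<beta> (fst r + 4, m')|lebesgue. h x)"
        using hi h0 \<beta> by (intro set_LINT_mono_set) auto
      finally have "(fst r + 4, m') \<in> C \<beta>" by (simp add: C_def)
      moreover have "icube \<alpha> r \<subseteq> icube \<beta> (fst r + 4, m')" using cube_triple_cube[of \<alpha> "fst r" "snd r"] \<beta> by auto
      ultimately show "icube \<alpha> r \<subseteq> (\<Union>\<beta>\<in>UNIV. \<Union>r\<in>C \<beta>. icube \<beta> r)" by blast
    qed
    have one: "emeasure lebesgue (\<Union>r\<in>C \<beta>. icube \<beta> r) \<le> ennreal (16 ^ CARD('n) / A * v p)" for \<beta>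
    proof -
      have "emeasure lebesgue (\<Union>r\<in>C \<beta>. icube \<beta> r) \<le> ennreal ((LINT x|lebesgue. h x) / c)"
        by (rule dyadic_weak_type[OF hi h0 c]) (simp add: C_def v_def)
      also have "(LINT x|lebesgue. h x) / c = 16 ^ CARD('n) / A * v p"
        using tp A unfolding hL c_def by (simp add: field_simps)
      finally show ?thesis .
    qed
    have "emeasure lebesgue (\<Union>r\<in>S. icube \<alpha> r) \<le> emeasure lebesgue (\<Union>\<beta>\<in>UNIV. \<Union>r\<in>C \<beta>. icube \<beta> r)"
      by (rule emeasure_mono[OF cov]) (auto intro!: sets.finite_UN Union_icube_sets)
    also have "\<dots> \<le> (\<Sum>\<beta>\<in>UNIV. emeasure lebesgue (\<Union>r\<in>C \<beta>. icube \<beta> r))"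
      by (rule emeasure_subadditive_finite) (auto intro: Union_icube_sets)
    also have "\<dots> \<le> (\<Sum>\<beta>\<in>(UNIV :: ('n \<Rightarrow> bool) set). ennreal (16 ^ CARD('n) / A * v p))"
      by (intro sum_mono one)
    also have "\<dots> = ennreal (\<Sum>\<beta>\<in>(UNIV :: ('n \<Rightarrow> bool) set). 16 ^ CARD('n) / A * v p)"
      using A v0[of p] by (intro sum_ennreal) auto
    also have "(\<Sum>\<beta>\<in>(UNIV :: ('n \<Rightarrow> bool) set). 16 ^ CARD('n) / A * v p) = 32 ^ CARD('n) / A * v p"
      by (simp add: card_fun power_mult_distrib[symmetric])
    finally show "emeasure lebesgue (\<Union>r\<in>S. icube \<alpha> r) \<le> ennreal (32 ^ CARD('n) / A * v p)" .
  qed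
qed

context cz_data
begin

text \<open>Taken at a height proportional to the average over the triple, the weak type bound
  becomes a fixed fraction of the volume of the cube. If that average is 0 the height is not
  admissible; then the weak type bound at all heights \<open>1 / real (Suc n)\<close> shows that the
  function vanishes almost everywhere.\<close>

lemma local_weak_type:
  fixes p :: "int \<times> ('n \<Rightarrow> int)"
  assumes W: "0 < W" "\<And>f t. f \<in> bcs \<Longrightarrow> 0 < t \<Longrightarrow>
      emeasure lebesgue {x. t < cmod (T f x)} \<le> ennreal (W * (LINT x|lebesgue. cmod (f x)) / t)"
    and f: "f \<in> bcs" and e: "0 < e" and A: "W * 3 ^ CARD('n) / e \<le> A"
  shows "emeasure lebesgue {x. A * triple_average \<alpha> f p < cmod (T (cut (itriple \<alpha> p) f) x)} \<le> ennreal (e * (2 powi fst p) ^ CARD('n))"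
proof -
  have cf: "cut (itriple \<alpha> p) f \<in> bcs" using f by (intro bcs_cut) auto
  define L where "L = (LINT x|lebesgue. cmod (cut (itriple \<alpha> p) f x))"
  have L: "L = triple_average \<alpha> f p * (3 ^ CARD('n) * (2 powi fst p) ^ CARD('n))"
    unfolding triple_average_mult by (simp only: L_def L1_norm_cut)
  have Apos: "0 < A" using A W(1) e by (meson divide_pos_pos less_le_trans mult_pos_pos zero_less_numeral zero_less_power)
  show ?thesis
  proof (cases "triple_average \<alpha> f p = 0")
    case True
    then have L0: "L = 0" by (simp add: L)
    have null: "{x. 1 / real (Suc n) < cmod (T (cut (itriple \<alpha> p) f) x)} \<in> null_sets lebesgue" for n
      using W(2)[OF cf, of "1 / real (Suc n)"] T_superlevel_sets[OF cf] L0 by (simp add: L_def null_sets_def)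
    have "{x. 0 < cmod (T (cut (itriple \<alpha> p) f) x)} \<subseteq> (\<Union>n. {x. 1 / real (Suc n) < cmod (T (cut (itriple \<alpha> p) f) x)})"
    proof
      fix x assume "x \<in> {x. 0 < cmod (T (cut (itriple \<alpha> p) f) x)}"
      then have "0 < cmod (T (cut (itriple \<alpha> p) f) x)" by simp
      then obtain n where "1 / real (Suc n) < cmod (T (cut (itriple \<alpha> p) f) x)" by (rule nat_approx_posE)
      then show "x \<in> (\<Union>n. {x. 1 / real (Suc n) < cmod (T (cut (itriple \<alpha> p) f) x)})" by blast
    qed
    moreover have "(\<Union>n. {x. 1 / real (Suc n) < cmod (T (cut (itriple \<alpha> p) f) x)}) \<in> null_sets lebesgue"
      using null by (intro null_sets_UN) auto
    ultimately have "{x. 0 < cmod (T (cut (itriple \<alpha> p) f) x)} \<in> null_sets lebesgue"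
      by (intro null_sets_subset[OF _ T_superlevel_sets[OF cf]])
    then have "emeasure lebesgue {x. 0 < cmod (T (cut (itriple \<alpha> p) f) x)} = 0" by (rule null_setsD1)
    then show ?thesis using True by simp
  next
    case False
    then have tp: "0 < triple_average \<alpha> f p" using triple_average_nonneg[of \<alpha> f p] by simp
    have "emeasure lebesgue {x. A * triple_average \<alpha> f p < cmod (T (cut (itriple \<alpha> p) f) x)} \<le> ennreal (W * L / (A * triple_average \<alpha> f p))"
      unfolding L_def using Apos tp by (intro W(2) cf) auto
    also have "\<dots> \<le> ennreal (e * (2 powi fst p) ^ CARD('n))"
    proof (rule ennreal_leI)
      have "W * L / (A * triple_average \<alpha> f p) = W * 3 ^ CARD('n) / A * (2 powi fst p) ^ CARD('n)"
        using tp by (simp add: L)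
      also have "W * 3 ^ CARD('n) / A \<le> e" using A Apos e by (simp add: field_simps)
      then have "W * 3 ^ CARD('n) / A * (2 powi fst p) ^ CARD('n) \<le> e * (2 powi fst p) ^ CARD('n)"
        by (intro mult_right_mono) auto
      finally show "W * L / (A * triple_average \<alpha> f p) \<le> e * (2 powi fst p) ^ CARD('n)" .
    qed
    finally show ?thesis .
  qed
qed

text \<open>A point of \<open>S\<close> lies in an annulus between the triples of two consecutive
  ancestors of \<open>r\<close>, where the kernel oscillates by at most \<open>\<rho> j\<close> over
  the volume. Integrating over the outer triple turns this into
  \<open>6 ^ CARD('n) * \<rho> j\<close> times its average. Only ancestors up to the
  \<open>n\<close>-th occur, which are those whose averages are controlled by hypothesis.\<close>

lemma oscillation_bound:
  fixes r :: "int \<times> ('n \<Rightarrow> int)" and n :: nat and \<alpha> :: "'n \<Rightarrow> bool"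
  defines "anc \<equiv> \<lambda>j. (fst r + int j, grid_index \<alpha> (fst r + int j) (corner \<alpha> (fst r) (snd r)))"
  assumes f: "f \<in> bcs"
    and S: "S \<in> sets lebesgue" "S \<subseteq> itriple \<alpha> (anc n) - itriple \<alpha> r"
    and avg: "\<And>j. j < n \<Longrightarrow> triple_average \<alpha> f (anc (Suc j)) \<le> a" and a0: "0 \<le> a"
    and x: "x \<in> icube \<alpha> r" "x' \<in> icube \<alpha> r"
  shows "cmod ((LINT y|lebesgue. K x y * cut S f y) - (LINT y|lebesgue. K x' y * cut S f y)) \<le> 6 ^ CARD('n) * suminf \<rho> * a"
proof -
  define k c where "k = fst r" and "c = corner \<alpha> (fst r) (snd r)"
  have c: "c \<in> icube \<alpha> r" by (simp add: c_def cube_nonempty)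
  have cg: "grid_index \<alpha> k c = snd r" using c by (simp add: mem_cube k_def)
  have anc: "itriple \<alpha> (anc j) = triple_cube \<alpha> (k + int j) (grid_index \<alpha> (k + int j) c)" for j
    by (simp add: anc_def k_def c_def)
  have anc0: "itriple \<alpha> (anc 0) = itriple \<alpha> r" unfolding anc using cg by (simp add: k_def)
  have xc: "grid_index \<alpha> (k + int j) x = grid_index \<alpha> (k + int j) c" for j
    using grid_index_mono[of \<alpha> k x c "k + int j"] x c by (simp add: mem_cube k_def)
  have cS: "cut S f \<in> bcs" by (rule bcs_cut[OF f S(1)])
  have ns: "z \<notin> supp (cut S f)" if "z \<in> icube \<alpha> r" for z
    unfolding supp_def using S(2) by (intro not_in_closure_outside_triple_cube[OF that]) (auto simp: indicator_def)
  have int: "integrable lebesgue (\<lambda>y. K z y * cut S f y)" if "z \<in> icube \<alpha> r" for z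
    by (rule kernel_integrable[OF cS ns[OF that]])
  have fi: "integrable lebesgue (\<lambda>y. indicator (itriple \<alpha> (anc (Suc j))) y *\<^sub>R cmod (f y))" for j
    using bcs_integrable[OF f] by (intro integrable_mult_indicator) auto
  define w where "w j = \<rho> j / (2 powi (k + int j)) ^ CARD('n)" for j
  have w0: "0 \<le> w j" for j using \<rho>_nonneg[of j] by (simp add: w_def)
  have pt: "cmod (K x y * cut S f y - K x' y * cut S f y) \<le> (\<Sum>j<n. w j * (indicator (itriple \<alpha> (anc (Suc j))) y *\<^sub>R cmod (f y)))" for y
  proof (cases "y \<in> S")
    case False
    then show ?thesis using w0 by (auto intro!: sum_nonneg)
  next
    case True
    define i where "i = (LEAST j. y \<in> itriple \<alpha> (anc j))"
    have yn: "y \<in> itriple \<alpha> (anc n)" "y \<notin> itriple \<alpha> (anc 0)" using True S(2) anc0 by auto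
    have yi: "y \<in> itriple \<alpha> (anc i)" unfolding i_def using yn(1) by (rule LeastI)
    have "i \<le> n" unfolding i_def using yn(1) by (rule Least_le)
    moreover have "i \<noteq> 0" using yi yn(2) by (intro notI) auto
    ultimately obtain j where j: "i = Suc j" "j < n" by (cases i) auto
    have "y \<notin> itriple \<alpha> (anc j)" using not_less_Least[of j "\<lambda>j. y \<in> itriple \<alpha> (anc j)"] j(1) unfolding i_def[symmetric] by simp
    then have "cmod (K x y - K x' y) \<le> w j"
      using kernel_fst[of x \<alpha> k "snd r" x' y j] x xc unfolding anc w_def by (simp add: k_def)
    then have "cmod (K x y - K x' y) * cmod (f y) \<le> w j * (indicator (itriple \<alpha> (anc (Suc j))) y *\<^sub>R cmod (f y))"
      using yi j(1) by (simp add: mult_right_mono)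
    also have "\<dots> \<le> (\<Sum>j<n. w j * (indicator (itriple \<alpha> (anc (Suc j))) y *\<^sub>R cmod (f y)))"
      using j(2) w0 by (intro member_le_sum) auto
    finally show ?thesis using True by (simp add: left_diff_distrib[symmetric] norm_mult)
  qed
  have "cmod ((LINT y|lebesgue. K x y * cut S f y) - (LINT y|lebesgue. K x' y * cut S f y))
     = cmod (LINT y|lebesgue. K x y * cut S f y - K x' y * cut S f y)"
    using int x by (subst Bochner_Integration.integral_diff) auto
  also have "\<dots> \<le> (LINT y|lebesgue. cmod (K x y * cut S f y - K x' y * cut S f y))" by (rule integral_norm_bound)
  also have "\<dots> \<le> (LINT y|lebesgue. (\<Sum>j<n. w j * (indicator (itriple \<alpha> (anc (Suc j))) y *\<^sub>R cmod (f y))))"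
    using int x pt fi
    by (intro integral_mono Bochner_Integration.integrable_sum integrable_mult_right integrable_norm Bochner_Integration.integrable_diff) auto
  also have "\<dots> = (\<Sum>j<n. w j * (LINT y:itriple \<alpha> (anc (Suc j))|lebesgue. cmod (f y)))"
    unfolding set_lebesgue_integral_def using fi
    by (subst Bochner_Integration.integral_sum)
      (auto intro!: integrable_mult_right simp only: integral_mult_right_zero)
  also have "\<dots> \<le> (\<Sum>j<n. 6 ^ CARD('n) * a * \<rho> j)"
  proof (rule sum_mono)
    fix j assume j: "j \<in> {..<n}"
    define s :: real where "s = 2 powi (k + int j)"
    have s: "0 < s" by (simp add: s_def)
    have "fst (anc (Suc j)) = k + int (Suc j)" by (simp add: anc_def k_def)
    then have s2: "2 powi fst (anc (Suc j)) = 2 * s" by (simp add: s_def power_int_add)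
    have "w j * (LINT y:itriple \<alpha> (anc (Suc j))|lebesgue. cmod (f y))
      = \<rho> j / s ^ CARD('n) * (triple_average \<alpha> f (anc (Suc j)) * (3 ^ CARD('n) * (2 * s) ^ CARD('n)))"
      unfolding triple_average_mult[symmetric] s2 by (simp add: w_def s_def)
    also have "\<dots> = 6 ^ CARD('n) * triple_average \<alpha> f (anc (Suc j)) * \<rho> j"
      using s by (simp add: power_mult_distrib) (simp add: power_mult_distrib[symmetric])
    also have "\<dots> \<le> 6 ^ CARD('n) * a * \<rho> j"
      using avg j \<rho>_nonneg by (intro mult_right_mono mult_left_mono) auto
    finally show "w j * (LINT y:itriple \<alpha> (anc (Suc j))|lebesgue. cmod (f y)) \<le> 6 ^ CARD('n) * a * \<rho> j" .
  qed
  also have "\<dots> = 6 ^ CARD('n) * a * (\<Sum>j<n. \<rho> j)" by (simp add: sum_distrib_left)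
  also have "\<dots> \<le> 6 ^ CARD('n) * a * suminf \<rho>"
    using a0 \<rho>_summable \<rho>_nonneg by (intro mult_left_mono sum_le_suminf) auto
  finally show ?thesis by (simp add: mult_ac)
qed

end

lemma set_LINT_indicator:
  assumes "A \<in> sets M" "U \<in> sets M"
  shows "(LINT x:A|M. indicator U x :: real) = measure M (A \<inter> U)"
proof -
  have "(LINT x:A|M. indicator U x :: real) = (LINT x|M. indicator (A \<inter> U) x)"
    unfolding set_lebesgue_integral_def by (intro Bochner_Integration.integral_cong) (auto simp: indicator_def)
  also have "\<dots> = measure M (A \<inter> U \<inter> space M)" by simp
  also have "A \<inter> U \<inter> space M = A \<inter> U" using sets.sets_into_space[OF assms(1)] by auto
  finally show ?thesis .
qed

text \<open>
  A cube stops when its triple average is large or when it meets the exceptional set of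
  \<open>T (f 1\<^bsub>3Q\<^esub>)\<close> too much. On a stopping cube \<open>P\<close>, some point is neither exceptional for \<open>Q\<close> nor for
  \<open>P\<close>, which bounds \<open>T (f 1\<^bsub>3Q - 3P\<^esub>)\<close> there, and its oscillation over \<open>P\<close> is controlled by the
  averages over the ancestors of \<open>P\<close>, which did not stop.
\<close>

definition (in cz_data) stopping_family ::
  "real \<Rightarrow> ('n \<Rightarrow> bool) \<Rightarrow> (real^'n \<Rightarrow> complex) \<Rightarrow> int \<times> ('n \<Rightarrow> int) \<Rightarrow> (int \<times> ('n \<Rightarrow> int)) set \<Rightarrow> bool" where
  "stopping_family A \<alpha> f p Ch \<longleftrightarrow>
     disjoint_family_on (icube \<alpha>) Ch \<and> (\<forall>r\<in>Ch. icube \<alpha> r \<subseteq> icube \<alpha> p) \<and>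
     emeasure lebesgue (\<Union>r\<in>Ch. icube \<alpha> r) \<le> ennreal ((2 powi fst p) ^ CARD('n) / 2) \<and>
     (AE x in lebesgue. x \<in> icube \<alpha> p - (\<Union>r\<in>Ch. icube \<alpha> r) \<longrightarrow>
        cmod (T (cut (itriple \<alpha> p) f) x) \<le> A * triple_average \<alpha> f p) \<and>
     (\<forall>r\<in>Ch. AE x in lebesgue. x \<in> icube \<alpha> r \<longrightarrow>
        cmod (T (cut (itriple \<alpha> p) f) x) \<le> A * triple_average \<alpha> f p + A * triple_average \<alpha> f r + cmod (T (cut (itriple \<alpha> r) f) x))"

lemma (in cz_data) ex_stopping_family:
  obtains A where "0 < A"
    "\<And>f \<alpha> p. f \<in> bcs \<Longrightarrow> \<exists>Ch. stopping_family A \<alpha> f p Ch"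
proof -
  obtain W where W: "0 < W" "\<And>f t. f \<in> bcs \<Longrightarrow> 0 < t \<Longrightarrow>
      emeasure lebesgue {x. t < cmod (T f x)} \<le> ennreal (W * (LINT x|lebesgue. cmod (f x)) / t)"
    using weak_type by blast
  \<comment> \<open>The two stopping reasons may each fill a quarter of the cube. Large averages do
    so because \<open>A\<close> is at least \<open>4 * 32 ^ CARD('n)\<close>; density in
    \<open>U\<close> does so because \<open>2 * e / a = 1 / 4\<close> with the number
    \<open>a\<close> chosen below.\<close>
  define e :: real where "e = 1 / 2 ^ (CARD('n) + 4)"
  have e0: "0 < e" by (simp add: e_def)
  define A where "A = max 1 (max (W * 3 ^ CARD('n) / e) (4 * 32 ^ CARD('n)))"
  have A: "1 \<le> A" "W * 3 ^ CARD('n) / e \<le> A" "4 * 32 ^ CARD('n) \<le> A" by (auto simp: A_def)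
  define A' where "A' = 6 ^ CARD('n) * suminf \<rho> * A + A"
  have sr: "0 \<le> suminf \<rho>" by (rule suminf_nonneg[OF \<rho>_summable \<rho>_nonneg])
  have A': "A \<le> A'" "0 < A'" using A sr by (auto simp: A'_def intro: add_nonneg_pos)
  show thesis
  proof (rule that[of A'])
    show "0 < A'" by fact
    fix f :: "real^'n \<Rightarrow> complex" and \<alpha> :: "'n \<Rightarrow> bool" and p :: "int \<times> ('n \<Rightarrow> int)"
    assume f: "f \<in> bcs"
    have fi: "integrable lebesgue f" using f by (rule bcs_integrable)
    have cf: "cut (itriple \<alpha> r) f \<in> bcs" for r using f by (intro bcs_cut) auto
    define v where "v r = (2 powi fst r :: real) ^ CARD('n)" for r :: "int \<times> ('n \<Rightarrow> int)"
    have v0: "0 < v r" for r by (simp add: v_def)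
    have mv: "measure lebesgue (icube \<alpha> r) = v r" "emeasure lebesgue (icube \<alpha> r) = ennreal (v r)" for r
      by (simp_all add: v_def)
    define E where "E r = {x. A * triple_average \<alpha> f r < cmod (T (cut (itriple \<alpha> r) f) x)}" for r
    have Es: "E r \<in> sets lebesgue" for r unfolding E_def by (intro T_superlevel_sets cf)
    have Em: "emeasure lebesgue (E r) \<le> ennreal (e * v r)" for r
      unfolding E_def v_def by (rule local_weak_type[OF W f e0 A(2)])
    have ev: "0 < e * v p" using e0 v0[of p] by simp
    obtain U where U: "open U" "E p \<subseteq> U" "U - E p \<in> lmeasurable" "emeasure lebesgue (U - E p) < ennreal (e * v p)"
      using sets_lebesgue_outer_open[OF Es ev] by blast
    have Us [measurable]: "U \<in> sets lebesgue" using U(1) by auto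
    have Um: "emeasure lebesgue U \<le> ennreal (2 * e * v p)"
    proof -
      have "emeasure lebesgue U = emeasure lebesgue (E p \<union> (U - E p))" using U(2) by (intro arg_cong2[where f = emeasure]) auto
      also have "\<dots> \<le> emeasure lebesgue (E p) + emeasure lebesgue (U - E p)" using Es U by (intro emeasure_subadditive) auto
      also have "\<dots> \<le> ennreal (e * v p) + ennreal (e * v p)" using Em U(4) by (intro add_mono) auto
      also have "\<dots> = ennreal (2 * e * v p)" using ev by (simp add: ennreal_plus[symmetric] mult.assoc del: ennreal_plus)
      finally show ?thesis .
    qed
    have Ufin: "emeasure lebesgue U < \<infinity>" using Um by (rule le_less_trans) simp
    then have Ul: "U \<in> lmeasurable" by (intro fmeasurableI Us)
    have mU: "measure lebesgue U \<le> 2 * e * v p"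
      using Um ev unfolding measure_def by (intro enn2real_leI) auto
    define h where "h x = (indicator U x :: real)" for x
    have hi: "integrable lebesgue h" unfolding h_def using Ufin by (intro integrable_real_indicator) auto
    have hS: "(LINT x:icube \<alpha> r|lebesgue. h x) = measure lebesgue (icube \<alpha> r \<inter> U)" for r
      unfolding h_def by (intro set_LINT_indicator) auto
    \<comment> \<open>A parent that does not stop meets \<open>U\<close> in at most \<open>a\<close>
      of its volume, which is exactly half the volume of its child. This leaves room for a good
      point in the child.\<close>
    define a :: real where "a = 1 / 2 ^ (CARD('n) + 1)"
    have a0: "0 < a" by (simp add: a_def)
    define sub where "sub r \<longleftrightarrow> fst r < fst p \<and> icube \<alpha> r \<subseteq> icube \<alpha> p" for r
    \<comment> \<open>Restricting to proper subcubes bounds the scales from above, so every stopping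
      cube lies in a maximal one.\<close>
    define St where "St = {r. sub r \<and> (A * triple_average \<alpha> f p < triple_average \<alpha> f r \<or> a * v r < measure lebesgue (icube \<alpha> r \<inter> U))}"
    define Ch where "Ch = maximal_cubes \<alpha> St"
    have UCh: "(\<Union>r\<in>Ch. icube \<alpha> r) = (\<Union>r\<in>St. icube \<alpha> r)"
      unfolding Ch_def by (rule Union_maximal_cubes[of _ "fst p"]) (auto simp: St_def sub_def)
    have ChSt: "r \<in> St" if "r \<in> Ch" for r using that maximal_cubes_subset by (auto simp: Ch_def)
    have meas: "emeasure lebesgue (\<Union>r\<in>Ch. icube \<alpha> r) \<le> ennreal (v p / 2)"
    proof -
      define S1 where "S1 = {r. fst r < fst p \<and> icube \<alpha> r \<subseteq> icube \<alpha> p \<and> A * triple_average \<alpha> f p < triple_average \<alpha> f r}"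
      define S2 where "S2 = {r. a * v r \<le> (LINT x:icube \<alpha> r|lebesgue. h x)}"
      have "St \<subseteq> S1 \<union> S2" by (auto simp: St_def S1_def S2_def sub_def hS)
      then have "emeasure lebesgue (\<Union>r\<in>Ch. icube \<alpha> r) \<le> emeasure lebesgue ((\<Union>r\<in>S1. icube \<alpha> r) \<union> (\<Union>r\<in>S2. icube \<alpha> r))"
        unfolding UCh by (intro emeasure_mono) (auto intro!: sets.Un Union_icube_sets)
      also have "\<dots> \<le> emeasure lebesgue (\<Union>r\<in>S1. icube \<alpha> r) + emeasure lebesgue (\<Union>r\<in>S2. icube \<alpha> r)"
        by (intro emeasure_subadditive Union_icube_sets)
      also have "\<dots> \<le> ennreal (v p / 4) + ennreal (v p / 4)"
      proof (intro add_mono)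
        have "emeasure lebesgue (\<Union>r\<in>S1. icube \<alpha> r) \<le> ennreal (32 ^ CARD('n) / A * v p)"
          unfolding S1_def v_def using A(1) by (intro emeasure_triple_average_superlevel fi) auto
        also have "\<dots> \<le> ennreal (1 / 4 * v p)"
          using A v0[of p] by (intro ennreal_leI mult_right_mono) (auto simp: field_simps)
        finally show "emeasure lebesgue (\<Union>r\<in>S1. icube \<alpha> r) \<le> ennreal (v p / 4)" by simp
        have "emeasure lebesgue (\<Union>r\<in>S2. icube \<alpha> r) \<le> ennreal ((LINT x|lebesgue. h x) / a)"
          by (rule dyadic_weak_type[OF hi _ a0]) (auto simp: S2_def v_def h_def)
        also have "(LINT x|lebesgue. h x) = measure lebesgue U" by (simp add: h_def)
        also have "ennreal (measure lebesgue U / a) \<le> ennreal (2 * e * v p / a)"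
          using mU a0 by (intro ennreal_leI divide_right_mono) auto
        also have "2 * e * v p / a = v p / 4" by (simp add: e_def a_def power_add)
        finally show "emeasure lebesgue (\<Union>r\<in>S2. icube \<alpha> r) \<le> ennreal (v p / 4)" .
      qed
      also have "\<dots> = ennreal (v p / 2)" using v0[of p] by (simp add: ennreal_plus[symmetric] del: ennreal_plus)
      finally show ?thesis .
    qed
    have outside: "x \<notin> U" if x: "x \<in> icube \<alpha> p - (\<Union>r\<in>Ch. icube \<alpha> r)" for x
    proof
      assume "x \<in> U"
      then obtain k where k: "k \<le> fst p - 1" "cube \<alpha> k (grid_index \<alpha> k x) \<subseteq> U" using open_contains_cube[OF U(1)] by blast
      define r where "r = (k, grid_index \<alpha> k x)"
      have xr: "x \<in> icube \<alpha> r" by (simp add: r_def mem_cube)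
      have "icube \<alpha> r \<subseteq> icube \<alpha> p" using x xr k(1) by (intro cube_subset[of x]) (auto simp: r_def)
      moreover have "a * v r < measure lebesgue (icube \<alpha> r \<inter> U)"
      proof -
        have "icube \<alpha> r \<inter> U = icube \<alpha> r" using k(2) by (auto simp: r_def)
        moreover have "1 < (2::real) ^ (CARD('n) + 1)" by (rule one_less_power) auto
        then have "a * v r < 1 * v r" using v0[of r] by (intro mult_strict_right_mono) (auto simp: a_def)
        ultimately show ?thesis using mv(1)[of r] by (simp del: measure_cube)
      qed
      ultimately have "r \<in> St" using k(1) by (auto simp: St_def sub_def r_def)
      then show False using x xr UCh by blast
    qed
    have c3: "cmod (T (cut (itriple \<alpha> p) f) x) \<le> A' * triple_average \<alpha> f p" if "x \<in> icube \<alpha> p - (\<Union>r\<in>Ch. icube \<alpha> r)" for x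
    proof -
      have "x \<notin> E p" using outside[OF that] U(2) by auto
      then have "cmod (T (cut (itriple \<alpha> p) f) x) \<le> A * triple_average \<alpha> f p" by (auto simp: E_def)
      also have "\<dots> \<le> A' * triple_average \<alpha> f p" using A' triple_average_nonneg by (intro mult_right_mono)
      finally show ?thesis .
    qed
    have c4: "AE x in lebesgue. x \<in> icube \<alpha> r \<longrightarrow>
         cmod (T (cut (itriple \<alpha> p) f) x) \<le> A' * triple_average \<alpha> f p + A' * triple_average \<alpha> f r + cmod (T (cut (itriple \<alpha> r) f) x)"
      if r: "r \<in> Ch" for r
    proof -
      have rp: "fst r < fst p" "icube \<alpha> r \<subseteq> icube \<alpha> p" using ChSt[OF r] by (auto simp: St_def sub_def)
      define n where "n = nat (fst p - fst r)"
      define c where "c = corner \<alpha> (fst r) (snd r)"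
      have c: "c \<in> icube \<alpha> r" by (simp add: c_def cube_nonempty)
      define anc where "anc = (\<lambda>j. (fst r + int j, grid_index \<alpha> (fst r + int j) c))"
      have n: "fst r + int n = fst p" "0 < n" using rp by (auto simp: n_def)
      have ancn: "anc n = p" using c rp(2) n(1) by (auto simp: anc_def mem_cube prod_eq_iff)
      have canc: "c \<in> icube \<alpha> (anc j)" for j by (simp add: anc_def mem_cube)
      \<comment> \<open>Intermediate ancestors pass both tests by maximality of \<open>r\<close>.
        The cube \<open>p\<close> was never tested, but it passes as well, because \<open>A\<close>
        is at least 1 and \<open>U\<close> fills at most a quarter of the permitted
        fraction.\<close>
      have ok: "triple_average \<alpha> f (anc (Suc j)) \<le> A * triple_average \<alpha> f p \<and> measure lebesgue (icube \<alpha> (anc (Suc j)) \<inter> U) \<le> a * v (anc (Suc j))"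
        if j: "j < n" for j
      proof (cases "Suc j = n")
        case True
        have "triple_average \<alpha> f p \<le> A * triple_average \<alpha> f p" using A(1) triple_average_nonneg[of \<alpha> f p] by (simp add: mult_le_cancel_right1)
        moreover have "measure lebesgue (icube \<alpha> p \<inter> U) \<le> measure lebesgue U"
          using Ul by (intro measure_mono_fmeasurable) auto
        moreover have "2 * e * v p \<le> a * v p"
        proof -
          have "2 * e = a / 4" by (simp add: e_def a_def power_add)
          then show ?thesis using v0[of p] a0 by (intro mult_right_mono) auto
        qed
        ultimately show ?thesis using mU True ancn by simp
      next
        case False
        have lt: "fst r < fst (anc (Suc j))" "fst (anc (Suc j)) < fst p" using j False n by (auto simp: anc_def)
        have "icube \<alpha> r \<subseteq> icube \<alpha> (anc (Suc j))" using lt by (intro cube_subset[OF c canc]) auto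
        then have "anc (Suc j) \<notin> St" using r lt(1) unfolding Ch_def maximal_cubes_def by blast
        moreover have "icube \<alpha> (anc (Suc j)) \<subseteq> icube \<alpha> p"
          using lt c rp(2) by (intro cube_subset[OF canc]) auto
        ultimately show ?thesis using lt(2) by (auto simp: St_def sub_def not_less)
      qed
      define S where "S = itriple \<alpha> p - itriple \<alpha> r"
      have Ss: "S \<in> sets lebesgue" by (simp add: S_def)
      have cS: "cut S f \<in> bcs" by (rule bcs_cut[OF f Ss])
      have osc: "cmod ((LINT y|lebesgue. K x y * cut S f y) - (LINT y|lebesgue. K x' y * cut S f y)) \<le> 6 ^ CARD('n) * suminf \<rho> * (A * triple_average \<alpha> f p)"
        if "x \<in> icube \<alpha> r" "x' \<in> icube \<alpha> r" for x x'
      proof (rule oscillation_bound[OF f Ss _ _ _ that, of n])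
        show "S \<subseteq> itriple \<alpha> (fst r + int n, grid_index \<alpha> (fst r + int n) (corner \<alpha> (fst r) (snd r))) - itriple \<alpha> r"
          using ancn by (simp add: S_def anc_def c_def)
        show "triple_average \<alpha> f (fst r + int (Suc j), grid_index \<alpha> (fst r + int (Suc j)) (corner \<alpha> (fst r) (snd r))) \<le> A * triple_average \<alpha> f p" if "j < n" for j
          using ok[OF that] by (simp add: anc_def c_def)
        show "0 \<le> A * triple_average \<alpha> f p" using A(1) triple_average_nonneg[of \<alpha> f p] by simp
      qed
      have ns: "z \<notin> supp (cut S f)" if "z \<in> icube \<alpha> r" for z
        unfolding supp_def by (intro not_in_closure_outside_triple_cube[OF that]) (auto simp: indicator_def S_def)
      have "itriple \<alpha> r \<subseteq> itriple \<alpha> p" using rp by (intro itriple_mono) auto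
      then have split: "(\<lambda>x. cut S f x + cut (itriple \<alpha> r) f x) = cut (itriple \<alpha> p) f"
        by (auto simp: S_def indicator_def fun_eq_iff)
      have Tsplit: "AE x in lebesgue. T (cut (itriple \<alpha> p) f) x = T (cut S f) x + T (cut (itriple \<alpha> r) f) x"
        using T_add[OF cS cf[of r]] unfolding split .
      have rep: "AE x in lebesgue. x \<in> icube \<alpha> r \<longrightarrow> T (cut S f) x = (LINT y|lebesgue. K x y * cut S f y)"
        using representation[OF cS] by eventually_elim (use ns in blast)
      \<comment> \<open>Inside \<open>r\<close> the set \<open>U\<close> takes at most half of the
        measure and \<open>E r\<close> less than half. The rest has positive measure, so it contains
        a point at which the almost-everywhere identities hold too.\<close>
      have "emeasure lebesgue (icube \<alpha> r - (U \<union> E r)) \<noteq> 0"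
      proof
        assume z: "emeasure lebesgue (icube \<alpha> r - (U \<union> E r)) = 0"
        have "emeasure lebesgue (icube \<alpha> r \<inter> U) \<le> ennreal (v r / 2)"
        proof -
          have "icube \<alpha> r \<subseteq> icube \<alpha> (anc 1)" by (intro cube_subset[OF c canc]) (simp add: anc_def)
          then have "measure lebesgue (icube \<alpha> r \<inter> U) \<le> measure lebesgue (icube \<alpha> (anc (Suc 0)) \<inter> U)"
            using Ul by (intro measure_mono_fmeasurable) (auto intro: fmeasurable_Int_fmeasurable simp: Int_commute)
          also have "\<dots> \<le> a * v (anc (Suc 0))" using ok[OF n(2)] by blast
          also have "\<dots> = v r / 2" by (simp add: a_def v_def anc_def power_int_add power_mult_distrib)
          finally have "measure lebesgue (icube \<alpha> r \<inter> U) \<le> v r / 2" .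
          moreover have "icube \<alpha> r \<inter> U \<in> lmeasurable" using Ul by (metis Int_commute cube_sets(1) fmeasurable_Int_fmeasurable)
          ultimately show ?thesis by (metis emeasure_eq_measure2 ennreal_leI)
        qed
        have "emeasure lebesgue (icube \<alpha> r) \<le> emeasure lebesgue ((icube \<alpha> r \<inter> U) \<union> (E r \<union> (icube \<alpha> r - (U \<union> E r))))"
          using Es by (intro emeasure_mono) auto
        also have "\<dots> \<le> emeasure lebesgue (icube \<alpha> r \<inter> U) + (emeasure lebesgue (E r) + emeasure lebesgue (icube \<alpha> r - (U \<union> E r)))"
          using Es by (intro order_trans[OF emeasure_subadditive] add_mono order_refl) auto
        also have "\<dots> \<le> ennreal (v r / 2) + (ennreal (e * v r) + 0)"
          using z Em[of r] \<open>emeasure lebesgue (icube \<alpha> r \<inter> U) \<le> ennreal (v r / 2)\<close> by (intro add_mono) auto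
        also have "\<dots> = ennreal (v r / 2 + e * v r)" using v0[of r] e0 by simp
        finally have "v r \<le> v r / 2 + e * v r"
          unfolding mv using v0[of r] e0 by (subst (asm) ennreal_le_iff) auto
        moreover have "(2::real) ^ 1 < 2 ^ (CARD('n) + 4)" by (rule power_strict_increasing) auto
        then have "e < 1 / 2" unfolding e_def by (intro divide_strict_left_mono) auto
        then have "e * v r < 1 / 2 * v r" using v0[of r] by (intro mult_strict_right_mono)
        ultimately show False by simp
      qed
      moreover have "icube \<alpha> r - (U \<union> E r) \<in> sets lebesgue" using Es by auto
      ultimately obtain x' where "x' \<in> icube \<alpha> r - (U \<union> E r)"
        and "T (cut (itriple \<alpha> p) f) x' = T (cut S f) x' + T (cut (itriple \<alpha> r) f) x' \<and>
          (x' \<in> icube \<alpha> r \<longrightarrow> T (cut S f) x' = (LINT y|lebesgue. K x' y * cut S f y))"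
        using AE_exists_in_set[OF AE_conjI[OF Tsplit rep]] by blast
      then have x': "x' \<in> icube \<alpha> r" "x' \<notin> U" "x' \<notin> E r"
        "T (cut (itriple \<alpha> p) f) x' = T (cut S f) x' + T (cut (itriple \<alpha> r) f) x'"
        "T (cut S f) x' = (LINT y|lebesgue. K x' y * cut S f y)"
        by blast+
      have b1: "cmod (T (cut (itriple \<alpha> p) f) x') \<le> A * triple_average \<alpha> f p"
      proof -
        have "x' \<notin> E p" using x'(2) U(2) by blast
        then show ?thesis by (simp add: E_def not_less)
      qed
      have b2: "cmod (T (cut (itriple \<alpha> r) f) x') \<le> A * triple_average \<alpha> f r" using x'(3) by (auto simp: E_def)
      have "T (cut S f) x' = T (cut (itriple \<alpha> p) f) x' - T (cut (itriple \<alpha> r) f) x'" using x'(4) by simp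
      then have b3: "cmod (T (cut S f) x') \<le> A * triple_average \<alpha> f p + A * triple_average \<alpha> f r"
        using norm_triangle_ineq4[of "T (cut (itriple \<alpha> p) f) x'" "T (cut (itriple \<alpha> r) f) x'"] b1 b2 by simp
      show ?thesis
        using Tsplit rep
      proof eventually_elim
        case (elim x)
        show ?case
        proof
          assume x: "x \<in> icube \<alpha> r"
          have "cmod (T (cut S f) x - T (cut S f) x') \<le> 6 ^ CARD('n) * suminf \<rho> * (A * triple_average \<alpha> f p)"
            using osc[OF x x'(1)] elim(2) x x'(5) by simp
          then have "cmod (T (cut S f) x) \<le> 6 ^ CARD('n) * suminf \<rho> * (A * triple_average \<alpha> f p) + (A * triple_average \<alpha> f p + A * triple_average \<alpha> f r)"
            using b3 norm_triangle_sub[of "T (cut S f) x" "T (cut S f) x'"] by linarith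
          also have "\<dots> = A' * triple_average \<alpha> f p + A * triple_average \<alpha> f r" by (simp add: A'_def algebra_simps)
          also have "\<dots> \<le> A' * triple_average \<alpha> f p + A' * triple_average \<alpha> f r" using A'(1) triple_average_nonneg by (intro add_left_mono mult_right_mono)
          finally show "cmod (T (cut (itriple \<alpha> p) f) x) \<le> A' * triple_average \<alpha> f p + A' * triple_average \<alpha> f r + cmod (T (cut (itriple \<alpha> r) f) x)"
            unfolding elim(1) using norm_triangle_ineq[of "T (cut S f) x" "T (cut (itriple \<alpha> r) f) x"] by linarith
        qed
      qed
    qed
    show "\<exists>Ch. stopping_family A' \<alpha> f p Ch"
      unfolding stopping_family_def
    proof (intro exI[of _ Ch] conjI ballI)
      show "disjoint_family_on (icube \<alpha>) Ch" unfolding Ch_def by (rule maximal_cubes_disjoint)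
      show "icube \<alpha> r \<subseteq> icube \<alpha> p" if "r \<in> Ch" for r using ChSt[OF that] by (auto simp: St_def sub_def)
      show "emeasure lebesgue (\<Union>r\<in>Ch. icube \<alpha> r) \<le> ennreal ((2 powi fst p) ^ CARD('n) / 2)"
        using meas by (simp only: v_def)
      show "AE x in lebesgue. x \<in> icube \<alpha> p - (\<Union>r\<in>Ch. icube \<alpha> r) \<longrightarrow>
         cmod (T (cut (itriple \<alpha> p) f) x) \<le> A' * triple_average \<alpha> f p"
        using c3 by (intro always_eventually) blast
    qed (use c4 in blast)
  qed
qed

text \<open>The total measure at least halves with every generation of stopping cubes, so almost
  every point leaves them after finitely many steps; the finite set \<open>G\<close> is its chain of
  cubes. The factor 2 arises because a cube contributes its average once as a child and once as a
  parent.\<close>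

lemma (in cz_data) sparse_domination:
  obtains A where "0 < A" "\<And>f \<alpha> p. f \<in> bcs \<Longrightarrow>
    \<exists>F E. (\<forall>r\<in>F. E r \<in> sets lebesgue \<and> E r \<subseteq> icube \<alpha> r \<and>
        measure lebesgue (icube \<alpha> r) / 2 \<le> measure lebesgue (E r)) \<and> disjoint_family_on E F \<and>
      (AE x in lebesgue. x \<in> icube \<alpha> p \<longrightarrow> (\<exists>G. finite G \<and> G \<subseteq> F \<and>
         cmod (T (cut (itriple \<alpha> p) f) x) \<le> A * (\<Sum>r\<in>G. triple_average \<alpha> f r * indicator (icube \<alpha> r) x)))"
proof -
  obtain A where A: "0 < A"
    and step: "\<And>f \<alpha> p. f \<in> bcs \<Longrightarrow> \<exists>Ch. stopping_family A \<alpha> f p Ch"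
    using ex_stopping_family by blast
  show thesis
  proof (rule that[of "2 * A"])
    show "0 < 2 * A" using A by simp
    fix f :: "real^'n \<Rightarrow> complex" and \<alpha> :: "'n \<Rightarrow> bool" and p :: "int \<times> ('n \<Rightarrow> int)"
    assume f: "f \<in> bcs"
    have "\<forall>p. \<exists>Ch. stopping_family A \<alpha> f p Ch" by (intro allI step f)
    from choice[OF this] obtain Ch where "\<And>p. stopping_family A \<alpha> f p (Ch p)" by blast
    note Ch0 = this[unfolded stopping_family_def]
    note Ch = Ch0[THEN conjunct1] Ch0[THEN conjunct2, THEN conjunct1, rule_format]
      Ch0[THEN conjunct2, THEN conjunct2, THEN conjunct1]
      Ch0[THEN conjunct2, THEN conjunct2, THEN conjunct2, THEN conjunct1]
      Ch0[THEN conjunct2, THEN conjunct2, THEN conjunct2, THEN conjunct2, THEN bspec]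
    define V where "V r = (\<Union>s\<in>Ch r. icube \<alpha> s)" for r
    \<comment> \<open>What the children leave of \<open>r\<close> is at least half of it and serves
      as its disjoint part; almost everywhere on it the iteration stops at \<open>r\<close>.\<close>
    define E where "E r = icube \<alpha> r - V r" for r
    define F where "F = rec_nat {p} (\<lambda>_ S. \<Union>r\<in>S. Ch r)"
    have F0: "F 0 = {p}" and FS: "F (Suc n) = (\<Union>r\<in>F n. Ch r)" for n by (simp_all add: F_def)
    define U where "U n = (\<Union>r\<in>F n. icube \<alpha> r)" for n
    have Vs: "V r \<in> sets lebesgue" for r unfolding V_def by (rule Union_icube_sets)
    have Us: "U n \<in> sets lebesgue" for n unfolding U_def by (rule Union_icube_sets)
    have VQ: "V r \<subseteq> icube \<alpha> r" for r using Ch(2) unfolding V_def by blast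
    have dF: "disjoint_family_on (icube \<alpha>) (F n)" for n
    proof (induction n)
      case 0
      show ?case by (simp add: F0 disjoint_family_on_def)
    next
      case (Suc n)
      show ?case unfolding disjoint_family_on_def
      proof (intro ballI impI)
        fix r s assume rs: "r \<in> F (Suc n)" "s \<in> F (Suc n)" "r \<noteq> s"
        then obtain r' s' where *: "r' \<in> F n" "r \<in> Ch r'" "s' \<in> F n" "s \<in> Ch s'" by (auto simp: FS)
        show "icube \<alpha> r \<inter> icube \<alpha> s = {}"
        proof (cases "r' = s'")
          case True
          then show ?thesis using disjoint_family_onD[OF Ch(1)[of r'] *(2)] * rs(3) by blast
        next
          case False
          then have "icube \<alpha> r' \<inter> icube \<alpha> s' = {}" using disjoint_family_onD[OF Suc.IH *(1,3)] by blast
          then show ?thesis using Ch(2)[OF *(2)] Ch(2)[OF *(4)] by blast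
        qed
      qed
    qed
    have same: "r = s" if "r \<in> F n" "s \<in> F n" "x \<in> icube \<alpha> r" "x \<in> icube \<alpha> s" for r s n x
      using disjoint_family_onD[OF dF that(1,2)] that(3,4) by blast
    have US: "U (Suc n) = (\<Union>r\<in>F n. V r)" for n unfolding U_def V_def FS by blast
    have Udec: "U n \<subseteq> U m" if "m \<le> n" for m n
      using that
    proof (rule lift_Suc_antimono_le[of U, rotated])
      show "U (Suc n) \<le> U n" for n unfolding US using VQ by (auto simp: U_def)
    qed
    have VE: "emeasure lebesgue (V r) \<le> ennreal (1 / 2) * emeasure lebesgue (icube \<alpha> r)" for r
    proof -
      have "emeasure lebesgue (icube \<alpha> r) = ennreal ((2 powi fst r) ^ CARD('n))" by simp
      moreover have "ennreal (1 / 2) * ennreal ((2 powi fst r) ^ CARD('n)) = ennreal ((2 powi fst r) ^ CARD('n) / 2)"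
        by (subst ennreal_mult'[symmetric]) auto
      ultimately show ?thesis using Ch(3)[of r] unfolding V_def by (simp only:)
    qed
    have Um: "emeasure lebesgue (U n) \<le> ennreal ((1 / 2) ^ n * (2 powi fst p) ^ CARD('n))" for n
    proof (induction n)
      case 0
      show ?case by (simp add: U_def F0)
    next
      case (Suc n)
      have dV: "disjoint_family_on V (F n)"
        unfolding disjoint_family_on_def using VQ disjoint_family_onD[OF dF] by blast
      have "emeasure lebesgue (U (Suc n)) = (\<integral>\<^sup>+r. emeasure lebesgue (V r) \<partial>count_space (F n))"
        unfolding US by (intro emeasure_UN_countable countable_icube_index dV Vs)
      also have "\<dots> \<le> (\<integral>\<^sup>+r. ennreal (1 / 2) * emeasure lebesgue (icube \<alpha> r) \<partial>count_space (F n))"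
        by (intro nn_integral_mono VE)
      also have "\<dots> = ennreal (1 / 2) * (\<integral>\<^sup>+r. emeasure lebesgue (icube \<alpha> r) \<partial>count_space (F n))"
        by (rule nn_integral_cmult) simp
      also have "(\<integral>\<^sup>+r. emeasure lebesgue (icube \<alpha> r) \<partial>count_space (F n)) = emeasure lebesgue (U n)"
        unfolding U_def by (intro emeasure_UN_countable[symmetric] countable_icube_index dF) simp
      also have "ennreal (1 / 2) * emeasure lebesgue (U n) \<le> ennreal (1 / 2) * ennreal ((1 / 2) ^ n * (2 powi fst p) ^ CARD('n))"
        by (intro mult_left_mono Suc.IH) auto
      also have "\<dots> = ennreal ((1 / 2) ^ Suc n * (2 powi fst p) ^ CARD('n))"
        by (subst ennreal_mult'[symmetric]) auto
      finally show ?case .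
    qed
    have EU: "E r \<inter> U (Suc n) = {}" if "r \<in> F n" for r n
    proof (rule equals0I)
      fix x assume x: "x \<in> E r \<inter> U (Suc n)"
      then obtain s where s: "s \<in> F n" "x \<in> V s" by (auto simp: US)
      have "x \<in> icube \<alpha> s" "x \<in> icube \<alpha> r" "x \<notin> V r" using s VQ[of s] x by (auto simp: E_def)
      then show False using same[OF s(1) that] s(2) by blast
    qed
    have Em: "E r \<in> sets lebesgue \<and> E r \<subseteq> icube \<alpha> r \<and> measure lebesgue (icube \<alpha> r) / 2 \<le> measure lebesgue (E r)" for r
    proof (intro conjI)
      show "E r \<in> sets lebesgue" unfolding E_def using Vs by auto
      show "E r \<subseteq> icube \<alpha> r" by (auto simp: E_def)
      have ql: "icube \<alpha> r \<in> lmeasurable" by (simp add: fmeasurable_def)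
      then have Vl: "V r \<in> lmeasurable" using VQ Vs by (rule fmeasurableI2)
      have "measure lebesgue (E r) = measure lebesgue (icube \<alpha> r) - measure lebesgue (V r)"
        unfolding E_def using ql Vl VQ by (intro measurable_measure_Diff) auto
      moreover have "measure lebesgue (V r) \<le> (2 powi fst r) ^ CARD('n) / 2"
        unfolding measure_def using Ch(3)[of r] by (intro enn2real_leI) (auto simp: V_def)
      ultimately show "measure lebesgue (icube \<alpha> r) / 2 \<le> measure lebesgue (E r)" by simp
    qed
    have E_ne: "E r \<noteq> {}" for r
    proof
      assume "E r = {}"
      then have "(2 powi fst r :: real) ^ CARD('n) \<le> 0" using Em[of r] by simp
      moreover have "0 < (2 powi fst r :: real) ^ CARD('n)" by simp
      ultimately show False by linarith
    qed
    have Esub: "E r \<subseteq> U m" if "r \<in> F n" "m \<le> n" for r m n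
      using Em[of r] Udec[OF that(2)] that(1) by (auto simp: U_def)
    have dE: "E r \<inter> E s = {}" if "r \<in> F m" "s \<in> F n" "r \<noteq> s" "m \<le> n" for r s m n
    proof (cases "m = n")
      case True
      then show ?thesis using disjoint_family_onD[OF dF, of r m s] that by (auto simp: E_def)
    next
      case False
      then show ?thesis using EU[OF that(1)] Esub[OF that(2), of "Suc m"] that(4) by auto
    qed
    \<comment> \<open>A cube cannot recur in a later generation, since later cubes avoid its
      nonempty part \<open>E r\<close>. Hence inserting the next cube into a chain really adds its
      average to the sum.\<close>
    have fresh: "r \<notin> F m" if "r \<in> F n" "m < n" for r m n
    proof
      assume "r \<in> F m"
      then show False using EU[of r m] Esub[OF that(1), of "Suc m"] that(2) E_ne[of r] by auto
    qed
    \<comment> \<open>Countably many pairs of cubes are involved, so a single null set covers every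
      inequality used in the iteration at a point.\<close>
    define Good where "Good x \<longleftrightarrow> (\<forall>r. (x \<in> icube \<alpha> r - V r \<longrightarrow> cmod (T (cut (itriple \<alpha> r) f) x) \<le> A * triple_average \<alpha> f r) \<and>
      (\<forall>s\<in>Ch r. x \<in> icube \<alpha> s \<longrightarrow> cmod (T (cut (itriple \<alpha> r) f) x) \<le> A * triple_average \<alpha> f r + A * triple_average \<alpha> f s + cmod (T (cut (itriple \<alpha> s) f) x)))" for x
    have AEGood: "AE x in lebesgue. Good x"
      unfolding Good_def AE_all_countable
    proof (intro allI AE_conjI)
      fix r
      show "AE x in lebesgue. x \<in> icube \<alpha> r - V r \<longrightarrow> cmod (T (cut (itriple \<alpha> r) f) x) \<le> A * triple_average \<alpha> f r"
        unfolding V_def by (rule Ch(4))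
      show "AE x in lebesgue. \<forall>s\<in>Ch r. x \<in> icube \<alpha> s \<longrightarrow>
          cmod (T (cut (itriple \<alpha> r) f) x) \<le> A * triple_average \<alpha> f r + A * triple_average \<alpha> f s + cmod (T (cut (itriple \<alpha> s) f) x)"
        using Ch(5)[of _ r] by (simp only: AE_ball_countable[OF countable_icube_index]) blast
    qed
    define \<Sigma> where "\<Sigma> G x = (\<Sum>r\<in>G. triple_average \<alpha> f r * indicator (icube \<alpha> r) x)" for G x
    have ins: "\<Sigma> (insert r G) x = \<Sigma> G x + triple_average \<alpha> f r" if "finite G" "G \<subseteq> (\<Union>i<n. F i)" "r \<in> F n" "x \<in> icube \<alpha> r" for r G x n
    proof -
      have "r \<notin> G" using fresh[OF that(3)] that(2) by auto
      then show ?thesis unfolding \<Sigma>_def sum.insert[OF that(1) \<open>r \<notin> G\<close>] using that(4) by simp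
    qed
    \<comment> \<open>The average of the current cube \<open>r\<close> is carried with factor
      \<open>A\<close> only; its second share is added when the chain moves below \<open>r\<close>
      or ends there.\<close>
    have chain: "\<exists>G. finite G \<and> G \<subseteq> (\<Union>i<n. F i) \<and>
        cmod (T (cut (itriple \<alpha> p) f) x) \<le> 2 * A * \<Sigma> G x + A * triple_average \<alpha> f r + cmod (T (cut (itriple \<alpha> r) f) x)"
      if "Good x" "r \<in> F n" "x \<in> icube \<alpha> r" for x r n
      using that(2,3)
    proof (induction n arbitrary: r)
      case 0
      then show ?case using A triple_average_nonneg[of \<alpha> f p] by (intro exI[of _ "{}"]) (simp add: F0 \<Sigma>_def)
    next
      case (Suc n)
      then obtain q where q: "q \<in> F n" "r \<in> Ch q" by (auto simp: FS)
      have xq: "x \<in> icube \<alpha> q" using Ch(2)[OF q(2)] Suc.prems(2) by blast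
      obtain G where G: "finite G" "G \<subseteq> (\<Union>i<n. F i)"
        "cmod (T (cut (itriple \<alpha> p) f) x) \<le> 2 * A * \<Sigma> G x + A * triple_average \<alpha> f q + cmod (T (cut (itriple \<alpha> q) f) x)"
        using Suc.IH[OF q(1) xq] by blast
      have "cmod (T (cut (itriple \<alpha> q) f) x) \<le> A * triple_average \<alpha> f q + A * triple_average \<alpha> f r + cmod (T (cut (itriple \<alpha> r) f) x)"
        using \<open>Good x\<close> q(2) Suc.prems(2) unfolding Good_def by blast
      then have "cmod (T (cut (itriple \<alpha> p) f) x) \<le> 2 * A * \<Sigma> (insert q G) x + A * triple_average \<alpha> f r + cmod (T (cut (itriple \<alpha> r) f) x)"
        using G(3) unfolding ins[OF G(1,2) q(1) xq] by (simp add: algebra_simps)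
      moreover have "insert q G \<subseteq> (\<Union>i<Suc n. F i)" using G(2) q(1) unfolding lessThan_Suc by blast
      ultimately show ?case using G(1) by (intro exI[of _ "insert q G"]) auto
    qed
    have null: "(\<Inter>n. U n) \<in> null_sets lebesgue"
    proof -
      have "emeasure lebesgue (\<Inter>n. U n) \<le> 0"
      proof (rule Lim_bounded2)
        have "(\<lambda>n. (1 / 2 :: real) ^ n * (2 powi fst p) ^ CARD('n)) \<longlonglongrightarrow> 0 * (2 powi fst p) ^ CARD('n)"
          by (intro tendsto_mult LIMSEQ_power_zero tendsto_const) auto
        then show "(\<lambda>n. ennreal ((1 / 2) ^ n * (2 powi fst p) ^ CARD('n))) \<longlonglongrightarrow> 0"
          using tendsto_ennrealI by fastforce
        show "\<forall>n\<ge>0. emeasure lebesgue (\<Inter>n. U n) \<le> ennreal ((1 / 2) ^ n * (2 powi fst p) ^ CARD('n))"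
          using Us by (intro allI impI order_trans[OF _ Um] emeasure_mono) auto
      qed
      moreover have "(\<Inter>n. U n) \<in> sets lebesgue" using Us by auto
      ultimately show ?thesis by (auto simp: null_sets_def)
    qed
    have final: "AE x in lebesgue. x \<in> icube \<alpha> p \<longrightarrow> (\<exists>G. finite G \<and> G \<subseteq> (\<Union>n. F n) \<and>
        cmod (T (cut (itriple \<alpha> p) f) x) \<le> 2 * A * \<Sigma> G x)"
      using AEGood AE_not_in[OF null]
    proof eventually_elim
      case (elim x)
      show ?case
      proof
        assume xp: "x \<in> icube \<alpha> p"
        define n where "n = (LEAST n. x \<notin> U n)"
        have nU: "x \<notin> U n" unfolding n_def by (rule LeastI_ex) (use elim(2) in blast)
        have "x \<in> U 0" using xp by (simp add: U_def F0)
        then obtain m where m: "n = Suc m" using nU by (cases n) auto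
        have "x \<in> U m" using not_less_Least[of m "\<lambda>n. x \<notin> U n"] m unfolding n_def[symmetric] by simp
        then obtain r where r: "r \<in> F m" "x \<in> icube \<alpha> r" by (auto simp: U_def)
        obtain G where G: "finite G" "G \<subseteq> (\<Union>i<m. F i)"
          "cmod (T (cut (itriple \<alpha> p) f) x) \<le> 2 * A * \<Sigma> G x + A * triple_average \<alpha> f r + cmod (T (cut (itriple \<alpha> r) f) x)"
          using chain[OF elim(1) r] by blast
        have "x \<notin> V r" using nU r(1) unfolding m US by blast
        then have "cmod (T (cut (itriple \<alpha> r) f) x) \<le> A * triple_average \<alpha> f r"
          using elim(1) r(2) unfolding Good_def by blast
        then have "cmod (T (cut (itriple \<alpha> p) f) x) \<le> 2 * A * \<Sigma> (insert r G) x"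
          using G(3) unfolding ins[OF G(1,2) r] by (simp add: algebra_simps)
        then show "\<exists>G. finite G \<and> G \<subseteq> (\<Union>n. F n) \<and> cmod (T (cut (itriple \<alpha> p) f) x) \<le> 2 * A * \<Sigma> G x"
          using G(1,2) r(1) by (intro exI[of _ "insert r G"]) auto
      qed
    qed
    show "\<exists>F E. (\<forall>r\<in>F. E r \<in> sets lebesgue \<and> E r \<subseteq> icube \<alpha> r \<and>
        measure lebesgue (icube \<alpha> r) / 2 \<le> measure lebesgue (E r)) \<and> disjoint_family_on E F \<and>
      (AE x in lebesgue. x \<in> icube \<alpha> p \<longrightarrow> (\<exists>G. finite G \<and> G \<subseteq> F \<and>
         cmod (T (cut (itriple \<alpha> p) f) x) \<le> 2 * A * (\<Sum>r\<in>G. triple_average \<alpha> f r * indicator (icube \<alpha> r) x)))"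
    proof (intro exI[of _ "\<Union>n. F n"] exI[of _ E] conjI)
      show "\<forall>r\<in>(\<Union>n. F n). E r \<in> sets lebesgue \<and> E r \<subseteq> icube \<alpha> r \<and>
        measure lebesgue (icube \<alpha> r) / 2 \<le> measure lebesgue (E r)" using Em by blast
      show "disjoint_family_on E (\<Union>n. F n)"
        unfolding disjoint_family_on_def
      proof (intro ballI impI)
        fix r s assume "r \<in> (\<Union>n. F n)" "s \<in> (\<Union>n. F n)" "r \<noteq> s"
        then obtain m n where "r \<in> F m" "s \<in> F n" by blast
        then show "E r \<inter> E s = {}" using dE[of r m s n] dE[of s n r m] \<open>r \<noteq> s\<close> by (cases "m \<le> n") auto
      qed
    qed (use final in \<open>simp only: \<Sigma>_def\<close>)
  qed
qed

section \<open>Quasi-norms of sparse operators\<close>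

lemma sparse_operator_finite:
  "finite S \<Longrightarrow> sparse_operator S f x = (\<Sum>Q\<in>S. average f Q * indicator Q x)"
  by (simp add: sparse_operator_def)

lemma average_nonneg: "(\<And>x. 0 \<le> f x) \<Longrightarrow> 0 \<le> average f Q"
  unfolding average_def set_lebesgue_integral_def by (intro divide_nonneg_nonneg integral_nonneg_AE) auto

lemma average_mono:
  assumes "integrable lebesgue f" "integrable lebesgue g" "Q \<in> sets lebesgue" "\<And>x. f x \<le> g x"
  shows "average f Q \<le> average g Q"
  unfolding average_def using assms by (intro divide_right_mono set_LINT_mono) auto

lemma grid_sets: "S \<subseteq> grid \<beta> \<Longrightarrow> Q \<in> S \<Longrightarrow> Q \<in> sets lebesgue"
  by (auto simp: grid_def)

lemma sparse_operator_mono: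
  assumes "finite S" "S \<subseteq> grid \<beta>" "integrable lebesgue f" "integrable lebesgue g" "\<And>x. f x \<le> g x"
  shows "sparse_operator S f x \<le> sparse_operator S g x"
  unfolding sparse_operator_finite[OF assms(1)] using assms grid_sets[OF assms(2)]
  by (intro sum_mono mult_right_mono average_mono) auto

lemma sparse_operator_nonneg:
  "finite S \<Longrightarrow> (\<And>x. 0 \<le> f x) \<Longrightarrow> 0 \<le> sparse_operator S f x"
  by (simp add: sparse_operator_finite sum_nonneg average_nonneg)

lemma sparse_operator_measurable:
  assumes "finite S" "S \<subseteq> grid \<beta>"
  shows "sparse_operator S f \<in> borel_measurable lebesgue"
proof -
  have "(\<lambda>x. \<Sum>Q\<in>S. average f Q * indicator Q x) \<in> borel_measurable lebesgue"
    using grid_sets[OF assms(2)] by (intro borel_measurable_sum borel_measurable_times borel_measurable_indicator) auto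
  moreover have "sparse_operator S f = (\<lambda>x. \<Sum>Q\<in>S. average f Q * indicator Q x)"
    by (rule ext) (rule sparse_operator_finite[OF assms(1)])
  ultimately show ?thesis by simp
qed

lemma triple_average_le_average:
  fixes r :: "int \<times> ('n::finite \<Rightarrow> int)"
  assumes f: "integrable lebesgue f" and sub: "itriple \<alpha> r \<subseteq> cube \<beta> (fst r + 4) m"
  shows "triple_average \<alpha> f r \<le> (16 / 3) ^ CARD('n) * average (\<lambda>x. cmod (f x)) (cube \<beta> (fst r + 4) m)"
proof -
  define v where "v = (2 powi fst r :: real) ^ CARD('n)"
  have v: "0 < v" by (simp add: v_def)
  have "measure lebesgue (cube \<beta> (fst r + 4) m) = 16 ^ CARD('n) * v"
    by (simp add: v_def power_int_add power_mult_distrib)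
  then have "(16 / 3) ^ CARD('n) * average (\<lambda>x. cmod (f x)) (cube \<beta> (fst r + 4) m)
      = (LINT x:cube \<beta> (fst r + 4) m|lebesgue. cmod (f x)) / (3 ^ CARD('n) * v)"
    unfolding average_def by (simp add: power_divide del: measure_cube)
  moreover have "(LINT x:itriple \<alpha> r|lebesgue. cmod (f x)) \<le> (LINT x:cube \<beta> (fst r + 4) m|lebesgue. cmod (f x))"
    using f sub by (intro set_LINT_mono_set) auto
  ultimately show ?thesis using v by (simp add: triple_average_def v_def divide_right_mono)
qed

text \<open>Replacing cubes by enclosing shifted cubes of 16 times the side weakens sparseness to
  the fraction \<open>1 / (2 * 16 ^ CARD('n))\<close>. Splitting by generations restores the
  fraction one half at the price of \<open>4 * 16 ^ CARD('n)\<close> classes in each grid.\<close>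

lemma finite_sparse_families:
  fixes G :: "(int \<times> ('n::finite \<Rightarrow> int)) set" and E :: "int \<times> ('n \<Rightarrow> int) \<Rightarrow> (real^'n) set"
  assumes G: "finite G" and dE: "disjoint_family_on E G"
    and E: "\<And>r. r \<in> G \<Longrightarrow> E r \<in> sets lebesgue \<and> E r \<subseteq> icube \<alpha> r \<and> measure lebesgue (icube \<alpha> r) / 2 \<le> measure lebesgue (E r)"
  shows "\<exists>P :: ('n \<Rightarrow> bool) \<Rightarrow> nat \<Rightarrow> (real^'n) set set.
    (\<forall>\<beta>. \<forall>i<4 * 16 ^ CARD('n). finite (P \<beta> i) \<and> P \<beta> i \<subseteq> grid \<beta> \<and> sparse_collection (P \<beta> i)) \<and>
    (\<forall>f x. integrable lebesgue f \<longrightarrow> (\<Sum>r\<in>G. triple_average \<alpha> f r * indicator (icube \<alpha> r) x) \<le>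
       (16 / 3) ^ CARD('n) * (\<Sum>\<beta>\<in>UNIV. \<Sum>i<4 * 16 ^ CARD('n). sparse_operator (P \<beta> i) (\<lambda>y. cmod (f y)) x))"
proof -
  define N :: nat where "N = 4 * 16 ^ CARD('n)"
  have "\<exists>b. itriple \<alpha> r \<subseteq> cube (fst b) (fst r + 4) (snd b)" for r
    using triple_cube_in_shifted_cube[of \<alpha> "fst r" "snd r"] by auto
  then obtain b where b: "\<And>r. itriple \<alpha> r \<subseteq> cube (fst (b r)) (fst r + 4) (snd (b r))" by metis
  define R where "R r = cube (fst (b r)) (fst r + 4) (snd (b r))" for r
  define S where "S \<beta> = R ` {r\<in>G. fst (b r) = \<beta>}" for \<beta>
  have sub: "icube \<alpha> r \<subseteq> R r" for r using b[of r] cube_triple_cube[of \<alpha> "fst r" "snd r"] by (auto simp: R_def)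
  have Sfin: "finite (S \<beta>)" for \<beta> using G by (simp add: S_def)
  have Sgrid: "S \<beta> \<subseteq> grid \<beta>" for \<beta> by (auto simp: S_def R_def grid_def)
  have "\<exists>P. S \<beta> = (\<Union>i<N. P i) \<and> disjoint_family_on P {..<N} \<and> (\<forall>i<N. sparse_collection (P i))" for \<beta>
  proof -
    \<comment> \<open>Several cubes may be sent to the same \<open>Q\<close>. Their disjoint parts
      are collected, so that distinct shifted cubes still receive disjoint sets; one preimage
      already provides the required fraction.\<close>
    define E' where "E' Q = (\<Union>r\<in>{r\<in>G. fst (b r) = \<beta> \<and> R r = Q}. E r)" for Q
    have a: "E' Q \<in> sets lebesgue \<and> E' Q \<subseteq> Q \<and> 1 / (2 * 16 ^ CARD('n)) * measure lebesgue Q \<le> measure lebesgue (E' Q)" if "Q \<in> S \<beta>" for Q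
    proof -
      obtain r where r: "r \<in> G" "fst (b r) = \<beta>" "R r = Q" using \<open>Q \<in> S \<beta>\<close> by (auto simp: S_def)
      have "E' Q \<subseteq> Q"
      proof
        fix x assume "x \<in> E' Q"
        then obtain s where "s \<in> G" "R s = Q" "x \<in> E s" by (auto simp: E'_def)
        then show "x \<in> Q" using E[of s] sub[of s] by blast
      qed
      moreover have s': "E' Q \<in> sets lebesgue" unfolding E'_def using G E by (intro sets.finite_UN) auto
      moreover have "1 / (2 * 16 ^ CARD('n)) * measure lebesgue Q \<le> measure lebesgue (E' Q)"
      proof -
        have "1 / (2 * 16 ^ CARD('n)) * measure lebesgue Q = measure lebesgue (icube \<alpha> r) / 2"
          using r(3) by (auto simp: R_def power_int_add power_mult_distrib)
        also have "\<dots> \<le> measure lebesgue (E r)" using E[OF r(1)] by blast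
        also have "\<dots> \<le> measure lebesgue (E' Q)"
        proof (rule measure_mono_fmeasurable)
          show "E r \<subseteq> E' Q" using r by (auto simp: E'_def)
          show "E r \<in> sets lebesgue" using E[OF r(1)] by blast
          have "Q \<in> lmeasurable" using r(3) by (auto simp: R_def fmeasurable_def)
          then show "E' Q \<in> lmeasurable" using \<open>E' Q \<subseteq> Q\<close> s' by (rule fmeasurableI2)
        qed
        finally show ?thesis .
      qed
      ultimately show ?thesis by blast
    qed
    have d: "disjoint_family_on E' (S \<beta>)"
      unfolding disjoint_family_on_def
    proof (intro ballI impI equals0I)
      fix Q Q' x assume "Q \<noteq> Q'" "x \<in> E' Q \<inter> E' Q'"
      then obtain s s' where "s \<in> G" "s' \<in> G" "R s = Q" "R s' = Q'" "x \<in> E s" "x \<in> E s'" by (auto simp: E'_def)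
      then show False using disjoint_family_onD[OF dE, of s s'] \<open>Q \<noteq> Q'\<close> by blast
    qed
    have \<eta>: "0 < 1 / (2 * 16 ^ CARD('n) :: real)" "2 / (1 / (2 * 16 ^ CARD('n))) \<le> real N" by (simp_all add: N_def)
    obtain P where "S \<beta> = (\<Union>i<N. P i)" "disjoint_family_on P {..<N}" "\<And>i. i < N \<Longrightarrow> sparse_collection (P i)"
      using sparse_split[OF Sfin Sgrid \<eta> a d] by metis
    then show ?thesis by (intro exI[of _ P]) simp
  qed
  then obtain P where P: "\<And>\<beta>. S \<beta> = (\<Union>i<N. P \<beta> i)" "\<And>\<beta>. disjoint_family_on (P \<beta>) {..<N}"
    "\<And>\<beta> i. i < N \<Longrightarrow> sparse_collection (P \<beta> i)" by metis
  have Pfin: "finite (P \<beta> i)" "P \<beta> i \<subseteq> grid \<beta>" if "i < N" for \<beta> i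
    using Sfin[of \<beta>] Sgrid[of \<beta>] that unfolding P(1) by (auto simp: finite_UN)
  show ?thesis
  proof (rule exI[of _ P], rule conjI)
    show "\<forall>\<beta>. \<forall>i<4 * 16 ^ CARD('n). finite (P \<beta> i) \<and> P \<beta> i \<subseteq> grid \<beta> \<and> sparse_collection (P \<beta> i)"
      using Pfin P(3) by (simp add: N_def)
  next
    show "\<forall>f x. integrable lebesgue f \<longrightarrow> (\<Sum>r\<in>G. triple_average \<alpha> f r * indicator (icube \<alpha> r) x) \<le>
       (16 / 3) ^ CARD('n) * (\<Sum>\<beta>\<in>UNIV. \<Sum>i<4 * 16 ^ CARD('n). sparse_operator (P \<beta> i) (\<lambda>y. cmod (f y)) x)"
    proof (intro allI impI)
    fix f :: "real^'n \<Rightarrow> complex" and x :: "real^'n"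
    assume f: "integrable lebesgue f"
    define a where "a Q = average (\<lambda>y. cmod (f y)) Q" for Q
    have a0: "0 \<le> a Q" for Q unfolding a_def by (rule average_nonneg) simp
    \<comment> \<open>Merging cubes with a common image causes no multiplicity: they have the same
      scale and are disjoint, so at a fixed \<open>x\<close> at most one of them
      contributes.\<close>
    have key: "(\<Sum>r\<in>{r\<in>G. fst (b r) = \<beta>}. a (R r) * indicator (icube \<alpha> r) x) \<le> (\<Sum>Q\<in>S \<beta>. a Q * indicator Q x)" for \<beta>
    proof -
      define H where "H = {r\<in>G. fst (b r) = \<beta> \<and> x \<in> icube \<alpha> r}"
      have inj: "inj_on R H"
      proof (rule inj_onI)
        fix r s assume rs: "r \<in> H" "s \<in> H" "R r = R s"
        then have "fst r + 4 = fst s + 4" unfolding R_def by (intro cube_eq_scale) (auto simp: cube_def)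
        then show "r = s" using rs by (auto simp: H_def mem_cube prod_eq_iff)
      qed
      have "(\<Sum>r\<in>{r\<in>G. fst (b r) = \<beta>}. a (R r) * indicator (icube \<alpha> r) x) = (\<Sum>r\<in>H. a (R r) * indicator (icube \<alpha> r) x)"
        using G by (intro sum.mono_neutral_right) (auto simp: H_def)
      also have "\<dots> = (\<Sum>r\<in>H. a (R r) * indicator (R r) x)"
        using sub by (intro sum.cong refl) (auto simp: H_def indicator_def)
      also have "\<dots> = (\<Sum>Q\<in>R ` H. a Q * indicator Q x)" using inj by (simp add: sum.reindex)
      also have "\<dots> \<le> (\<Sum>Q\<in>S \<beta>. a Q * indicator Q x)"
        using Sfin a0 by (intro sum_mono2) (auto simp: H_def S_def)
      finally show ?thesis .
    qed
    have "(\<Sum>r\<in>G. triple_average \<alpha> f r * indicator (icube \<alpha> r) x) \<le> (\<Sum>r\<in>G. (16 / 3) ^ CARD('n) * a (R r) * indicator (icube \<alpha> r) x)"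
      using triple_average_le_average[OF f b] by (intro sum_mono mult_right_mono) (auto simp: a_def R_def)
    also have "\<dots> = (16 / 3) ^ CARD('n) * (\<Sum>r\<in>G. a (R r) * indicator (icube \<alpha> r) x)"
      by (simp only: sum_distrib_left mult.assoc)
    also have "(\<Sum>r\<in>G. a (R r) * indicator (icube \<alpha> r) x) = (\<Sum>\<beta>\<in>UNIV. \<Sum>r\<in>{r\<in>G. fst (b r) = \<beta>}. a (R r) * indicator (icube \<alpha> r) x)"
      using G by (intro sum.group[symmetric]) auto
    also have "(16 / 3) ^ CARD('n) * \<dots> \<le> (16 / 3) ^ CARD('n) * (\<Sum>\<beta>\<in>UNIV. \<Sum>Q\<in>S \<beta>. a Q * indicator Q x)"
      by (intro mult_left_mono sum_mono key) auto
    also have "(\<Sum>\<beta>\<in>UNIV. \<Sum>Q\<in>S \<beta>. a Q * indicator Q x) = (\<Sum>\<beta>\<in>UNIV. \<Sum>i<N. sparse_operator (P \<beta> i) (\<lambda>y. cmod (f y)) x)"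
    proof (intro sum.cong refl)
      fix \<beta>
      have "(\<Sum>Q\<in>S \<beta>. a Q * indicator Q x) = (\<Sum>i<N. \<Sum>Q\<in>P \<beta> i. a Q * indicator Q x)"
        unfolding P(1) using Pfin P(2)[of \<beta>] by (intro sum.UNION_disjoint) (auto simp: disjoint_family_on_def)
      also have "\<dots> = (\<Sum>i<N. sparse_operator (P \<beta> i) (\<lambda>y. cmod (f y)) x)"
        using Pfin by (intro sum.cong refl) (auto simp: sparse_operator_finite a_def)
      finally show "(\<Sum>Q\<in>S \<beta>. a Q * indicator Q x) = (\<Sum>i<N. sparse_operator (P \<beta> i) (\<lambda>y. cmod (f y)) x)" .
    qed
    finally show "(\<Sum>r\<in>G. triple_average \<alpha> f r * indicator (icube \<alpha> r) x) \<le>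
       (16 / 3) ^ CARD('n) * (\<Sum>\<beta>\<in>UNIV. \<Sum>i<4 * 16 ^ CARD('n). sparse_operator (P \<beta> i) (\<lambda>y. cmod (f y)) x)"
      by (simp only: N_def)
    qed
  qed
qed

section \<open>Working forms of the quasi-norm axioms\<close>

lemma quasinorm_mono:
  assumes "function_quasinorm X" "f \<in> borel_measurable lebesgue" "g \<in> borel_measurable lebesgue"
    "AE x in lebesgue. cmod (f x) \<le> cmod (g x)"
  shows "X f \<le> X g"
  using assms unfolding function_quasinorm_def by blast

lemma quasinorm_scale:
  assumes "function_quasinorm X" "f \<in> borel_measurable lebesgue"
  shows "X (\<lambda>x. c * f x) = ennreal (cmod c) * X f"
  using assms unfolding function_quasinorm_def by blast

lemma quasinorm_Fatou:
  fixes F :: "nat \<Rightarrow> real^'n \<Rightarrow> real"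
  assumes X: "function_quasinorm X" and F: "\<And>n. F n \<in> borel_measurable lebesgue" "\<And>n x. 0 \<le> F n x"
    and g: "g \<in> borel_measurable lebesgue" and lim: "AE x in lebesgue. (\<lambda>n. F n x) \<longlonglongrightarrow> g x"
    and B: "\<And>n. X (\<lambda>x. of_real (F n x)) \<le> B"
  shows "X (\<lambda>x. of_real (g x)) \<le> B"
proof -
  have "AE x in lebesgue. ereal (g x) = liminf (\<lambda>n. ereal (F n x))"
    using lim by eventually_elim (auto intro!: lim_imp_Liminf[symmetric])
  then have "X (\<lambda>x. of_real (g x)) \<le> liminf (\<lambda>n. X (\<lambda>x. of_real (F n x)))"
    using X F g unfolding function_quasinorm_def by blast
  also have "\<dots> \<le> liminf (\<lambda>n. B)" using B by (intro Liminf_mono) auto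
  also have "\<dots> = B" by (rule Liminf_const) simp
  finally show ?thesis .
qed

text \<open>Peeling off one summand at a time costs one factor per step. Enlarging the constant to
  at least 1 lets every summand carry the same power.\<close>

lemma quasinorm_sum:
  assumes X: "function_quasinorm X"
  obtains C where "0 < C" "\<And>I F s. finite I \<Longrightarrow> (\<And>i. i \<in> I \<Longrightarrow> F i \<in> borel_measurable lebesgue) \<Longrightarrow>
     (\<And>i. i \<in> I \<Longrightarrow> X (F i) \<le> s) \<Longrightarrow> X (\<lambda>x. \<Sum>i\<in>I. F i x) \<le> ennreal (C ^ card I) * (of_nat (card I) * s)"
proof -
  obtain C0 where C0: "C0 > 0" "\<And>f g. f \<in> borel_measurable lebesgue \<Longrightarrow> g \<in> borel_measurable lebesgue \<Longrightarrow>
        X (\<lambda>x. f x + g x) \<le> ennreal C0 * (X f + X g)"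
    using X unfolding function_quasinorm_def by blast
  define C where "C = max 1 C0"
  have C: "1 \<le> C" "C0 \<le> C" by (auto simp: C_def)
  have "X (\<lambda>x. \<Sum>i\<in>I. F i x) \<le> ennreal (C ^ card I) * (of_nat (card I) * s)"
    if "finite I" "\<And>i. i \<in> I \<Longrightarrow> F i \<in> borel_measurable lebesgue" "\<And>i. i \<in> I \<Longrightarrow> X (F i) \<le> s"
    for I :: "'b set" and F s
    using that
  proof (induction I)
    case empty
    \<comment> \<open>Homogeneity with the factor 0 gives the value 0 at the zero function, since 0
      times infinity is 0 in \<open>ennreal\<close>.\<close>
    have "X (\<lambda>x. 0 * (0::complex)) = ennreal (cmod 0) * X (\<lambda>x. 0)" by (rule quasinorm_scale[OF X]) simp
    then show ?case by simp
  next
    case (insert i I)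
    have IH: "X (\<lambda>x. \<Sum>i\<in>I. F i x) \<le> ennreal (C ^ card I) * (of_nat (card I) * s)"
      using insert by (intro insert.IH) auto
    have "X (\<lambda>x. \<Sum>i\<in>insert i I. F i x) = X (\<lambda>x. F i x + (\<Sum>i\<in>I. F i x))" using insert by simp
    also have "\<dots> \<le> ennreal C0 * (X (F i) + X (\<lambda>x. \<Sum>i\<in>I. F i x))"
      using insert by (intro C0 borel_measurable_sum) auto
    also have "\<dots> \<le> ennreal C * (s + ennreal (C ^ card I) * (of_nat (card I) * s))"
      using insert.prems(2)[of i] IH C by (intro mult_mono add_mono ennreal_leI) auto
    also have "\<dots> \<le> ennreal C * (ennreal (C ^ card I) * s + ennreal (C ^ card I) * (of_nat (card I) * s))"
    proof -
      have "1 * s \<le> ennreal (C ^ card I) * s"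
        using C by (intro mult_right_mono) (auto simp: one_le_power)
      then show ?thesis by (intro mult_left_mono add_right_mono) auto
    qed
    also have "\<dots> = (ennreal C * ennreal (C ^ card I)) * (s + of_nat (card I) * s)"
      by (simp only: distrib_left mult.assoc)
    also have "ennreal C * ennreal (C ^ card I) = ennreal (C ^ card (insert i I))"
      using insert C by (subst ennreal_mult'[symmetric]) auto
    also have "s + of_nat (card I) * s = of_nat (card (insert i I)) * s"
      using insert by (simp add: distrib_right)
    finally show ?case .
  qed
  then show thesis using that[of C] C by force
qed

definition sparse_sup :: "((real^'n \<Rightarrow> complex) \<Rightarrow> ennreal) \<Rightarrow> (real^'n \<Rightarrow> complex) \<Rightarrow> ennreal" where
  "sparse_sup X f = (SUP (\<D>, \<S>) \<in> {(\<D>, \<S>). dyadic_grid \<D> \<and> \<S> \<subseteq> \<D> \<and> sparse_collection \<S>}.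
     X (\<lambda>x. of_real (sparse_operator \<S> (\<lambda>y. cmod (f y)) x)))"

lemma quasinorm_le_sparse_sup:
  assumes "S \<subseteq> grid \<beta>" "sparse_collection S"
  shows "X (\<lambda>x. of_real (sparse_operator S (\<lambda>y. cmod (f y)) x)) \<le> sparse_sup X f"
  unfolding sparse_sup_def
  by (rule SUP_upper2[of "(grid \<beta>, S)"]) (use assms dyadic_grid_grid in auto)

text \<open>With all coordinates shifted, the origin keeps the relative distance one third from the
  nearest faces at every scale, so its cubes exhaust the space. In the unshifted grid the origin is
  a corner at every scale and they would not.\<close>

lemma ball_subset_central_cube:
  fixes x :: "real^'n"
  assumes "norm x < 2 ^ N / 3"
  shows "x \<in> cube (\<lambda>_. True) (int N) (grid_index (\<lambda>_. True) (int N) 0)"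
  unfolding mem_cube
proof
  fix i
  have p: "(0::real) < 2 ^ N" by simp
  have "\<bar>x $ i\<bar> < 2 ^ N / 3" using component_le_norm_cart[of x i] assms by linarith
  then have t: "\<bar>x $ i / 2 ^ N\<bar> < 1 / 3" using p by (simp add: field_simps)
  have s: "(- 2) ^ N / 3 / 2 ^ N = (if even N then 1 / 3 else - (1 / 3 :: real))"
    by (auto simp: power_minus')
  have "\<lfloor>(z - (- 2) ^ N / 3) / 2 ^ N\<rfloor> = (if even N then - 1 else 0)" if "\<bar>z / 2 ^ N\<bar> < 1 / 3" for z :: real
  proof -
    define t where "t = z / 2 ^ N"
    have "\<bar>t\<bar> < 1 / 3" using that by (simp add: t_def)
    then have "\<lfloor>t - 1 / 3\<rfloor> = - 1" "\<lfloor>t + 1 / 3\<rfloor> = 0" by linarith+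
    then show ?thesis unfolding diff_divide_distrib s t_def[symmetric] by simp
  qed
  from this[OF t] this[of 0] show "grid_index (\<lambda>_. True) (int N) x i = grid_index (\<lambda>_. True) (int N) 0 i"
    by (simp add: grid_index_def shift_def)
qed

text \<open>The right side is formed with a majorant \<open>g\<close> in place of \<open>f\<close>,
  using that sparse sums increase with the function. In the later approximation of an integrable
  function it therefore stays the same along the whole sequence.\<close>

lemma (in cz_data) quasinorm_bcs_le_sparse_sup:
  assumes X: "function_quasinorm X"
  obtains C where "0 < C" "\<And>f g. f \<in> bcs \<Longrightarrow> integrable lebesgue g \<Longrightarrow>
    (\<And>x. cmod (f x) \<le> cmod (g x)) \<Longrightarrow> X (T f) \<le> ennreal C * sparse_sup X g"
proof -
  obtain A where A: "0 < A" and dom: "\<And>f \<alpha> p. f \<in> bcs \<Longrightarrow>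
    \<exists>F E. (\<forall>r\<in>F. E r \<in> sets lebesgue \<and> E r \<subseteq> icube \<alpha> r \<and>
        measure lebesgue (icube \<alpha> r) / 2 \<le> measure lebesgue (E r)) \<and> disjoint_family_on E F \<and>
      (AE x in lebesgue. x \<in> icube \<alpha> p \<longrightarrow> (\<exists>G. finite G \<and> G \<subseteq> F \<and>
         cmod (T (cut (itriple \<alpha> p) f) x) \<le> A * (\<Sum>r\<in>G. triple_average \<alpha> f r * indicator (icube \<alpha> r) x)))"
    using sparse_domination by blast
  \<comment> \<open>One index for each shift pattern and residue class. The cardinality depends only
    on the dimension, which keeps the power in \<open>quasinorm_sum\<close> under control.\<close>
  define I where "I = (UNIV :: ('n \<Rightarrow> bool) set) \<times> {..<4 * 16 ^ CARD('n) :: nat}"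
  have Ifin: "finite I" by (simp add: I_def)
  have I0: "card I \<noteq> 0" by (simp add: I_def)
  obtain C0 where C0: "0 < C0" "\<And>F s. (\<And>i. i \<in> I \<Longrightarrow> F i \<in> borel_measurable lebesgue) \<Longrightarrow>
     (\<And>i. i \<in> I \<Longrightarrow> X (F i) \<le> s) \<Longrightarrow> X (\<lambda>x. \<Sum>i\<in>I. F i x) \<le> ennreal (C0 ^ card I) * (of_nat (card I) * s)"
    by (rule quasinorm_sum[OF X, where ?'b = "('n \<Rightarrow> bool) \<times> nat"]) (use Ifin in blast)
  define c where "c = A * (16 / 3) ^ CARD('n)"
  have c0: "0 < c" using A by (simp add: c_def)
  define C where "C = c * (C0 ^ card I * real (card I))"
  have Cpos: "0 < C" using c0 C0(1) I0 by (simp add: C_def)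
  show thesis
  proof (rule that[OF Cpos])
    fix f g :: "real^'n \<Rightarrow> complex"
    assume f: "f \<in> bcs" and g: "integrable lebesgue g" and fg: "\<And>x. cmod (f x) \<le> cmod (g x)"
    have fi: "integrable lebesgue f" using f by (rule bcs_integrable)
    have [measurable]: "T f \<in> borel_measurable lebesgue" using f by (rule T_measurable)
    define s where "s = sparse_sup X g"
    \<comment> \<open>Only finite sparse families are used, so no summability question arises for \<^const>\<open>infsum\<close>.\<close>
    have finite_bound: "X (\<lambda>x. of_real (u x)) \<le> ennreal C * s"
      if u: "u \<in> borel_measurable lebesgue" "\<And>x. 0 \<le> u x"
        "\<And>x. u x \<le> A * (\<Sum>r\<in>G. triple_average \<alpha> f r * indicator (icube \<alpha> r) x)" and G: "finite G"
        and E: "\<And>r. r \<in> G \<Longrightarrow> E r \<in> sets lebesgue \<and> E r \<subseteq> icube \<alpha> r \<and>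
          measure lebesgue (icube \<alpha> r) / 2 \<le> measure lebesgue (E r)" "disjoint_family_on E G"
      for u G E \<alpha>
    proof -
      obtain P :: "('n \<Rightarrow> bool) \<Rightarrow> nat \<Rightarrow> (real^'n) set set" where
        P1: "\<forall>\<beta>. \<forall>i<4 * 16 ^ CARD('n). finite (P \<beta> i) \<and> P \<beta> i \<subseteq> grid \<beta> \<and> sparse_collection (P \<beta> i)" and
        P2: "\<forall>f x. integrable lebesgue f \<longrightarrow> (\<Sum>r\<in>G. triple_average \<alpha> f r * indicator (icube \<alpha> r) x) \<le>
         (16 / 3) ^ CARD('n) * (\<Sum>\<beta>\<in>UNIV. \<Sum>i<4 * 16 ^ CARD('n). sparse_operator (P \<beta> i) (\<lambda>y. cmod (f y)) x)"
        using finite_sparse_families[OF G E(2) E(1)] by blast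
      define Q where "Q b = P (fst b) (snd b)" for b
      have Q: "finite (Q b)" "Q b \<subseteq> grid (fst b)" "sparse_collection (Q b)" if "b \<in> I" for b
        using P1[rule_format, of "snd b" "fst b"] that by (auto simp: Q_def I_def)
      define F where "F b x = sparse_operator (Q b) (\<lambda>y. cmod (f y)) x" for b x
      have Fm: "F b \<in> borel_measurable lebesgue" if "b \<in> I" for b
        using sparse_operator_measurable[OF Q(1,2)[OF that]] by (simp add: F_def[abs_def])
      have F0: "0 \<le> F b x" if "b \<in> I" for b x
        unfolding F_def by (rule sparse_operator_nonneg[OF Q(1)[OF that]]) simp
      have Fs: "X (\<lambda>x. complex_of_real (F b x)) \<le> s" if b: "b \<in> I" for b
      proof -
        have Gm: "sparse_operator (Q b) (\<lambda>y. cmod (g y)) \<in> borel_measurable lebesgue"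
          by (rule sparse_operator_measurable[OF Q(1,2)[OF b]])
        have le: "F b x \<le> sparse_operator (Q b) (\<lambda>y. cmod (g y)) x" for x
          unfolding F_def using fi g fg by (intro sparse_operator_mono[OF Q(1,2)[OF b]]) auto
        have "cmod (of_real (F b x)) \<le> cmod (of_real (sparse_operator (Q b) (\<lambda>y. cmod (g y)) x))" for x
          unfolding norm_of_real using F0[OF b, of x] le[of x] by linarith
        then have "X (\<lambda>x. of_real (F b x)) \<le> X (\<lambda>x. of_real (sparse_operator (Q b) (\<lambda>y. cmod (g y)) x))"
          using Fm[OF b] Gm by (intro quasinorm_mono[OF X]) auto
        also have "\<dots> \<le> s" unfolding s_def by (rule quasinorm_le_sparse_sup[OF Q(2,3)[OF b]])
        finally show ?thesis .
      qed
      define H where "H x = (\<Sum>b\<in>I. complex_of_real (F b x))" for x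
      have Hm: "H \<in> borel_measurable lebesgue" unfolding H_def using Fm by (intro borel_measurable_sum) auto
      have "u x \<le> c * (\<Sum>b\<in>I. F b x)" for x
      proof -
        have "A * (\<Sum>r\<in>G. triple_average \<alpha> f r * indicator (icube \<alpha> r) x) \<le> A * ((16 / 3) ^ CARD('n) * (\<Sum>b\<in>I. F b x))"
          using P2[rule_format, OF fi, of x] A unfolding I_def F_def Q_def by (simp add: sum.cartesian_product case_prod_beta')
        then show ?thesis using u(3)[of x] by (simp add: c_def mult.assoc)
      qed
      moreover have "cmod (of_real c * H x) = c * (\<Sum>b\<in>I. F b x)" for x
      proof -
        have "H x = of_real (\<Sum>b\<in>I. F b x)" by (simp add: H_def)
        moreover have "0 \<le> (\<Sum>b\<in>I. F b x)" using F0 by (intro sum_nonneg)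
        ultimately show ?thesis using c0 by (simp add: norm_mult del: of_real_sum)
      qed
      ultimately have "X (\<lambda>x. of_real (u x)) \<le> X (\<lambda>x. of_real c * H x)"
        using u Hm by (intro quasinorm_mono[OF X]) auto
      also have "\<dots> = ennreal c * X H" using quasinorm_scale[OF X Hm] c0 by simp
      also have "\<dots> \<le> ennreal c * (ennreal (C0 ^ card I) * (of_nat (card I) * s))"
        unfolding H_def using Fm Fs by (intro mult_left_mono C0(2)) auto
      also have "\<dots> = ennreal C * s"
        using c0 C0(1) by (simp add: C_def ennreal_mult ennreal_of_nat_eq_real_of_nat mult.assoc)
      finally show ?thesis .
    qed
    obtain M where M: "M > 0" "\<And>x. M < norm x \<Longrightarrow> f x = 0" using f by (auto simp: bcs_iff)
    define \<alpha> where "\<alpha> = (\<lambda>_::'n. True)"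
    define p where "p N = (int N, grid_index \<alpha> (int N) 0)" for N
    have big: "x \<in> icube \<alpha> (p N)" if "norm x < 2 ^ N / 3" for x N
      using ball_subset_central_cube[OF that] by (simp add: p_def \<alpha>_def)
    obtain N0 where N0: "3 * M < 2 ^ N0" using real_arch_pow[of 2 "3 * M"] by auto
    have cutp: "cut (itriple \<alpha> (p N)) f = f" if "N0 \<le> N" for N
    proof
      fix x :: "real^'n"
      have "(2::real) ^ N0 \<le> 2 ^ N" using that by (intro power_increasing) auto
      then have "norm x < 2 ^ N / 3" if "norm x \<le> M"
        using that N0 by linarith
      then have "x \<in> itriple \<alpha> (p N)" if "norm x \<le> M"
        using big that cube_triple_cube by blast
      then show "cut (itriple \<alpha> (p N)) f x = f x" using M(2)[of x] by (cases "norm x \<le> M") auto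
    qed
    have local: "X (\<lambda>x. of_real (indicator (icube \<alpha> (p N)) x * cmod (T f x))) \<le> ennreal C * s" if N: "N0 \<le> N" for N
    proof -
      obtain F E where "\<forall>r\<in>F. E r \<in> sets lebesgue \<and> E r \<subseteq> icube \<alpha> r \<and>
          measure lebesgue (icube \<alpha> r) / 2 \<le> measure lebesgue (E r)" and F2: "disjoint_family_on E F"
        and F3: "AE x in lebesgue. x \<in> icube \<alpha> (p N) \<longrightarrow> (\<exists>G. finite G \<and> G \<subseteq> F \<and>
           cmod (T f x) \<le> A * (\<Sum>r\<in>G. triple_average \<alpha> f r * indicator (icube \<alpha> r) x))"
        using dom[OF f, of \<alpha> "p N"] unfolding cutp[OF N] by (elim exE conjE) (rule that)
      note F = this(1)[rule_format] F2 F3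
      define Fm where "Fm m = {r\<in>F. to_nat r < m}" for m
      have Fm: "finite (Fm m)" "Fm m \<subseteq> F" for m
      proof -
        show "finite (Fm m)" by (rule inj_on_finite[where f = to_nat and B = "{..<m}"]) (auto simp: Fm_def inj_on_def)
      qed (auto simp: Fm_def)
      \<comment> \<open>The minimum is dominated by a finite sparse sum and yet converges to the
        localised modulus of \<open>T f\<close>, as the Fatou property requires.\<close>
      define u where "u m x = min (indicator (icube \<alpha> (p N)) x * cmod (T f x))
        (A * (\<Sum>r\<in>Fm m. triple_average \<alpha> f r * indicator (icube \<alpha> r) x))" for m x
      have um [measurable]: "u m \<in> borel_measurable lebesgue" for m unfolding u_def by measurable
      have u0: "0 \<le> u m x" for m x
        unfolding u_def using A triple_average_nonneg by (auto intro!: mult_nonneg_nonneg sum_nonneg)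
      show ?thesis
      proof (rule quasinorm_Fatou[OF X um u0])
        show "(\<lambda>x. indicator (icube \<alpha> (p N)) x * cmod (T f x)) \<in> borel_measurable lebesgue" by measurable
        show "X (\<lambda>x. of_real (u m x)) \<le> ennreal C * s" for m
        proof (rule finite_bound[OF um u0, where G = "Fm m" and E = E and \<alpha> = \<alpha>])
          show "u m x \<le> A * (\<Sum>r\<in>Fm m. triple_average \<alpha> f r * indicator (icube \<alpha> r) x)" for x by (simp add: u_def)
          show "E r \<in> sets lebesgue \<and> E r \<subseteq> icube \<alpha> r \<and> measure lebesgue (icube \<alpha> r) / 2 \<le> measure lebesgue (E r)"
            if "r \<in> Fm m" for r using that Fm(2) by (intro F(1)) blast
        qed (rule Fm disjoint_family_on_mono[OF Fm(2) F(2)])+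
        show "AE x in lebesgue. (\<lambda>m. u m x) \<longlonglongrightarrow> indicator (icube \<alpha> (p N)) x * cmod (T f x)"
          using F(3)
        proof eventually_elim
          case (elim x)
          show ?case
          proof (cases "x \<in> icube \<alpha> (p N)")
            case False
            then have "u m x = 0" for m unfolding u_def using A triple_average_nonneg
              by (auto intro!: min_absorb1 mult_nonneg_nonneg sum_nonneg)
            then show ?thesis using False by simp
          next
            case True
            then obtain G where G: "finite G" "G \<subseteq> F" "cmod (T f x) \<le> A * (\<Sum>r\<in>G. triple_average \<alpha> f r * indicator (icube \<alpha> r) x)"
              using elim by blast
            \<comment> \<open>The finite set \<open>G\<close> depends on \<open>x\<close>, but it is
              contained in all sufficiently late \<open>Fm m\<close>. From then on the minimum
              equals the modulus, so the convergence is eventual equality.\<close>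
            define m0 where "m0 = Suc (Max (insert 0 (to_nat ` G)))"
            have sub: "G \<subseteq> Fm m" if "m0 \<le> m" for m
            proof
              fix r assume r: "r \<in> G"
              have "to_nat r \<le> Max (insert 0 (to_nat ` G))" using G(1) r by (intro Max_ge) auto
              then show "r \<in> Fm m" using that r G(2) by (auto simp: Fm_def m0_def)
            qed
            have "u m x = cmod (T f x)" if "m0 \<le> m" for m
            proof -
              have "(\<Sum>r\<in>G. triple_average \<alpha> f r * indicator (icube \<alpha> r) x) \<le> (\<Sum>r\<in>Fm m. triple_average \<alpha> f r * indicator (icube \<alpha> r) x)"
                using sub[OF that] Fm(1) by (intro sum_mono2) (simp_all add: triple_average_nonneg)
              then have "cmod (T f x) \<le> A * (\<Sum>r\<in>Fm m. triple_average \<alpha> f r * indicator (icube \<alpha> r) x)"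
                using G(3) A by (meson mult_left_mono less_imp_le order_trans)
              then show ?thesis using True by (simp add: u_def min_absorb1)
            qed
            then have "(\<lambda>m. u m x) \<longlonglongrightarrow> cmod (T f x)"
              by (intro tendsto_eventually) (auto simp: eventually_sequentially)
            then show ?thesis using True by simp
          qed
        qed
      qed
    qed
    have local': "X (\<lambda>x. of_real (indicator (icube \<alpha> (p (N0 + n))) x * cmod (T f x))) \<le> ennreal C * s" for n
      by (rule local) simp
    have "X (\<lambda>x. of_real (cmod (T f x))) \<le> ennreal C * s"
    proof (rule quasinorm_Fatou[OF X _ _ _ _ local'])
      show "(\<lambda>x. indicator (icube \<alpha> (p (N0 + n))) x * cmod (T f x)) \<in> borel_measurable lebesgue" for n by measurable
      show "0 \<le> indicator (icube \<alpha> (p (N0 + n))) x * cmod (T f x)" for n x by simp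
      show "(\<lambda>x. cmod (T f x)) \<in> borel_measurable lebesgue" by measurable
      show "AE x in lebesgue. (\<lambda>n. indicator (icube \<alpha> (p (N0 + n))) x * cmod (T f x)) \<longlonglongrightarrow> cmod (T f x)"
      proof (rule always_eventually, rule allI, rule tendsto_eventually)
        fix x :: "real^'n"
        obtain m where m: "3 * norm x < 2 ^ m" using real_arch_pow[of 2 "3 * norm x"] by auto
        have "x \<in> icube \<alpha> (p (N0 + n))" if "m \<le> n" for n
        proof -
          have "(2::real) ^ m \<le> 2 ^ (N0 + n)" using that by (intro power_increasing) auto
          then show ?thesis using m by (intro big) linarith
        qed
        then show "\<forall>\<^sub>F n in sequentially. indicator (icube \<alpha> (p (N0 + n))) x * cmod (T f x) = cmod (T f x)"
          unfolding eventually_sequentially by (intro exI[of _ m]) simp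
      qed
    qed
    moreover have "X (T f) \<le> X (\<lambda>x. of_real (cmod (T f x)))"
      by (rule quasinorm_mono[OF X]) auto
    ultimately show "X (T f) \<le> ennreal C * sparse_sup X g" unfolding s_def by (rule order_trans[rotated])
  qed
qed

section \<open>Extension to integrable functions\<close>

text \<open>Truncating both the values and the domain keeps the approximants pointwise below
  \<open>f\<close> in modulus. The comparison of sparse sums needs this domination in addition to
  convergence in mean.\<close>

lemma bcs_dense_L1:
  fixes f :: "real^'n \<Rightarrow> complex"
  assumes f: "integrable lebesgue f"
  obtains F where "\<And>n. F n \<in> bcs" "\<And>n x. cmod (F n x) \<le> cmod (f x)"
    "(\<lambda>n. LINT x|lebesgue. cmod (F n x - f x)) \<longlonglongrightarrow> 0"
proof -
  have [measurable]: "f \<in> borel_measurable lebesgue" using f by auto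
  define S where "S n = {x. cmod (f x) \<le> real n \<and> norm x \<le> real n}" for n
  have Ss [measurable]: "S n \<in> sets lebesgue" for n
  proof -
    have "{x \<in> space lebesgue. cmod (f x) \<le> real n} \<in> sets lebesgue" by measurable
    moreover have "cball 0 (real n) \<in> sets (lebesgue :: (real^'n) measure)" by auto
    moreover have "S n = {x \<in> space lebesgue. cmod (f x) \<le> real n} \<inter> cball 0 (real n)" by (auto simp: S_def)
    ultimately show ?thesis by (simp only: sets.Int)
  qed
  show thesis
  proof (rule that[of "\<lambda>n. cut (S n) f"])
    show "cut (S n) f \<in> bcs" for n
      unfolding bcs_iff
    proof (intro conjI exI[of _ "real n + 1"] allI impI)
      show "cut (S n) f \<in> borel_measurable lebesgue" by measurable
    qed (auto simp: S_def indicator_def)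
    show "cmod (cut (S n) f x) \<le> cmod (f x)" for n x by (simp add: indicator_def)
    have "(\<lambda>n. LINT x|lebesgue. cmod (cut (S n) f x - f x)) \<longlonglongrightarrow> (LINT x|(lebesgue :: (real^'n) measure). 0::real)"
    proof (rule integral_dominated_convergence[where w = "\<lambda>x. cmod (f x)"])
      show "AE x in lebesgue. (\<lambda>n. cmod (cut (S n) f x - f x)) \<longlonglongrightarrow> 0"
      proof (rule always_eventually, rule allI, rule tendsto_eventually)
        fix x
        obtain m where "max (cmod (f x)) (norm x) < real m" using reals_Archimedean2 by blast
        then show "\<forall>\<^sub>F n in sequentially. cmod (cut (S n) f x - f x) = 0"
          unfolding eventually_sequentially by (intro exI[of _ m]) (auto simp: S_def)
      qed
    qed (use f in \<open>auto simp: indicator_def\<close>)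
    then show "(\<lambda>n. LINT x|lebesgue. cmod (cut (S n) f x - f x)) \<longlonglongrightarrow> 0" by simp
  qed
qed

section \<open>Convergence in measure and the extension by density\<close>

lemma geometric_increments:
  fixes a :: "nat \<Rightarrow> complex"
  assumes a: "\<And>k. j \<le> k \<Longrightarrow> cmod (a (Suc k) - a k) \<le> (1 / 2) ^ k"
  shows "convergent a" "a \<longlonglongrightarrow> L \<Longrightarrow> cmod (a j - L) \<le> 2 * (1 / 2) ^ j"
proof -
  have bound: "cmod (a (m + n) - a m) \<le> 2 * (1 / 2) ^ m * (1 - (1 / 2) ^ n)" if "j \<le> m" for m n
  proof (induction n)
    case (Suc n)
    have "cmod (a (m + Suc n) - a m) \<le> cmod (a (Suc (m + n)) - a (m + n)) + cmod (a (m + n) - a m)"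
      using norm_triangle_ineq[of "a (Suc (m + n)) - a (m + n)" "a (m + n) - a m"] by simp
    also have "\<dots> \<le> (1 / 2) ^ (m + n) + 2 * (1 / 2) ^ m * (1 - (1 / 2) ^ n)"
      using a[of "m + n"] Suc.IH that by (intro add_mono) auto
    also have "\<dots> = 2 * (1 / 2) ^ m * (1 - (1 / 2) ^ Suc n)" by (simp add: power_add algebra_simps)
    finally show ?case .
  qed simp
  have bound2: "cmod (a (m + n) - a m) \<le> 2 * (1 / 2) ^ m" if "j \<le> m" for m n
  proof -
    have "2 * (1 / 2) ^ m * (1 - (1 / 2) ^ n) \<le> 2 * (1 / 2 :: real) ^ m * 1" by (intro mult_left_mono) auto
    then show ?thesis using bound[OF that, of n] by linarith
  qed
  have "Cauchy a"
  proof (rule metric_CauchyI)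
    fix e :: real assume "0 < e"
    then obtain k where k: "(1 / 2 :: real) ^ k < e / 4" using real_arch_pow_inv[of "e / 4" "1 / 2"] by auto
    define M where "M = max j k"
    have Me: "(1 / 2 :: real) ^ M < e / 4"
    proof -
      have "(1 / 2 :: real) ^ M \<le> (1 / 2) ^ k" by (rule power_decreasing) (auto simp: M_def)
      then show ?thesis using k by linarith
    qed
    show "\<exists>M. \<forall>m\<ge>M. \<forall>n\<ge>M. dist (a m) (a n) < e"
    proof (intro exI[of _ M] allI impI)
      fix m n assume "M \<le> m" "M \<le> n"
      then have "cmod (a m - a M) \<le> 2 * (1 / 2) ^ M" "cmod (a n - a M) \<le> 2 * (1 / 2) ^ M"
        using bound2[of M "m - M"] bound2[of M "n - M"] by (auto simp: M_def)
      moreover have "dist (a m) (a n) \<le> cmod (a m - a M) + cmod (a n - a M)"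
        using dist_triangle2[of "a m" "a n" "a M"] by (simp add: dist_norm)
      ultimately show "dist (a m) (a n) < e" using Me by linarith
    qed
  qed
  then show "convergent a" by (rule Cauchy_convergent)
  assume "a \<longlonglongrightarrow> L"
  then have "(\<lambda>n. cmod (a (j + n) - a j)) \<longlonglongrightarrow> cmod (L - a j)"
    by (intro tendsto_intros LIMSEQ_ignore_initial_segment[of a L j, unfolded add.commute[of _ j]])
  then have "cmod (L - a j) \<le> 2 * (1 / 2) ^ j"
    using bound2[of j] by (intro LIMSEQ_le_const2) auto
  then show "cmod (a j - L) \<le> 2 * (1 / 2) ^ j" by (simp add: norm_minus_commute)
qed

lemma superlevel_diff_sets:
  assumes [measurable]: "f \<in> borel_measurable lebesgue" "g \<in> borel_measurable lebesgue"
  shows "{x. t < cmod (f x - g x)} \<in> sets lebesgue"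
  by (rule superlevel_sets) measurable

lemma emeasure_superlevel_diff_triangle:
  assumes "f \<in> borel_measurable lebesgue" "g \<in> borel_measurable lebesgue" "h \<in> borel_measurable lebesgue"
  shows "emeasure lebesgue {x. s + t < cmod (f x - h x)}
    \<le> emeasure lebesgue {x. s < cmod (f x - g x)} + emeasure lebesgue {x. t < cmod (g x - h x)}"
proof -
  have "{x. s + t < cmod (f x - h x)} \<subseteq> {x. s < cmod (f x - g x)} \<union> {x. t < cmod (g x - h x)}"
  proof
    fix x assume "x \<in> {x. s + t < cmod (f x - h x)}"
    moreover have "cmod (f x - h x) \<le> cmod (f x - g x) + cmod (g x - h x)"
      using norm_triangle_ineq[of "f x - g x" "g x - h x"] by simp
    ultimately show "x \<in> {x. s < cmod (f x - g x)} \<union> {x. t < cmod (g x - h x)}" by auto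
  qed
  then have "emeasure lebesgue {x. s + t < cmod (f x - h x)} \<le> emeasure lebesgue ({x. s < cmod (f x - g x)} \<union> {x. t < cmod (g x - h x)})"
    using assms by (intro emeasure_mono) (auto intro: superlevel_diff_sets)
  also have "\<dots> \<le> emeasure lebesgue {x. s < cmod (f x - g x)} + emeasure lebesgue {x. t < cmod (g x - h x)}"
    using assms by (intro emeasure_subadditive superlevel_diff_sets)
  finally show ?thesis .
qed

text \<open>This makes the choice in \<open>L1_extension\<close> harmless: two admissible limits
  agree almost everywhere.\<close>

lemma converges_in_measure_unique:
  assumes u: "\<And>n. u n \<in> borel_measurable lebesgue" and g: "g \<in> borel_measurable lebesgue" "g' \<in> borel_measurable lebesgue"
    and lim: "converges_in_measure u g" "converges_in_measure u g'"
  shows "AE x in lebesgue. g x = g' x"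
proof -
  have null: "{x. \<epsilon> < cmod (g x - g' x)} \<in> null_sets lebesgue" if "0 < \<epsilon>" for \<epsilon>
  proof -
    have e: "0 < \<epsilon> / 2" using that by simp
    have "(\<lambda>n. emeasure lebesgue {x. \<epsilon> / 2 < cmod (u n x - g x)} + emeasure lebesgue {x. \<epsilon> / 2 < cmod (u n x - g' x)}) \<longlonglongrightarrow> 0 + 0"
      using lim e unfolding converges_in_measure_def by (intro tendsto_add) blast+
    then have "emeasure lebesgue {x. \<epsilon> < cmod (g x - g' x)} \<le> 0 + 0"
    proof (rule LIMSEQ_le_const, intro exI[of _ 0] allI impI)
      fix n
      show "emeasure lebesgue {x. \<epsilon> < cmod (g x - g' x)} \<le>
        emeasure lebesgue {x. \<epsilon> / 2 < cmod (u n x - g x)} + emeasure lebesgue {x. \<epsilon> / 2 < cmod (u n x - g' x)}"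
        using emeasure_superlevel_diff_triangle[OF g(1) u g(2), of "\<epsilon> / 2" "\<epsilon> / 2" n] by (simp add: norm_minus_commute)
    qed
    then show ?thesis using superlevel_diff_sets[OF g] by (simp add: null_sets_def)
  qed
  have "AE x in lebesgue. \<forall>n. x \<notin> {x. 1 / real (Suc n) < cmod (g x - g' x)}"
    unfolding AE_all_countable by (intro allI AE_not_in null) simp
  then show ?thesis
  proof eventually_elim
    case (elim x)
    show ?case
    proof (rule ccontr)
      assume "g x \<noteq> g' x"
      then have "0 < cmod (g x - g' x)" by simp
      then obtain n where "1 / real (Suc n) < cmod (g x - g' x)" by (rule nat_approx_posE)
      then show False using elim by blast
    qed
  qed
qed

context cz_data
begin

lemma weak_type_diff:
  obtains W where "0 < W" "\<And>f g t. f \<in> bcs \<Longrightarrow> g \<in> bcs \<Longrightarrow> 0 < t \<Longrightarrow>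
    emeasure lebesgue {x. t < cmod (T f x - T g x)} \<le> ennreal (W * (LINT x|lebesgue. cmod (f x - g x)) / t)"
proof -
  obtain W where W: "0 < W" "\<And>f t. f \<in> bcs \<Longrightarrow> 0 < t \<Longrightarrow>
    emeasure lebesgue {x. t < cmod (T f x)} \<le> ennreal (W * (LINT x|lebesgue. cmod (f x)) / t)"
    using weak_type by blast
  show thesis
  proof (rule that[OF W(1)])
    fix f g :: "real^'n \<Rightarrow> complex" and t :: real
    assume f: "f \<in> bcs" and g: "g \<in> bcs" and t: "0 < t"
    have "emeasure lebesgue {x. t < cmod (T f x - T g x)} = emeasure lebesgue {x. t < cmod (T (\<lambda>y. f y - g y) x)}"
    proof (rule emeasure_eq_AE)
      show "AE x in lebesgue. (x \<in> {x. t < cmod (T f x - T g x)}) = (x \<in> {x. t < cmod (T (\<lambda>y. f y - g y) x)})"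
        using T_diff[OF f g] by eventually_elim simp
    qed (intro superlevel_diff_sets T_measurable T_superlevel_sets bcs_diff f g)+
    also have "\<dots> \<le> ennreal (W * (LINT x|lebesgue. cmod (f x - g x)) / t)"
      by (rule W(2)[OF bcs_diff[OF f g] t])
    finally show "emeasure lebesgue {x. t < cmod (T f x - T g x)} \<le> ennreal (W * (LINT x|lebesgue. cmod (f x - g x)) / t)" .
  qed
qed

text \<open>The weak type bound turns convergence in mean into the Cauchy property in measure. A
  fast subsequence of truncations converges almost everywhere by Borel-Cantelli, and its limit
  serves for every approximating sequence. Thus the choice in \<open>L1_extension\<close> has a
  witness, and an almost everywhere convergent sequence is available for the Fatou property.\<close>

lemma L1_extension_limit:
  assumes f: "integrable lebesgue f"
  obtains H g where "\<And>j. H j \<in> bcs" "\<And>j x. cmod (H j x) \<le> cmod (f x)"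
    "g \<in> borel_measurable lebesgue" "AE x in lebesgue. (\<lambda>j. T (H j) x) \<longlonglongrightarrow> g x"
    "(\<lambda>j. LINT x|lebesgue. cmod (H j x - f x)) \<longlonglongrightarrow> 0"
    "\<And>F. (\<And>n. F n \<in> bcs) \<Longrightarrow> (\<lambda>n. LINT x|lebesgue. cmod (F n x - f x)) \<longlonglongrightarrow> 0 \<Longrightarrow>
      converges_in_measure (\<lambda>n. T (F n)) g"
proof -
  obtain W where W: "0 < W" "\<And>f g t. f \<in> bcs \<Longrightarrow> g \<in> bcs \<Longrightarrow> 0 < t \<Longrightarrow>
    emeasure lebesgue {x. t < cmod (T f x - T g x)} \<le> ennreal (W * (LINT x|lebesgue. cmod (f x - g x)) / t)"
    using weak_type_diff by blast
  obtain F0 where F0: "\<And>n. F0 n \<in> bcs" "\<And>n x. cmod (F0 n x) \<le> cmod (f x)"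
    "(\<lambda>n. LINT x|lebesgue. cmod (F0 n x - f x)) \<longlonglongrightarrow> 0"
    using bcs_dense_L1[OF f] by blast
  \<comment> \<open>The rate \<open>(1 / 4) ^ j\<close> is the square of the height
    \<open>(1 / 2) ^ j\<close> used for \<open>A j\<close>; after division by the height the
    exceptional sets still have summable measure.\<close>
  have "\<exists>n. (LINT x|lebesgue. cmod (F0 n x - f x)) \<le> (1 / 4) ^ j" for j
  proof -
    have "eventually (\<lambda>n. (LINT x|lebesgue. cmod (F0 n x - f x)) < (1 / 4) ^ j) sequentially"
      using F0(3) by (intro order_tendstoD(2)) auto
    then show ?thesis by (auto simp: eventually_sequentially intro: less_imp_le)
  qed
  then obtain k where k: "\<And>j. (LINT x|lebesgue. cmod (F0 (k j) x - f x)) \<le> (1 / 4) ^ j" by metis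
  define H where "H j = F0 (k j)" for j
  have H: "H j \<in> bcs" for j using F0(1) by (simp add: H_def)
  have Hf: "(LINT x|lebesgue. cmod (H j x - f x)) \<le> (1 / 4) ^ j" for j using k by (simp add: H_def)
  have Hlim: "(\<lambda>j. LINT x|lebesgue. cmod (H j x - f x)) \<longlonglongrightarrow> 0"
  proof (rule tendsto_sandwich[OF _ _ tendsto_const])
    show "(\<lambda>j. (1 / 4 :: real) ^ j) \<longlonglongrightarrow> 0" by (rule LIMSEQ_power_zero) simp
  qed (use Hf in auto)
  have L1_tri: "(LINT x|lebesgue. cmod (u x - v x)) \<le> (LINT x|lebesgue. cmod (u x - f x)) + (LINT x|lebesgue. cmod (v x - f x))"
    if "integrable lebesgue u" "integrable lebesgue v" for u v
  proof -
    have "(LINT x|lebesgue. cmod (u x - v x)) \<le> (LINT x|lebesgue. cmod (u x - f x) + cmod (v x - f x))"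
    proof (rule integral_mono)
      show "cmod (u x - v x) \<le> cmod (u x - f x) + cmod (v x - f x)" for x
        using norm_triangle_ineq4[of "u x - f x" "v x - f x"] by simp
    qed (use that f in auto)
    also have "\<dots> = (LINT x|lebesgue. cmod (u x - f x)) + (LINT x|lebesgue. cmod (v x - f x))"
      using that f by (intro Bochner_Integration.integral_add) auto
    finally show ?thesis .
  qed
  have Tm: "T (H j) \<in> borel_measurable lebesgue" for j by (rule T_measurable[OF H])
  define A where "A j = {x. (1 / 2) ^ j < cmod (T (H (Suc j)) x - T (H j) x)}" for j
  have As: "A j \<in> sets lebesgue" for j unfolding A_def by (intro superlevel_diff_sets Tm)
  have Am: "emeasure lebesgue (A j) \<le> ennreal (2 * W * (1 / 2) ^ j)" for j
  proof -
    have "(LINT x|lebesgue. cmod (H (Suc j) x - H j x)) \<le> (1 / 4) ^ Suc j + (1 / 4) ^ j"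
      using L1_tri[OF bcs_integrable[OF H] bcs_integrable[OF H], of "Suc j" j] Hf[of j] Hf[of "Suc j"] by linarith
    also have "\<dots> \<le> 2 * (1 / 4) ^ j" by simp
    finally have le: "(LINT x|lebesgue. cmod (H (Suc j) x - H j x)) \<le> 2 * (1 / 4) ^ j" .
    have "emeasure lebesgue (A j) \<le> ennreal (W * (LINT x|lebesgue. cmod (H (Suc j) x - H j x)) / (1 / 2) ^ j)"
      unfolding A_def by (intro W(2) H) auto
    also have "\<dots> \<le> ennreal (W * (2 * (1 / 4) ^ j) / (1 / 2) ^ j)"
      using W(1) le by (intro ennreal_leI divide_right_mono mult_left_mono) auto
    also have "W * (2 * (1 / 4) ^ j) / (1 / 2) ^ j = 2 * W * ((1 / 4) ^ j / (1 / 2) ^ j)" by simp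
    also have "(1 / 4 :: real) ^ j / (1 / 2) ^ j = (1 / 2) ^ j" by (simp add: power_divide[symmetric])
    finally show ?thesis .
  qed
  \<comment> \<open>Where the sequence diverges \<open>lim\<close> has no prescribed value; that set
    turns out to be null.\<close>
  define g where "g x = lim (\<lambda>j. T (H j) x)" for x
  have gm: "g \<in> borel_measurable lebesgue" unfolding g_def using Tm by (rule borel_measurable_lim_metric)
  have g_lim: "(\<lambda>j. T (H j) x) \<longlonglongrightarrow> g x \<and> cmod (T (H j) x - g x) \<le> 2 * (1 / 2) ^ j"
    if "\<And>i. j \<le> i \<Longrightarrow> x \<notin> A i" for j x
  proof -
    have a: "cmod (T (H (Suc i)) x - T (H i) x) \<le> (1 / 2) ^ i" if "j \<le> i" for i
      using \<open>\<And>i. j \<le> i \<Longrightarrow> x \<notin> A i\<close>[OF that] by (simp add: A_def not_less)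
    have "convergent (\<lambda>j. T (H j) x)" by (rule geometric_increments(1)[of j]) (rule a)
    then have l: "(\<lambda>j. T (H j) x) \<longlonglongrightarrow> g x" by (simp add: g_def convergent_LIMSEQ_iff)
    moreover have "cmod (T (H j) x - g x) \<le> 2 * (1 / 2) ^ j"
      by (rule geometric_increments(2)[OF _ l]) (rule a)
    ultimately show ?thesis by simp
  qed
  have tail: "emeasure lebesgue {x. 2 * (1 / 2) ^ j < cmod (T (H j) x - g x)} \<le> ennreal (4 * W * (1 / 2) ^ j)" for j
  proof -
    have "{x. 2 * (1 / 2) ^ j < cmod (T (H j) x - g x)} \<subseteq> (\<Union>i. A (i + j))"
    proof
      fix x assume x: "x \<in> {x. 2 * (1 / 2) ^ j < cmod (T (H j) x - g x)}"
      show "x \<in> (\<Union>i. A (i + j))"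
      proof (rule ccontr)
        assume "x \<notin> (\<Union>i. A (i + j))"
        then have "x \<notin> A i" if "j \<le> i" for i using that by (metis UN_I UNIV_I le_add_diff_inverse2)
        then show False using g_lim[of j x] x by auto
      qed
    qed
    then have "emeasure lebesgue {x. 2 * (1 / 2) ^ j < cmod (T (H j) x - g x)} \<le> emeasure lebesgue (\<Union>i. A (i + j))"
      using As by (intro emeasure_mono) auto
    also have "\<dots> \<le> (\<Sum>i. emeasure lebesgue (A (i + j)))"
      using As by (intro emeasure_subadditive_countably) auto
    also have "\<dots> \<le> (\<Sum>i. ennreal (2 * W * (1 / 2) ^ j * (1 / 2) ^ i))"
    proof (rule suminf_le)
      show "emeasure lebesgue (A (i + j)) \<le> ennreal (2 * W * (1 / 2) ^ j * (1 / 2) ^ i)" for i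
        using Am[of "i + j"] by (simp add: power_add mult_ac)
    qed auto
    also have "\<dots> = ennreal (\<Sum>i. 2 * W * (1 / 2) ^ j * (1 / 2) ^ i)"
      using W(1) by (intro suminf_ennreal2) (auto intro!: summable_mult summable_geometric)
    also have "(\<Sum>i. 2 * W * (1 / 2) ^ j * (1 / 2) ^ i) = 2 * W * (1 / 2) ^ j * (\<Sum>i. (1 / 2) ^ i)"
      by (intro suminf_mult summable_geometric) simp
    also have "(\<Sum>i. (1 / 2 :: real) ^ i) = 2" by (subst suminf_geometric) auto
    finally show ?thesis by (simp add: mult_ac)
  qed
  have AE_lim: "AE x in lebesgue. (\<lambda>j. T (H j) x) \<longlonglongrightarrow> g x"
  proof -
    have "AE x in lebesgue. eventually (\<lambda>j. x \<in> space lebesgue - A j) sequentially"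
    proof (rule borel_cantelli_AE1[OF As])
      show "emeasure lebesgue (A j) < \<infinity>" for j using Am by (rule le_less_trans) simp
      have "measure lebesgue (A j) \<le> 2 * W * (1 / 2) ^ j" for j
        unfolding measure_def using Am W(1) by (intro enn2real_leI) auto
      then have le: "norm (measure lebesgue (A j)) \<le> 2 * W * (1 / 2) ^ j" for j by simp
      have "summable (\<lambda>j. 2 * W * (1 / 2) ^ j)" by (intro summable_mult summable_geometric) simp
      then show "summable (\<lambda>j. measure lebesgue (A j))"
        by (rule summable_comparison_test[rotated]) (use le in blast)
    qed
    then show ?thesis
    proof eventually_elim
      case (elim x)
      then obtain j where "\<And>i. j \<le> i \<Longrightarrow> x \<notin> A i" by (auto simp: eventually_sequentially)
      then show ?case using g_lim[of j x] by blast
    qed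
  qed
  have conv: "converges_in_measure (\<lambda>n. T (F n)) g"
    if F: "\<And>n. F n \<in> bcs" "(\<lambda>n. LINT x|lebesgue. cmod (F n x - f x)) \<longlonglongrightarrow> 0" for F
    unfolding converges_in_measure_def
  proof (intro allI impI)
    fix \<epsilon> :: real assume \<epsilon>: "0 < \<epsilon>"
    define l where "l n = (LINT x|lebesgue. cmod (F n x - f x))" for n
    have l0: "0 \<le> l n" for n by (simp add: l_def)
    \<comment> \<open>The function \<open>F n\<close> is compared with \<open>H j\<close>, and
      \<open>H j\<close> with \<open>g\<close>. Letting \<open>j\<close> grow with \<open>n\<close>
      fixed leaves only the distance \<open>l n\<close> from \<open>F n\<close> to
      \<open>f\<close>.\<close>
    have bound: "emeasure lebesgue {x. \<epsilon> < cmod (T (F n) x - g x)} \<le> ennreal (W * l n / (\<epsilon> / 2))" for n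
    proof (rule LIMSEQ_le_const)
      have "(\<lambda>j. W * (l n + (1 / 4) ^ j) / (\<epsilon> / 2) + 4 * W * (1 / 2) ^ j) \<longlonglongrightarrow> W * (l n + 0) / (\<epsilon> / 2) + 4 * W * 0"
        using \<epsilon> by (intro tendsto_intros LIMSEQ_power_zero) auto
      then show "(\<lambda>j. ennreal (W * (l n + (1 / 4) ^ j) / (\<epsilon> / 2) + 4 * W * (1 / 2) ^ j)) \<longlonglongrightarrow> ennreal (W * l n / (\<epsilon> / 2))"
        by (intro tendsto_ennrealI) simp
      obtain j0 where j0: "(1 / 2 :: real) ^ j0 < \<epsilon> / 4" using real_arch_pow_inv[of "\<epsilon> / 4" "1 / 2"] \<epsilon> by auto
      show "\<exists>N. \<forall>j\<ge>N. emeasure lebesgue {x. \<epsilon> < cmod (T (F n) x - g x)} \<le> ennreal (W * (l n + (1 / 4) ^ j) / (\<epsilon> / 2) + 4 * W * (1 / 2) ^ j)"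
      proof (intro exI[of _ j0] allI impI)
        fix j assume j: "j0 \<le> j"
        have "(1 / 2 :: real) ^ j \<le> (1 / 2) ^ j0" using j by (intro power_decreasing) auto
        then have small: "2 * (1 / 2) ^ j \<le> \<epsilon> / 2" using j0 by linarith
        have "emeasure lebesgue {x. \<epsilon> < cmod (T (F n) x - g x)} \<le>
          emeasure lebesgue {x. \<epsilon> / 2 < cmod (T (F n) x - T (H j) x)} + emeasure lebesgue {x. \<epsilon> / 2 < cmod (T (H j) x - g x)}"
          using emeasure_superlevel_diff_triangle[OF T_measurable[OF F(1)] Tm gm, of "\<epsilon> / 2" "\<epsilon> / 2" n j] by simp
        also have "\<dots> \<le> ennreal (W * (l n + (1 / 4) ^ j) / (\<epsilon> / 2)) + ennreal (4 * W * (1 / 2) ^ j)"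
        proof (rule add_mono)
          have "emeasure lebesgue {x. \<epsilon> / 2 < cmod (T (F n) x - T (H j) x)} \<le> ennreal (W * (LINT x|lebesgue. cmod (F n x - H j x)) / (\<epsilon> / 2))"
            using \<epsilon> by (intro W(2) F H) auto
          also have "\<dots> \<le> ennreal (W * (l n + (1 / 4) ^ j) / (\<epsilon> / 2))"
            using L1_tri[OF bcs_integrable[OF F(1)] bcs_integrable[OF H], of n j] Hf[of j] W(1) \<epsilon>
            by (intro ennreal_leI divide_right_mono mult_left_mono) (auto simp: l_def)
          finally show "emeasure lebesgue {x. \<epsilon> / 2 < cmod (T (F n) x - T (H j) x)} \<le> ennreal (W * (l n + (1 / 4) ^ j) / (\<epsilon> / 2))" .
          have "emeasure lebesgue {x. \<epsilon> / 2 < cmod (T (H j) x - g x)} \<le> emeasure lebesgue {x. 2 * (1 / 2) ^ j < cmod (T (H j) x - g x)}"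
            using small by (intro emeasure_mono superlevel_diff_sets Tm gm) auto
          then show "emeasure lebesgue {x. \<epsilon> / 2 < cmod (T (H j) x - g x)} \<le> ennreal (4 * W * (1 / 2) ^ j)"
            using tail[of j] by (rule order_trans)
        qed
        also have "\<dots> = ennreal (W * (l n + (1 / 4) ^ j) / (\<epsilon> / 2) + 4 * W * (1 / 2) ^ j)"
          using W(1) l0[of n] \<epsilon> by (intro ennreal_plus[symmetric]) auto
        finally show "emeasure lebesgue {x. \<epsilon> < cmod (T (F n) x - g x)} \<le> ennreal (W * (l n + (1 / 4) ^ j) / (\<epsilon> / 2) + 4 * W * (1 / 2) ^ j)" .
      qed
    qed
    show "(\<lambda>n. emeasure lebesgue {x. \<epsilon> < cmod (T (F n) x - g x)}) \<longlonglongrightarrow> 0"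
    proof (rule tendsto_sandwich[OF _ _ tendsto_const])
      have "(\<lambda>n. W * l n / (\<epsilon> / 2)) \<longlonglongrightarrow> W * 0 / (\<epsilon> / 2)"
        using F(2) \<epsilon> unfolding l_def by (intro tendsto_intros) auto
      then show "(\<lambda>n. ennreal (W * l n / (\<epsilon> / 2))) \<longlonglongrightarrow> 0" using tendsto_ennrealI by fastforce
    qed (use bound in auto)
  qed
  show thesis
    by (rule that[OF H _ gm AE_lim Hlim conv]) (auto simp: H_def F0(2))
qed

text \<open>The chosen function and the constructed limit are both limits in measure along
  \<open>H\<close>, hence equal almost everywhere; this transfers the pointwise convergence to
  \<open>L1_extension\<close>.\<close>

lemma L1_extension_approx:
  assumes f: "integrable lebesgue f"
  obtains H where "\<And>j. H j \<in> bcs" "\<And>j x. cmod (H j x) \<le> cmod (f x)"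
    "L1_extension T f \<in> borel_measurable lebesgue" "AE x in lebesgue. (\<lambda>j. T (H j) x) \<longlonglongrightarrow> L1_extension T f x"
proof -
  obtain H g where H: "\<And>j. H j \<in> bcs" "\<And>j x. cmod (H j x) \<le> cmod (f x)"
    and g: "g \<in> borel_measurable lebesgue" "AE x in lebesgue. (\<lambda>j. T (H j) x) \<longlonglongrightarrow> g x"
    and Hlim: "(\<lambda>j. LINT x|lebesgue. cmod (H j x - f x)) \<longlonglongrightarrow> 0"
    and conv: "\<And>F. (\<And>n. F n \<in> bcs) \<Longrightarrow> (\<lambda>n. LINT x|lebesgue. cmod (F n x - f x)) \<longlonglongrightarrow> 0 \<Longrightarrow>
      converges_in_measure (\<lambda>n. T (F n)) g"
    using L1_extension_limit[OF f] by blast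
  define P where "P g \<longleftrightarrow> g \<in> borel_measurable lebesgue \<and>
        (\<forall>F. (\<forall>n. F n \<in> bcs) \<and>
             (\<lambda>n. LINT x|lebesgue. cmod (F n x - f x)) \<longlonglongrightarrow> 0 \<longrightarrow>
             converges_in_measure (\<lambda>n. T (F n)) g)" for g
  have "P g" unfolding P_def using g(1) conv by blast
  then have "P (SOME g. P g)" by (rule someI[of P])
  then have PL: "P (L1_extension T f)" unfolding L1_extension_def P_def .
  then have m: "L1_extension T f \<in> borel_measurable lebesgue" by (simp add: P_def)
  have "converges_in_measure (\<lambda>n. T (H n)) (L1_extension T f)" using PL H(1) Hlim by (simp add: P_def)
  then have "AE x in lebesgue. g x = L1_extension T f x"
    using T_measurable[OF H(1)] g(1) m conv[OF H(1) Hlim] by (intro converges_in_measure_unique)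
  with g(2) have "AE x in lebesgue. (\<lambda>j. T (H j) x) \<longlonglongrightarrow> L1_extension T f x" by eventually_elim simp
  then show thesis using H m by (intro that)
qed

end

theorem corollaryA2:
  fixes X :: "(real^'n \<Rightarrow> complex) \<Rightarrow> ennreal"
    and T :: "(real^'n \<Rightarrow> complex) \<Rightarrow> real^'n \<Rightarrow> complex"
    and \<omega> :: "real \<Rightarrow> real"
  assumes "function_quasinorm X"
    and "CZ_operator \<omega> T"
    and "log_Dini \<omega>"
  shows "\<exists>C>0. \<forall>f. integrable lebesgue f \<longrightarrow>
           X (L1_extension T f) \<le>
             ennreal C * (SUP (\<D>, \<S>) \<in> {(\<D>, \<S>). dyadic_grid \<D> \<and> \<S> \<subseteq> \<D> \<and> sparse_collection \<S>}.
               X (\<lambda>x. of_real (sparse_operator \<S> (\<lambda>y. cmod (f y)) x)))"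
proof -
  note X = assms(1)
  obtain K q B \<rho> where "cz_data T K q B \<rho>" by (rule CZ_operator_cz_data[OF assms(2,3)])
  then interpret cz_data T K q B \<rho> .
  obtain C where C: "0 < C" "\<And>f g. f \<in> bounded_compactly_supported \<Longrightarrow> integrable lebesgue g \<Longrightarrow>
    (\<And>x. cmod (f x) \<le> cmod (g x)) \<Longrightarrow> X (T f) \<le> ennreal C * sparse_sup X g"
    using quasinorm_bcs_le_sparse_sup[OF X] by blast
  have "X (L1_extension T f) \<le> ennreal C * sparse_sup X f" if f: "integrable lebesgue f" for f
  proof -
    obtain H where H: "\<And>j. H j \<in> bounded_compactly_supported" "\<And>j x. cmod (H j x) \<le> cmod (f x)"
      and m: "L1_extension T f \<in> borel_measurable lebesgue"
      and lim: "AE x in lebesgue. (\<lambda>j. T (H j) x) \<longlonglongrightarrow> L1_extension T f x"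
      using L1_extension_approx[OF f] by blast
    have [measurable]: "T (H j) \<in> borel_measurable lebesgue" for j by (rule T_measurable[OF H(1)])
    have "X (L1_extension T f) \<le> X (\<lambda>x. of_real (cmod (L1_extension T f x)))"
      using m by (intro quasinorm_mono[OF X]) auto
    \<comment> \<open>Every \<open>T (H j)\<close> is bounded by the same quantity formed with
      \<open>f\<close>, so the lower limit in the Fatou property is bounded by it as well.\<close>
    also have "\<dots> \<le> ennreal C * sparse_sup X f"
    proof (rule quasinorm_Fatou[OF X])
      show "(\<lambda>x. cmod (T (H j) x)) \<in> borel_measurable lebesgue" for j by measurable
      show "0 \<le> cmod (T (H j) x)" for j x by simp
      show "(\<lambda>x. cmod (L1_extension T f x)) \<in> borel_measurable lebesgue" using m by measurable
      show "AE x in lebesgue. (\<lambda>j. cmod (T (H j) x)) \<longlonglongrightarrow> cmod (L1_extension T f x)"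
        using lim by eventually_elim (rule tendsto_norm)
      have "X (\<lambda>x. of_real (cmod (T (H j) x))) \<le> X (T (H j))" for j
        by (rule quasinorm_mono[OF X]) auto
      then show "X (\<lambda>x. of_real (cmod (T (H j) x))) \<le> ennreal C * sparse_sup X f" for j
        using C(2)[OF H(1) f H(2)] by (rule order_trans)
    qed
    finally show ?thesis .
  qed
  then show ?thesis using C(1) unfolding sparse_sup_def by blast
qed

end
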